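(* Let $m,n\ge1$ be integers and $d=m+n$. For every real $m\times n$ matrix $A$, uniformly in $k\ge0$, \[ M_A(\psi_{n/m}(2^k),2^k)=\frac{1}{N_A(\psi_{n/m}(2^k),2^k)}\asymp\Delta_k(A). \] Moreover, for $\mathcal L^m$-almost every $\mathbf b\in\mathbb T^m$, \[ \mathfrak c_A(\mathbf b)= \begin{cases} 0 & \text{if } \sum_k\Delta_k(A)=\infty,\\ +\infty & \text{if } \sum_k\Delta_k(A)<\infty. \end{cases} \] Equivalently, for every $\varepsilon>0$, the sets $\mathrm{Bad}_A(\varepsilon)$, $\mathrm{Bad}_A$ and $\mathrm{Bad}_A(\infty)$ are all $\mathcal L^m$-null in the first case and all $\mathcal L^m$-conull in the second case.
   Context: Norms $|\cdot|$ are supremum norms; $\mathbb T^m=\mathbb R^m/\mathbb Z^m$; $|\mathbf x|_{\mathbb Z^m}:=\min_{\mathbf p\in\mathbb Z^m}|\mathbf x-\mathbf p|$; $\mathcal L^m$ is normalized Lebesgue measure on $\mathbb T^m$. The sums are over integers $k\ge0$. For $\psi:(0,\infty)\to(0,\infty)$, $W_A(\psi)$ is the set of $\mathbf b\in\mathbb T^m$ such that $|A\mathbf q-\mathbf b|_{\mathbb Z^m}<\psi(|\mathbf q|)$ holds for infinitely many distinct $\mathbf q\in\mathbb Z^n\setminus\{\mathbf 0\}$. For $r,T>0$, \[ N_A(r,T):=\#\{(\mathbf p,\mathbf q)\in\mathbb Z^m\times\mathbb Z^n: |A\mathbf q-\mathbf p|\le r,\ |\mathbf q|\le T\},\qquad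 M_A(r,T):=\frac{r^mT^n}{N_A(r,T)}. \] Put $\psi_{n/m}(q):=q^{-n/m}$, \[ \mathfrak c_A(\mathbf b):=\liminf_{|\mathbf q|\to\infty,\ \mathbf q\in\mathbb Z^n}\frac{|A\mathbf q-\mathbf b|_{\mathbb Z^m}}{\psi_{n/m}(|\mathbf q|)}\in[0,+\infty], \] \[ \mathrm{Bad}_A:=\{\mathbf b\in\mathbb T^m:\mathfrak c_A(\mathbf b)>0\},\quad \mathrm{Bad}_A(\varepsilon):=\mathbb T^m\setminus W_A(\varepsilon\psi_{n/m})\ (\varepsilon>0),\quad \mathrm{Bad}_A(\infty):=\{\mathbf b\in\mathbb T^m:\mathfrak c_A(\mathbf b)=+\infty\}. \] Let \[ \Lambda_A=u_A\mathbb Z^d,\quad u_A=\begin{pmatrix}I_m&A\\0&I_n\end{pmatrix},\quad a_t=\begin{pmatrix}e^{t/m}I_m&0\\0&e^{-t/n}I_n\end{pmatrix}, \] and for a lattice $\Lambda\subset\mathbb R^d$ and $1\le i\le d$ let $\lambda_i(\Lambda):=\inf\{\rho>0:\Lambda\cap[-\rho,\rho]^d\text{ contains } i\text{ linearly independent vectors}\}$. Define \[ \Delta_k(A):=\prod_{i=1}^{d}\min\{1,\lambda_i(a_{nk\log 2}\Lambda_A)\}. \] $X\asymp Y$ means $C^{-1}Y\le X\le CY$ for a constant $C>0$ which may depend on $m,n,A$ (but here not on $k$). *)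

theory Defs
  imports "HOL-Analysis.Analysis"
begin

text \<open>
  The dimensions are \<open>m = CARD('m)\<close> and \<open>n = CARD('n)\<close>; the space \<open>\<real>\<^sup>d\<close> with \<open>d = m + n\<close> is
  \<^typ>\<open>real ^ ('m + 'n)\<close>. Integer vectors are elements of \<^typ>\<open>int ^ 'n\<close>, and the supremum norm
  is \<^const>\<open>infnorm\<close>.
\<close>

definition real_vec :: "int ^ 'k \<Rightarrow> real ^ 'k"
  where "real_vec q = (\<chi> i. real_of_int (q $ i))"

lemma real_vec_0: "real_vec 0 = 0"
  and real_vec_add: "real_vec (p + q) = real_vec p + real_vec q"
  and real_vec_diff: "real_vec (p - q) = real_vec p - real_vec q"
  and real_vec_minus: "real_vec (- p) = - real_vec p"
  by (simp_all add: real_vec_def vec_eq_iff)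


subsection \<open>The torus\<close>

definition torus_rel :: "real ^ 'm \<Rightarrow> real ^ 'm \<Rightarrow> bool"
  where "torus_rel x y \<longleftrightarrow> x - y \<in> range real_vec"

lemma equivp_torus_rel: "equivp torus_rel"
proof (rule equivpI)
  show "reflp torus_rel"
    by (auto simp: reflp_def torus_rel_def intro!: image_eqI[where x = 0] simp: real_vec_0)
  show "symp torus_rel"
  proof (rule sympI)
    fix x y :: "real ^ 'm" assume "torus_rel x y"
    then obtain p where "x - y = real_vec p" by (auto simp: torus_rel_def)
    then have "y - x = real_vec (- p)" by (simp add: real_vec_minus algebra_simps)
    then show "torus_rel y x" by (simp add: torus_rel_def)
  qed
  show "transp torus_rel"
  proof (rule transpI)
    fix x y z :: "real ^ 'm" assume "torus_rel x y" "torus_rel y z"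
    then obtain p q where "x - y = real_vec p" "y - z = real_vec q"
      by (auto simp: torus_rel_def)
    then have "x - z = real_vec (p + q)" by (simp add: real_vec_add algebra_simps)
    then show "torus_rel x z" by (simp add: torus_rel_def)
  qed
qed

quotient_type 'm torus = "real ^ 'm" / torus_rel
  by (rule equivp_torus_rel)

lift_definition to_torus :: "real ^ ('m::finite) \<Rightarrow> 'm torus" is "\<lambda>x. x" .

instantiation torus :: (finite) ab_group_add
begin

lift_definition zero_torus :: "'a torus" is 0 .

lift_definition plus_torus :: "'a torus \<Rightarrow> 'a torus \<Rightarrow> 'a torus" is "(+)"
proof -
  fix a b c d :: "real ^ 'a" assume "torus_rel a b" "torus_rel c d"
  then obtain p q where "a - b = real_vec p" "c - d = real_vec q"
    by (auto simp: torus_rel_def)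
  then have "(a + c) - (b + d) = real_vec (p + q)" by (simp add: real_vec_add algebra_simps)
  then show "torus_rel (a + c) (b + d)" by (simp add: torus_rel_def)
qed

lift_definition uminus_torus :: "'a torus \<Rightarrow> 'a torus" is uminus
proof -
  fix a b :: "real ^ 'a" assume "torus_rel a b"
  then obtain p where "a - b = real_vec p" by (auto simp: torus_rel_def)
  then have "- a - - b = real_vec (- p)" by (simp add: real_vec_minus algebra_simps)
  then show "torus_rel (- a) (- b)" by (simp add: torus_rel_def)
qed

lift_definition minus_torus :: "'a torus \<Rightarrow> 'a torus \<Rightarrow> 'a torus" is "(-)"
proof -
  fix a b c d :: "real ^ 'a" assume "torus_rel a b" "torus_rel c d"
  then obtain p q where "a - b = real_vec p" "c - d = real_vec q"
    by (auto simp: torus_rel_def)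
  then have "(a - c) - (b - d) = real_vec (p - q)" by (simp add: real_vec_diff algebra_simps)
  then show "torus_rel (a - c) (b - d)" by (simp add: torus_rel_def)
qed

instance
proof
  have eq: "torus_rel x y" if "x = y" for x y :: "real ^ 'a"
    using that equivp_reflp[OF equivp_torus_rel] by simp
  fix a b c :: "'a torus"
  show "a + b + c = a + (b + c)" by transfer (rule eq, simp)
  show "a + b = b + a" by transfer (rule eq, simp)
  show "0 + a = a" by transfer (rule eq, simp)
  show "- a + a = 0" by transfer (rule eq, simp)
  show "a - b = a + - b" by transfer (rule eq, simp)
qed

end

text \<open>The distance to the nearest integer vector; the infimum is attained.\<close>

lift_definition znorm :: "('m::finite) torus \<Rightarrow> real" is "\<lambda>x. INF p. infnorm (x - real_vec p)"
proof -
  fix x y :: "real ^ 'm" assume "torus_rel x y"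
  then obtain r where r: "x - y = real_vec r" by (auto simp: torus_rel_def)
  have "range (\<lambda>p. infnorm (x - real_vec p)) = range (\<lambda>p. infnorm (y - real_vec p))"
  proof (intro equalityI subsetI; elim rangeE)
    fix t p assume "t = infnorm (x - real_vec p)"
    moreover have "x - real_vec p = y - real_vec (p - r)"
      using r by (simp add: real_vec_diff algebra_simps)
    ultimately show "t \<in> range (\<lambda>p. infnorm (y - real_vec p))" by simp
  next
    fix t p assume "t = infnorm (y - real_vec p)"
    moreover have "y - real_vec p = x - real_vec (p + r)"
      using r by (simp add: real_vec_add algebra_simps)
    ultimately show "t \<in> range (\<lambda>p. infnorm (x - real_vec p))" by simp
  qed
  then show "(INF p. infnorm (x - real_vec p)) = (INF p. infnorm (y - real_vec p))"
    by simp
qed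

text \<open>
  Lebesgue measure on the torus: the image under the projection of Lebesgue measure on the
  fundamental domain \<open>[0,1)\<^sup>m\<close>, on the sets whose preimage in \<open>\<real>\<^sup>m\<close> is Lebesgue measurable.
\<close>

definition torus_measure :: "('m::finite) torus measure"
  where "torus_measure =
    distr (restrict_space lebesgue {x :: real ^ 'm. \<forall>i. 0 \<le> x $ i \<and> x $ i < 1})
      (sigma UNIV {S. to_torus -` S \<in> sets lebesgue}) to_torus"

lemma space_torus_measure [simp]: "space torus_measure = UNIV"
  by (simp add: torus_measure_def)

lemma sets_torus_measure:
  "sets torus_measure = {S :: 'm::finite torus set. to_torus -` S \<in> sets lebesgue}"
proof -
  have "sigma_algebra UNIV {S :: 'm torus set. to_torus -` S \<in> sets lebesgue}"
    unfolding sigma_algebra_iff2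
    by (auto simp: vimage_Diff vimage_UN intro!: sets.countable_UN sets.Diff)
  then show ?thesis
    by (simp add: torus_measure_def sigma_algebra.sigma_sets_eq)
qed

lemma unit_cube_lmeasurable:
  "{x :: real ^ 'm. \<forall>i. 0 \<le> x $ i \<and> x $ i < 1} \<in> sets lebesgue"
proof -
  have "{x :: real ^ 'm. \<forall>i. 0 \<le> x $ i \<and> x $ i < 1} \<in> sets borel"
    by measurable
  then show ?thesis by (simp add: lborelD)
qed

lemma emeasure_torus_measure:
  fixes S :: "'m::finite torus set"
  assumes "S \<in> sets torus_measure"
  shows "emeasure torus_measure S =
    emeasure lebesgue (to_torus -` S \<inter> {x :: real ^ 'm. \<forall>i. 0 \<le> x $ i \<and> x $ i < 1})"
proof -
  let ?C = "{x :: real ^ 'm. \<forall>i. 0 \<le> x $ i \<and> x $ i < 1}"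
  let ?M = "sigma UNIV {S :: 'm torus set. to_torus -` S \<in> sets lebesgue}"
  have sets_M: "sets ?M = {S. to_torus -` S \<in> sets lebesgue}"
    using sets_torus_measure by (simp add: torus_measure_def)
  have "to_torus \<in> restrict_space lebesgue ?C \<rightarrow>\<^sub>M ?M"
    unfolding measurable_def
    using unit_cube_lmeasurable
    by (auto simp: sets_M space_restrict_space sets_restrict_space)
  then show ?thesis
    using assms unit_cube_lmeasurable
    by (simp add: torus_measure_def emeasure_distr emeasure_restrict_space space_restrict_space
        vimage_def)
qed

lemma emeasure_torus_measure_UNIV:
  "emeasure (torus_measure :: 'm::finite torus measure) UNIV = 1"
proof -
  let ?C = "{x :: real ^ 'm. \<forall>i. 0 \<le> x $ i \<and> x $ i < 1}"
  have "emeasure lebesgue (box 0 (1 :: real ^ 'm)) \<le> emeasure lebesgue ?C"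
    using unit_cube_lmeasurable by (intro emeasure_mono) (auto simp: mem_box_cart less_imp_le)
  moreover have "emeasure lebesgue ?C \<le> emeasure lebesgue (cbox 0 (1 :: real ^ 'm))"
    by (intro emeasure_mono) (auto simp: mem_box_cart less_imp_le)
  moreover have "(1 :: real ^ 'm) \<bullet> b = 1" if "b \<in> Basis" for b
    using that by (auto simp: Basis_vec_def inner_axis)
  then have "emeasure lebesgue (box 0 (1 :: real ^ 'm)) = 1"
      "emeasure lebesgue (cbox 0 (1 :: real ^ 'm)) = 1"
    by (simp_all add: emeasure_lborel_box_eq emeasure_lborel_cbox_eq)
  ultimately have "emeasure lebesgue ?C = 1" by simp
  moreover have "UNIV \<in> sets (torus_measure :: 'm torus measure)"
    by (simp add: sets_torus_measure)
  ultimately show ?thesis by (simp add: emeasure_torus_measure)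
qed


subsection \<open>Inhomogeneous approximation\<close>

definition approx_set :: "real ^ 'n ^ 'm \<Rightarrow> (real \<Rightarrow> real) \<Rightarrow> 'm torus set"
  where "approx_set A \<psi> = {b. infinite {q :: int ^ 'n. q \<noteq> 0 \<and>
    znorm (to_torus (A *v real_vec q) - b) < \<psi> (infnorm (real_vec q))}}"

definition count_N :: "real ^ 'n ^ 'm \<Rightarrow> real \<Rightarrow> real \<Rightarrow> nat"
  where "count_N A r T = card {(p :: int ^ 'm, q :: int ^ 'n).
    infnorm (A *v real_vec q - real_vec p) \<le> r \<and> infnorm (real_vec q) \<le> T}"

definition ratio_M :: "real ^ 'n ^ 'm \<Rightarrow> real \<Rightarrow> real \<Rightarrow> real"
  where "ratio_M A r T = r ^ CARD('m) * T ^ CARD('n) / real (count_N A r T)"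

definition psi :: "real \<Rightarrow> real \<Rightarrow> real"
  where "psi s q = q powr (- s)"

definition c_inf :: "real ^ 'n ^ 'm \<Rightarrow> 'm torus \<Rightarrow> ereal"
  where "c_inf A b =
    Liminf (filtercomap (\<lambda>q :: int ^ 'n. infnorm (real_vec q)) at_top)
      (\<lambda>q. ereal (znorm (to_torus (A *v real_vec q) - b)
                  / psi (CARD('n) / CARD('m)) (infnorm (real_vec q))))"

definition Bad :: "real ^ 'n ^ 'm \<Rightarrow> 'm torus set"
  where "Bad A = {b. c_inf A b > 0}"

definition Bad_eps :: "real ^ 'n ^ 'm \<Rightarrow> real \<Rightarrow> 'm torus set"
  where "Bad_eps A \<epsilon> = UNIV - approx_set A (\<lambda>q. \<epsilon> * psi (CARD('n) / CARD('m)) q)"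

definition Bad_infinity :: "real ^ 'n ^ 'm \<Rightarrow> 'm torus set"
  where "Bad_infinity A = {b. c_inf A b = \<infinity>}"


subsection \<open>Lattices and successive minima\<close>

definition block_mat ::
    "real ^ 'm ^ 'm \<Rightarrow> real ^ 'n ^ 'm \<Rightarrow> real ^ 'm ^ 'n \<Rightarrow> real ^ 'n ^ 'n \<Rightarrow>
     real ^ ('m + 'n) ^ ('m + 'n)"
  where "block_mat P Q R S = (\<chi> i j.
    case i of
      Inl i' \<Rightarrow> (case j of Inl j' \<Rightarrow> P $ i' $ j' | Inr j' \<Rightarrow> Q $ i' $ j')
    | Inr i' \<Rightarrow> (case j of Inl j' \<Rightarrow> R $ i' $ j' | Inr j' \<Rightarrow> S $ i' $ j'))"

definition u_mat :: "real ^ 'n ^ 'm \<Rightarrow> real ^ ('m + 'n) ^ ('m + 'n)"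
  where "u_mat A = block_mat (mat 1) A 0 (mat 1)"

definition a_mat :: "real \<Rightarrow> real ^ ('m::finite + 'n::finite) ^ ('m + 'n)"
  where "a_mat t = block_mat (mat (exp (t / CARD('m)))) 0 0 (mat (exp (- t / CARD('n))))"

definition lattice_of :: "real ^ 'n ^ 'm \<Rightarrow> (real ^ ('m + 'n)) set"
  where "lattice_of A = range (\<lambda>z. u_mat A *v real_vec z)"

definition succ_min :: "nat \<Rightarrow> (real ^ 'k) set \<Rightarrow> real"
  where "succ_min i L = Inf {\<rho>. \<rho> > 0 \<and>
    (\<exists>S \<subseteq> L \<inter> cbox (vec (- \<rho>)) (vec \<rho>). independent S \<and> card S = i)}"

definition Delta :: "real ^ 'n ^ 'm \<Rightarrow> nat \<Rightarrow> real"
  where "Delta A k = (\<Prod>i = 1..CARD('m) + CARD('n).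
    min 1 (succ_min i ((*v) (a_mat (real CARD('n) * real k * ln 2)) ` lattice_of A)))"

end

(*
  The asymptotics of N follow by iterating a covering estimate over the successive minima (upper
  bound) and by counting integer combinations of short independent vectors (lower bound).

  Write r_k = 2^(-kn/m), N_k = N(r_k, 2^k) and x_k = 1/N_k. Next to one approximation A q of b at
  scale k there are at least N_k of them at comparable scales, so by Markov's inequality the set of b
  approximable at scale k has measure O(x_k), and the convergence case is the Borel-Cantelli lemma.

  In the divergence case let f_k(b) count the approximations of b at scale k and Z_K be the sum of
  x_k f_k over k < K. For k <= l the correlation of f_k and f_l is bounded by the ratio R_kl of
  N(r_k, 2^l) to the volume of the box. If the box spans, then R_kl = O(1). Otherwise its points lie
  in a hyperplane, and covering them by boxes of scale j shows R_kl = O(rho^min(j-k, l-j) N_j) for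
  all k <= j <= l with some rho < 1. This suffices to sum x_k x_l R_kl over the nonspanning pairs to
  O(sum of x_k), whence E(Z_K^2) = O((E Z_K)^2), and the Paley-Zygmund inequality gives positive
  measure of approximable b. The same hyperplane bound shows that A Z^n + Z^m is dense if the series
  diverges, and a zero-one law for invariant sets under dense translations gives full measure.
*)

theory Submission
  imports Defs
begin

section \<open>Counting lattice points by successive minima\<close>

text \<open>Approximations come in clusters: for fixed epsilon E f_k has order 1, but where f_k is
  nonzero it tends to have size about N_k. The weight x_k makes f_k resemble the indicator of an
  event of probability x_k, and the diagonal of the second moment, where R_kk = N_k, contributes
  only x_k per scale. A spanning box puts an approximation near every point, so averaging over the
  torus bounds its count. For a nonspanning box the intermediate scale j is free: j = k and j = l
  give x_k x_l R_kl = O(min(x_k, x_l)), and the other j show that, among scales where x is at most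
  x_k, the correlations of k with j and with l > j cannot both be comparable with x_k unless j is
  near k or near l. This takes the place of decay of R_kl itself. Two obstacles remain. For a fixed
  epsilon the limsup set need not be invariant under A Z^n + Z^m; a shift eventually at most doubles
  |q|, so it costs epsilon a factor 2^(n/m), which is harmless as epsilon is arbitrary. And
  infinitely many successful scales might all use one pair (p, q); that is possible only on the
  countable set A Z^n + Z^m.\<close>

lemma card_le_mult_fibres:
  fixes X Y :: "'a::ab_group_add set"
  assumes "finite Y" "finite K" "f ` X \<subseteq> K"
    and diff: "\<And>x y. x \<in> X \<Longrightarrow> y \<in> X \<Longrightarrow> f x = f y \<Longrightarrow> x - y \<in> Y"
  shows "card X \<le> card K * card Y"
proof -
  have fib: "card {x \<in> X. f x = c} \<le> card Y" for c
  proof (cases "{x \<in> X. f x = c} = {}")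
    case True
    then show ?thesis by (metis card.empty le0)
  next
    case False
    then obtain x0 where x0: "x0 \<in> X" "f x0 = c" by auto
    have "(\<lambda>x. x - x0) ` {x \<in> X. f x = c} \<subseteq> Y"
      using x0 diff by auto
    moreover have "inj_on (\<lambda>x. x - x0) {x \<in> X. f x = c}"
      by (auto intro: inj_onI)
    ultimately show ?thesis
      using card_inj_on_le \<open>finite Y\<close> by blast
  qed
  have "X = (\<Union>c\<in>K. {x \<in> X. f x = c})"
    using assms(3) by auto
  then have "card X \<le> (\<Sum>c\<in>K. card {x \<in> X. f x = c})"
    using card_UN_le[OF \<open>finite K\<close>] by metis
  also have "\<dots> \<le> (\<Sum>c\<in>K. card Y)"
    by (intro sum_mono fib)
  finally show ?thesis by simp
qed

lemma card_floor_range: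
  fixes a :: real
  assumes "0 \<le> a"
  shows "real (card {\<lfloor>- a\<rfloor>..\<lfloor>a\<rfloor>}) \<le> 2 * a + 2"
proof -
  have "\<lfloor>- a\<rfloor> \<le> \<lfloor>a\<rfloor>" using assms by (intro floor_mono) simp
  then have "real (card {\<lfloor>- a\<rfloor>..\<lfloor>a\<rfloor>}) = real_of_int (\<lfloor>a\<rfloor> - \<lfloor>- a\<rfloor> + 1)" by simp
  then show ?thesis by linarith
qed

text \<open>Pigeonhole: points in a common cell of sides \<open>t\<close> have their difference in
  \<open>Y\<close>. The functionals \<open>\<phi>\<close> stay arbitrary because the applications
  subdivide different directions: an orthonormal basis of a subspace, all coordinates, all but one,
  or only the first block.\<close>

lemma card_le_cells:
  fixes \<phi> :: "'i \<Rightarrow> 'a::ab_group_add \<Rightarrow> real"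
  assumes I: "finite I" and Y: "finite Y"
    and \<phi>: "\<And>i x y. i \<in> I \<Longrightarrow> \<phi> i (x - y) = \<phi> i x - \<phi> i y"
    and t: "\<And>i. i \<in> I \<Longrightarrow> t i > 0"
    and M: "\<And>x i. x \<in> X \<Longrightarrow> i \<in> I \<Longrightarrow> \<bar>\<phi> i x\<bar> \<le> M i"
    and M0: "\<And>i. i \<in> I \<Longrightarrow> 0 \<le> M i"
    and diff: "\<And>x y. x \<in> X \<Longrightarrow> y \<in> X \<Longrightarrow> (\<And>i. i \<in> I \<Longrightarrow> \<bar>\<phi> i (x - y)\<bar> < t i) \<Longrightarrow> x - y \<in> Y"
  shows "real (card X) \<le> (\<Prod>i\<in>I. 2 * M i / t i + 2) * real (card Y)"
proof -
  define f where "f x = (\<lambda>i\<in>I. \<lfloor>\<phi> i x / t i\<rfloor>)" for x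
  define K where "K = (PiE I (\<lambda>i. {\<lfloor>- (M i / t i)\<rfloor>..\<lfloor>M i / t i\<rfloor>}))"
  have "card X \<le> card K * card Y"
  proof (rule card_le_mult_fibres[where f = f])
    show "f ` X \<subseteq> K"
    proof
      fix z assume "z \<in> f ` X"
      then obtain x where x: "x \<in> X" "z = f x" by auto
      have "\<lfloor>- (M i / t i)\<rfloor> \<le> \<lfloor>\<phi> i x / t i\<rfloor> \<and> \<lfloor>\<phi> i x / t i\<rfloor> \<le> \<lfloor>M i / t i\<rfloor>" if "i \<in> I" for i
      proof -
        have "- M i \<le> \<phi> i x" "\<phi> i x \<le> M i" using M[OF x(1) that] by auto
        then have "- M i / t i \<le> \<phi> i x / t i" "\<phi> i x / t i \<le> M i / t i"
          using t[OF that] divide_right_mono[of _ _ "t i"] by (simp_all only: less_imp_le)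
        then show ?thesis by (auto intro!: floor_mono)
      qed
      then show "z \<in> K" unfolding x f_def K_def by auto
    qed
    show "finite K" unfolding K_def using I by (intro finite_PiE) auto
    fix x y assume xy: "x \<in> X" "y \<in> X" "f x = f y"
    show "x - y \<in> Y"
    proof (rule diff[OF xy(1,2)])
      fix i assume i: "i \<in> I"
      then have "\<lfloor>\<phi> i x / t i\<rfloor> = \<lfloor>\<phi> i y / t i\<rfloor>"
        using fun_cong[OF xy(3), of i] by (simp add: f_def)
      then have "\<bar>\<phi> i x / t i - \<phi> i y / t i\<bar> < 1" by linarith
      moreover have "\<phi> i x / t i - \<phi> i y / t i = \<phi> i (x - y) / t i"
        using \<phi>[OF i] by (simp add: diff_divide_distrib)
      ultimately show "\<bar>\<phi> i (x - y)\<bar> < t i"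
        using t[OF i] by (simp add: field_simps)
    qed
  qed fact
  then have "real (card X) \<le> real (card K) * real (card Y)"
    by (metis of_nat_le_iff of_nat_mult)
  also have "real (card K) = (\<Prod>i\<in>I. real (card {\<lfloor>- (M i / t i)\<rfloor>..\<lfloor>M i / t i\<rfloor>}))"
    unfolding K_def using I by (simp add: card_PiE)
  also have "\<dots> \<le> (\<Prod>i\<in>I. 2 * M i / t i + 2)"
  proof (intro prod_mono conjI)
    fix i assume "i \<in> I"
    then have "0 \<le> M i / t i" using t M0 by (simp add: less_imp_le)
    from card_floor_range[OF this]
    show "real (card {\<lfloor>- (M i / t i)\<rfloor>..\<lfloor>M i / t i\<rfloor>}) \<le> 2 * M i / t i + 2" by simp
  qed simp
  finally show ?thesis by (simp add: mult_right_mono)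
qed

lemma infnorm_le_iff: "infnorm (x :: real ^ 'k) \<le> r \<longleftrightarrow> (\<forall>i. \<bar>x $ i\<bar> \<le> r)"
proof
  assume "infnorm x \<le> r"
  then show "\<forall>i. \<bar>x $ i\<bar> \<le> r" using component_le_infnorm_cart order_trans by blast
next
  assume *: "\<forall>i. \<bar>x $ i\<bar> \<le> r"
  show "infnorm x \<le> r"
    unfolding infnorm_cart by (rule cSup_least) (use * in auto)
qed

definition boxp :: "(real ^ 'k) set \<Rightarrow> ('k \<Rightarrow> real) \<Rightarrow> (real ^ 'k) set"
  where "boxp L S = {x \<in> L. \<forall>i. \<bar>x $ i\<bar> \<le> S i}"

text \<open>Discreteness is encoded as finiteness in every cube and full rank as a spanning
  condition, so that no lattice basis has to be chosen.\<close>

locale full_lattice =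
  fixes L :: "(real ^ 'k) set"
  assumes zero_mem: "0 \<in> L"
    and diff_mem: "x \<in> L \<Longrightarrow> y \<in> L \<Longrightarrow> x - y \<in> L"
    and finite_cube: "finite (boxp L (\<lambda>_. \<rho>))"
    and span_eq: "span L = UNIV"
begin

lemma minus_mem: "x \<in> L \<Longrightarrow> - x \<in> L"
  using diff_mem[OF zero_mem] by simp

lemma add_mem: "x \<in> L \<Longrightarrow> y \<in> L \<Longrightarrow> x + y \<in> L"
  using diff_mem[of x "- y"] minus_mem by simp

lemma sum_mem: "(\<And>i. i \<in> I \<Longrightarrow> f i \<in> L) \<Longrightarrow> sum f I \<in> L"
  by (induction I rule: infinite_finite_induct) (auto simp: zero_mem add_mem)

lemma of_nat_mem: "x \<in> L \<Longrightarrow> real n *\<^sub>R x \<in> L"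
  by (induction n) (auto simp: zero_mem add_mem algebra_simps)

lemma of_int_mem: "x \<in> L \<Longrightarrow> of_int z *\<^sub>R x \<in> L"
  by (cases z rule: int_cases2) (use of_nat_mem minus_mem in force)+

lemma finite_boxp: "finite (boxp L S)"
proof (rule finite_subset[OF _ finite_cube])
  show "boxp L S \<subseteq> boxp L (\<lambda>_. Max (range S))"
    by (auto simp: boxp_def intro: order_trans Max_ge)
qed

lemma card_boxp_pos: "(\<And>i. 0 \<le> S i) \<Longrightarrow> card (boxp L S) > 0"
  using finite_boxp zero_mem by (auto simp: card_gt_0_iff boxp_def)

lemma boxp_mono: "(\<And>i. S i \<le> S' i) \<Longrightarrow> boxp L S \<subseteq> boxp L S'"
  by (auto simp: boxp_def intro: order_trans)

lemma card_boxp_mono: "(\<And>i. S i \<le> S' i) \<Longrightarrow> card (boxp L S) \<le> card (boxp L S')"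
  by (intro card_mono finite_boxp boxp_mono)

abbreviation N :: "real \<Rightarrow> nat" where "N \<rho> \<equiv> card (boxp L (\<lambda>_. \<rho>))"

text \<open>Only directions in the span of the points of the larger cube are subdivided, so the
  exponent is the rank there instead of \<open>CARD('k)\<close>. This exponent is what lets the
  losses in the induction over the minima match the product.\<close>

lemma card_cube_le_dim:
  assumes r: "0 < r" "r \<le> R"
  shows "real (N R) \<le> (4 * real CARD('k) ^ 2 * R / r) ^ dim (boxp L (\<lambda>_. R)) * real (N r)"
proof -
  let ?d = "real CARD('k)"
  have d1: "?d \<ge> 1" by (simp add: Suc_leI)
  let ?V = "span (boxp L (\<lambda>_. R))"
  obtain B where B: "B \<subseteq> ?V" "pairwise orthogonal B" "\<And>x. x \<in> B \<Longrightarrow> norm x = 1"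
      "independent B" "card B = dim ?V" "span B = ?V"
    using orthonormal_basis_subspace[OF subspace_span] by blast
  have finB: "finite B" using B(4) independent_imp_finite by blast
  have cardB: "card B = dim (boxp L (\<lambda>_. R))" using B(5) by simp
  have cardB_le: "card B \<le> CARD('k)"
    using cardB dim_subset_UNIV[of "boxp L (\<lambda>_. R)"] by simp
  have norm_le: "norm x \<le> ?d * R" if "x \<in> boxp L (\<lambda>_. R)" for x
  proof -
    have "norm x \<le> (\<Sum>i\<in>UNIV. \<bar>x $ i\<bar>)" by (rule norm_le_l1_cart)
    also have "\<dots> \<le> (\<Sum>i\<in>(UNIV :: 'k set). R)" using that by (intro sum_mono) (auto simp: boxp_def)
    finally show ?thesis by simp
  qed
  \<comment> \<open>Cells of side \<open>r / ?d\<close> suffice: at most \<open>?d\<close>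
    orthonormal coordinates, each below \<open>r / ?d\<close>, give norm at most \<open>r\<close>,
    which bounds the supremum norm.\<close>
  have "real (N R) \<le> (\<Prod>b\<in>B. 2 * (?d * R) / (r / ?d) + 2) * real (N r)"
  proof (rule card_le_cells[where \<phi> = "\<lambda>b x. x \<bullet> b"])
    fix x b assume x: "x \<in> boxp L (\<lambda>_. R)" and b: "b \<in> B"
    have "\<bar>x \<bullet> b\<bar> \<le> norm x * norm b" by (rule Cauchy_Schwarz_ineq2)
    then show "\<bar>x \<bullet> b\<bar> \<le> ?d * R" using norm_le[OF x] B(3)[OF b] by simp
  next
    fix x y assume x: "x \<in> boxp L (\<lambda>_. R)" and y: "y \<in> boxp L (\<lambda>_. R)"
      and small: "\<And>b. b \<in> B \<Longrightarrow> \<bar>(x - y) \<bullet> b\<bar> < r / ?d"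
    have "x - y \<in> ?V" using x y by (intro span_diff span_base)
    then have "x - y \<in> span B" using B(6) by simp
    then have eq: "x - y = (\<Sum>b\<in>B. ((x - y) \<bullet> b / (b \<bullet> b)) *\<^sub>R b)"
      using B(2) finB orthonormal_basis_expand[OF _ _ _ finB, of "x - y"] B(3)
      by (smt (verit, del_insts) div_by_1 dot_square_norm one_power2 pairwise_def sum.cong)
    have "norm (x - y) \<le> (\<Sum>b\<in>B. norm (((x - y) \<bullet> b / (b \<bullet> b)) *\<^sub>R b))"
      by (subst eq) (rule norm_sum)
    also have "\<dots> \<le> (\<Sum>b\<in>B. r / ?d)"
      using small B(3) by (intro sum_mono) (auto simp: dot_square_norm less_imp_le)
    also have "\<dots> = real (card B) * (r / ?d)" by simp
    also have "\<dots> \<le> ?d * (r / ?d)"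
      using cardB_le r by (intro mult_right_mono) auto
    also have "\<dots> = r" using d1 by simp
    finally have "norm (x - y) \<le> r" .
    then have "\<forall>i. \<bar>(x - y) $ i\<bar> \<le> r" using component_le_norm_cart order_trans by blast
    then show "x - y \<in> boxp L (\<lambda>_. r)" using x y diff_mem by (auto simp: boxp_def)
  qed (use finB finite_boxp r d1 in \<open>auto simp: inner_diff_left\<close>)
  also have "(\<Prod>b\<in>B. 2 * (?d * R) / (r / ?d) + 2) = (2 * ?d^2 * R / r + 2) ^ card B"
    by (simp add: power2_eq_square mult_ac)
  also have "\<dots> \<le> (4 * ?d^2 * R / r) ^ card B"
  proof (intro power_mono)
    have "1 * 1 \<le> ?d^2 * (R / r)" using d1 r by (intro mult_mono) auto
    moreover have "2 * ?d^2 * R / r = 2 * (?d^2 * (R / r))" "4 * ?d^2 * R / r = 4 * (?d^2 * (R / r))"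
      by simp_all
    ultimately show "2 * ?d^2 * R / r + 2 \<le> 4 * ?d^2 * R / r" by linarith
  qed (use r in auto)
  finally show ?thesis unfolding cardB by (simp add: mult_right_mono)
qed

end

context full_lattice
begin

section \<open>Successive minima and the number of points in a cube\<close>

lemma succ_min_alt:
  "succ_min i L = Inf {\<rho>. \<rho> > 0 \<and> (\<exists>S \<subseteq> boxp L (\<lambda>_. \<rho>). independent S \<and> card S = i)}"
proof -
  have "L \<inter> cbox (vec (- \<rho>)) (vec \<rho>) = boxp L (\<lambda>_. \<rho>)" for \<rho>
    by (auto simp: boxp_def mem_box_cart abs_le_iff minus_le_iff)
  then show ?thesis unfolding succ_min_def by simp
qed

lemma minima_bdd_below:
  "bdd_below {\<rho>. \<rho> > 0 \<and> (\<exists>S \<subseteq> boxp L (\<lambda>_. \<rho>). independent S \<and> card S = i)}"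
  by (rule bdd_belowI[of _ 0]) auto

lemma minima_nonempty:
  assumes "i \<le> CARD('k)"
  shows "{\<rho>. \<rho> > 0 \<and> (\<exists>S \<subseteq> boxp L (\<lambda>_. \<rho>). independent S \<and> card S = i)} \<noteq> {}"
proof -
  obtain B where B: "B \<subseteq> L" "independent B" "L \<subseteq> span B" "card B = dim L"
    using basis_exists by metis
  have "dim L = CARD('k)" using span_eq dim_span[of L] by (metis dim_UNIV DIM_cart DIM_real mult_1_right dimension_def)
  then obtain S where S: "S \<subseteq> B" "card S = i"
    using assms B(4) by (metis obtain_subset_with_card_n)
  have fin: "finite S" using S B(2) independent_imp_finite finite_subset by blast
  define \<rho> where "\<rho> = 1 + (\<Sum>x\<in>S. norm x)"
  have "S \<subseteq> boxp L (\<lambda>_. \<rho>)"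
  proof
    fix x assume x: "x \<in> S"
    have "norm x \<le> (\<Sum>x\<in>S. norm x)" using fin x by (intro member_le_sum) auto
    then have "\<bar>x $ i\<bar> \<le> \<rho>" for i
      using component_le_norm_cart[of x i] by (simp add: \<rho>_def)
    then show "x \<in> boxp L (\<lambda>_. \<rho>)" using x S B by (auto simp: boxp_def)
  qed
  moreover have "\<rho> > 0" unfolding \<rho>_def by (smt (verit) norm_ge_zero sum_nonneg)
  moreover have "independent S" using S B(2) independent_mono by blast
  ultimately show ?thesis using S(2) by blast
qed

lemma succ_min_le:
  assumes "\<rho> > 0" "i \<le> dim (boxp L (\<lambda>_. \<rho>))"
  shows "succ_min i L \<le> \<rho>"
proof -
  obtain B where B: "B \<subseteq> boxp L (\<lambda>_. \<rho>)" "independent B" "card B = dim (boxp L (\<lambda>_. \<rho>))"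
    using basis_exists by metis
  then obtain S where S: "S \<subseteq> B" "card S = i"
    using assms(2) by (metis obtain_subset_with_card_n)
  then have "S \<subseteq> boxp L (\<lambda>_. \<rho>)" "independent S"
    using B independent_mono by blast+
  then show ?thesis
    unfolding succ_min_alt using assms(1) S(2)
    by (intro cInf_lower minima_bdd_below) blast
qed

lemma succ_min_less_imp:
  assumes "i \<le> CARD('k)" "succ_min i L < \<rho>"
  obtains S where "S \<subseteq> boxp L (\<lambda>_. \<rho>)" "independent S" "card S = i"
proof -
  from cInf_lessD[OF minima_nonempty[OF assms(1)] assms(2)[unfolded succ_min_alt]]
  obtain \<rho>' S where "\<rho>' < \<rho>" "S \<subseteq> boxp L (\<lambda>_. \<rho>')" "independent S" "card S = i" by auto
  moreover have "boxp L (\<lambda>_. \<rho>') \<subseteq> boxp L (\<lambda>_. \<rho>)"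
    using calculation by (intro boxp_mono) auto
  ultimately show ?thesis using that by blast
qed

lemma succ_min_pos:
  assumes "1 \<le> i" "i \<le> CARD('k)"
  shows "succ_min i L > 0"
proof -
  \<comment> \<open>The extra 1 keeps \<open>P\<close> nonempty and is the lower bound used for
    radii above 1.\<close>
  define P where "P = insert 1 (infnorm ` (boxp L (\<lambda>_. 1) - {0}))"
  have P: "finite P" "P \<noteq> {}" unfolding P_def using finite_boxp by auto
  have "\<forall>y\<in>P. 0 < y" unfolding P_def by (auto simp: infnorm_pos_lt)
  then have Min0: "0 < Min P" using P by simp
  have "Min P \<le> succ_min i L"
    unfolding succ_min_alt
  proof (rule cInf_greatest[OF minima_nonempty[OF assms(2)]])
    fix \<rho> assume "\<rho> \<in> {\<rho>. \<rho> > 0 \<and> (\<exists>S \<subseteq> boxp L (\<lambda>_. \<rho>). independent S \<and> card S = i)}"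
    then obtain S where S: "\<rho> > 0" "S \<subseteq> boxp L (\<lambda>_. \<rho>)" "independent S" "card S = i" by auto
    then have "S \<noteq> {}" using assms by auto
    then obtain x where x: "x \<in> S" by auto
    then have "x \<noteq> 0" using S(3) dependent_zero by blast
    show "Min P \<le> \<rho>"
    proof (cases "\<rho> \<le> 1")
      case True
      then have "x \<in> boxp L (\<lambda>_. 1)" using x S(2) boxp_mono[of "\<lambda>_. \<rho>" "\<lambda>_. 1"] by blast
      then have "infnorm x \<in> P" using \<open>x \<noteq> 0\<close> by (auto simp: P_def)
      then have "Min P \<le> infnorm x" using P by simp
      also have "\<dots> \<le> \<rho>" using x S(2) by (auto simp: infnorm_le_iff boxp_def)
      finally show ?thesis .
    next
      case False
      have "Min P \<le> 1" using P by (intro Min_le) (auto simp: P_def)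
      then show ?thesis using False by simp
    qed
  qed
  then show ?thesis using Min0 by simp
qed

text \<open>Induction on a bound \<open>i\<close> for the rank. Shrinking the cube to radius at most
  half of \<open>succ_min (Suc i) L\<close> lowers the rank to \<open>i\<close> and costs
  \<open>s ^ Suc i\<close>, where \<open>s\<close> is the maximum of 1 and
  \<open>\<rho> / succ_min (Suc i) L\<close>. One \<open>s\<close> pays for the new factor; the
  other \<open>i\<close> turn each earlier factor at the small radius into the one at
  \<open>\<rho>\<close>.\<close>

lemma card_cube_le_minima:
  assumes "\<rho> > 0" "dim (boxp L (\<lambda>_. \<rho>)) \<le> i" "i \<le> CARD('k)"
  shows "real (N \<rho>) \<le> ((8 * real CARD('k) ^ 2) ^ CARD('k)) ^ i * (\<Prod>j=1..i. max 1 (\<rho> / succ_min j L))"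
  using assms
proof (induction i arbitrary: \<rho>)
  case 0
  then have "boxp L (\<lambda>_. \<rho>) \<subseteq> {0}" by (simp add: dim_eq_0)
  then have "N \<rho> \<le> card {0 :: real ^ 'k}" by (intro card_mono) auto
  then show ?case by simp
next
  case (Suc i)
  let ?lam = "\<lambda>j. succ_min j L"
  let ?c = "8 * real CARD('k) ^ 2"
  have "real CARD('k) ^ 2 \<ge> 1" by (intro one_le_power) (simp add: Suc_leI)
  then have c1: "?c \<ge> 1" by linarith
  have lam: "?lam (Suc i) > 0" using Suc.prems by (intro succ_min_pos) auto
  \<comment> \<open>One covering step. Halving the radius makes it strictly smaller than the
    minimum, and this 2 turns the 4 of \<open>card_cube_le_dim\<close> into the 8 of
    \<open>?c\<close>.\<close>
  have key: "real (N \<rho>) \<le> (?c * s) ^ Suc i * (((?c ^ CARD('k)) ^ i) * (\<Prod>j=1..i. max 1 (\<rho> / s / 2 / ?lam j)))"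
    if s: "s \<ge> 1" and less: "\<rho> / s / 2 < ?lam (Suc i)" for s
  proof -
    let ?r = "\<rho> / s / 2"
    have r: "0 < ?r" "?r \<le> \<rho>" using s Suc.prems(1) by (auto simp: field_simps)
    have "\<not> Suc i \<le> dim (boxp L (\<lambda>_. ?r))"
      using succ_min_le[OF r(1), of "Suc i"] less by auto
    then have IH: "real (N ?r) \<le> ((?c ^ CARD('k)) ^ i) * (\<Prod>j=1..i. max 1 (?r / ?lam j))"
      using Suc.prems r by (intro Suc.IH) auto
    have "real (N \<rho>) \<le> (4 * real CARD('k) ^ 2 * \<rho> / ?r) ^ dim (boxp L (\<lambda>_. \<rho>)) * real (N ?r)"
      by (rule card_cube_le_dim[OF r])
    also have "4 * real CARD('k) ^ 2 * \<rho> / ?r = ?c * s"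
      using Suc.prems(1) s by (simp add: field_simps)
    also have "(?c * s) ^ dim (boxp L (\<lambda>_. \<rho>)) \<le> (?c * s) ^ Suc i"
      using Suc.prems(2) c1 s mult_mono[of 1 ?c 1 s] by (intro power_increasing) auto
    also have "(?c * s) ^ Suc i * real (N ?r) \<le> (?c * s) ^ Suc i * (((?c ^ CARD('k)) ^ i) * (\<Prod>j=1..i. max 1 (?r / ?lam j)))"
      using IH s by (intro mult_left_mono) auto
    finally show ?thesis by (simp add: mult_right_mono)
  qed
  \<comment> \<open>Rounding the exponent up lets every induction step multiply by the same
    constant.\<close>
  have pw: "?c ^ Suc i \<le> ?c ^ CARD('k)" using Suc.prems c1 by (intro power_increasing) auto
  show ?case
  proof (cases "\<rho> \<le> ?lam (Suc i)")
    case True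
    have lamj: "?lam j > 0" if "j \<in> {1..Suc i}" for j using that Suc.prems by (intro succ_min_pos) auto
    have "real (N \<rho>) \<le> (?c * 1) ^ Suc i * (((?c ^ CARD('k)) ^ i) * (\<Prod>j=1..i. max 1 (\<rho> / 1 / 2 / ?lam j)))"
      using True Suc.prems(1) by (intro key) auto
    also have "\<dots> \<le> ?c ^ CARD('k) * (((?c ^ CARD('k)) ^ i) * (\<Prod>j=1..i. max 1 (\<rho> / ?lam j)))"
    proof (intro mult_mono prod_mono conjI)
      fix j assume "j \<in> {1..i}"
      then have "?lam j > 0" using lamj by auto
      then show "max 1 (\<rho> / 1 / 2 / ?lam j) \<le> max 1 (\<rho> / ?lam j)"
        using Suc.prems(1) by (intro max.mono divide_right_mono) auto
    qed (use pw in \<open>auto intro!: prod_nonneg mult_nonneg_nonneg\<close>)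
    also have "\<dots> = (?c ^ CARD('k)) ^ Suc i * ((\<Prod>j=1..i. max 1 (\<rho> / ?lam j)) * 1)" by simp
    also have "\<dots> \<le> (?c ^ CARD('k)) ^ Suc i * ((\<Prod>j=1..i. max 1 (\<rho> / ?lam j)) * max 1 (\<rho> / ?lam (Suc i)))"
      by (intro mult_left_mono) (auto intro!: prod_nonneg)
    finally show ?thesis by simp
  next
    case False
    define s where "s = \<rho> / ?lam (Suc i)"
    have s1: "s \<ge> 1" using False lam by (simp add: s_def)
    have lamj: "?lam j > 0" if "j \<in> {1..Suc i}" for j using that Suc.prems by (intro succ_min_pos) auto
    have rs: "\<rho> / s = ?lam (Suc i)" using lam Suc.prems(1) by (simp add: s_def)
    have "real (N \<rho>) \<le> (?c * s) ^ Suc i * (((?c ^ CARD('k)) ^ i) * (\<Prod>j=1..i. max 1 (\<rho> / s / 2 / ?lam j)))"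
      using rs lam s1 by (intro key) auto
    \<comment> \<open>The \<open>Suc i\<close> copies of \<open>s\<close> are distributed: one
      stands alone, one goes into each of the \<open>i\<close> factors.\<close>
    also have "\<dots> = ?c ^ Suc i * (((?c ^ CARD('k)) ^ i) * ((s * (\<Prod>j=1..i. s * max 1 (\<rho> / s / 2 / ?lam j)))))"
      by (simp add: power_mult_distrib prod.distrib)
    also have "\<dots> \<le> ?c ^ CARD('k) * (((?c ^ CARD('k)) ^ i) * (max 1 s * (\<Prod>j=1..i. max 1 (\<rho> / ?lam j))))"
    proof (intro mult_mono prod_mono conjI)
      fix j assume j: "j \<in> {1..i}"
      then have l: "?lam j > 0" using lamj by auto
      have le: "?lam j \<le> ?lam (Suc i)"
      proof (rule field_le_epsilon)
        fix e :: real assume "e > 0"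
        then obtain S where S: "S \<subseteq> boxp L (\<lambda>_. ?lam (Suc i) + e)" "independent S" "card S = Suc i"
          using succ_min_less_imp[of "Suc i" "?lam (Suc i) + e"] Suc.prems by auto
        then have "Suc i \<le> dim (boxp L (\<lambda>_. ?lam (Suc i) + e))"
          using independent_card_le_dim by metis
        then show "?lam j \<le> ?lam (Suc i) + e"
          using j lam \<open>e > 0\<close> by (intro succ_min_le) auto
      qed
      have "s \<le> \<rho> / ?lam j"
        unfolding s_def using le l lam Suc.prems(1) by (intro divide_left_mono) auto
      moreover have "s * (\<rho> / s / 2 / ?lam j) \<le> \<rho> / ?lam j"
        using s1 l Suc.prems(1) by (simp add: field_simps)
      moreover have "s * max 1 (\<rho> / s / 2 / ?lam j) = max s (s * (\<rho> / s / 2 / ?lam j))"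
        using s1 by (simp add: max_mult_distrib_left)
      ultimately show "s * max 1 (\<rho> / s / 2 / ?lam j) \<le> max 1 (\<rho> / ?lam j)" by auto
    qed (use pw s1 in \<open>auto intro!: prod_nonneg mult_nonneg_nonneg\<close>)
    also have "\<dots> = (?c ^ CARD('k)) ^ Suc i * ((\<Prod>j=1..i. max 1 (\<rho> / ?lam j)) * max 1 (\<rho> / ?lam (Suc i)))"
      by (simp add: s_def)
    finally show ?thesis by simp
  qed
qed

text \<open>The factor 2 stands in for attainment of the infimum. Among \<open>Suc i\<close>
  independent vectors one lies outside the span of the \<open>i\<close> vectors already
  chosen.\<close>

lemma short_vectors:
  assumes "i \<le> CARD('k)"
  shows "\<exists>v. (\<forall>j<i. v j \<in> boxp L (\<lambda>_. 2 * succ_min (Suc j) L)) \<and> independent (v ` {..<i}) \<and> inj_on v {..<i}"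
  using assms
proof (induction i)
  case 0
  then show ?case by (auto simp: independent_empty)
next
  case (Suc i)
  then obtain v where v: "\<And>j. j < i \<Longrightarrow> v j \<in> boxp L (\<lambda>_. 2 * succ_min (Suc j) L)"
    "independent (v ` {..<i})" "inj_on v {..<i}" by auto
  have "succ_min (Suc i) L > 0" using Suc.prems by (intro succ_min_pos) auto
  then have "succ_min (Suc i) L < 2 * succ_min (Suc i) L" by simp
  then obtain S where S: "S \<subseteq> boxp L (\<lambda>_. 2 * succ_min (Suc i) L)" "independent S" "card S = Suc i"
    using succ_min_less_imp Suc.prems by metis
  have "\<not> S \<subseteq> span (v ` {..<i})"
  proof
    assume "S \<subseteq> span (v ` {..<i})"
    then have "card S \<le> card (v ` {..<i})"
      using independent_span_bound[of "v ` {..<i}" S] S(2) by simp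
    also have "\<dots> \<le> i" using card_image_le[of "{..<i}" v] by simp
    finally show False using S(3) by simp
  qed
  then obtain x where x: "x \<in> S" "x \<notin> span (v ` {..<i})" by auto
  define w where "w = v(i := x)"
  have img: "w ` {..<Suc i} = insert x (v ` {..<i})" by (auto simp: w_def lessThan_Suc)
  have "w j \<in> boxp L (\<lambda>_. 2 * succ_min (Suc j) L)" if "j < Suc i" for j
    using that v(1)[of j] x(1) S(1) by (cases "j = i") (auto simp: w_def)
  moreover have "independent (w ` {..<Suc i})"
    unfolding img using x(2) v(2) by (intro independent_insertI) auto
  moreover have "inj_on w {..<Suc i}"
  proof -
    have "inj_on w {..<i}" using v(3) by (auto simp: inj_on_def w_def)
    moreover have "w ` {..<i} = v ` {..<i}" by (intro image_cong) (auto simp: w_def)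
    then have "w i \<notin> w ` {..<i}" using x(2) span_base[of x "v ` {..<i}"] by (auto simp: w_def)
    ultimately show ?thesis by (simp add: lessThan_Suc inj_on_insert)
  qed
  ultimately show ?case by blast
qed

lemma card_cube_ge_minima:
  "(\<Prod>j=1..CARD('k). max 1 (1 / succ_min j L)) \<le> (2 * real CARD('k)) ^ CARD('k) * real (N 1)"
proof -
  let ?d = "CARD('k)"
  let ?lam = "\<lambda>j. succ_min (Suc j) L"
  obtain v where v: "\<And>j. j < ?d \<Longrightarrow> v j \<in> boxp L (\<lambda>_. 2 * ?lam j)"
      "independent (v ` {..<?d})" "inj_on v {..<?d}"
    using short_vectors[of ?d] by auto
  have lam: "?lam j > 0" if "j < ?d" for j using that by (intro succ_min_pos) auto
  \<comment> \<open>With \<open>0 \<le> a j \<le> h j\<close> each term moves a coordinate by at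
    most \<open>h j * (2 * ?lam j) = 1 / ?d\<close>, so the \<open>?d\<close> terms together stay in
    the unit cube.\<close>
  define h where "h j = 1 / (2 * real ?d * ?lam j)" for j
  have h: "h j > 0" if "j < ?d" for j using lam[OF that] by (simp add: h_def)
  define P where "P = PiE {..<?d} (\<lambda>j. {0..\<lfloor>h j\<rfloor>})"
  define g where "g a = (\<Sum>j<?d. of_int (a j) *\<^sub>R v j)" for a :: "nat \<Rightarrow> int"
  have "g ` P \<subseteq> boxp L (\<lambda>_. 1)"
  proof
    fix x assume "x \<in> g ` P"
    then obtain a where a: "a \<in> P" "x = g a" by auto
    have "x \<in> L" unfolding a(2) g_def using v(1) by (intro sum_mem of_int_mem) (auto simp: boxp_def)
    moreover have "\<bar>x $ l\<bar> \<le> 1" for l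
    proof -
      have "\<bar>x $ l\<bar> = \<bar>\<Sum>j<?d. of_int (a j) * v j $ l\<bar>" by (simp add: a(2) g_def)
      also have "\<dots> \<le> (\<Sum>j<?d. \<bar>of_int (a j) * v j $ l\<bar>)" by (rule sum_abs)
      also have "\<dots> \<le> (\<Sum>j<?d. 1 / real ?d)"
      proof (rule sum_mono)
        fix j assume j: "j \<in> {..<?d}"
        have aj: "0 \<le> a j" "a j \<le> \<lfloor>h j\<rfloor>" using a(1) j by (auto simp: P_def PiE_iff)
        then have "\<bar>real_of_int (a j)\<bar> \<le> h j" by linarith
        moreover have "\<bar>v j $ l\<bar> \<le> 2 * ?lam j" using v(1) j by (auto simp: boxp_def)
        ultimately have "\<bar>of_int (a j) * v j $ l\<bar> \<le> h j * (2 * ?lam j)"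
          unfolding abs_mult by (intro mult_mono) auto
        also have "\<dots> = 1 / real ?d" using lam[of j] j by (auto simp: h_def field_simps)
        finally show "\<bar>of_int (a j) * v j $ l\<bar> \<le> 1 / real ?d" .
      qed
      also have "\<dots> = 1" by simp
      finally show ?thesis .
    qed
    ultimately show "x \<in> boxp L (\<lambda>_. 1)" by (auto simp: boxp_def)
  qed
  moreover have "inj_on g P"
  proof (rule inj_onI)
    fix a b assume a: "a \<in> P" and b: "b \<in> P" and ab: "g a = g b"
    have eq0: "(\<Sum>j<?d. of_int (a j - b j) *\<^sub>R v j) = 0"
      using ab by (simp add: g_def algebra_simps sum_subtractf)
    have "a j - b j = 0" if "j < ?d" for j
    proof -
      \<comment> \<open>Independence of a set speaks of coefficients indexed by its vectors, hence
        the inverse of \<open>v\<close>.\<close>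
      let ?u = "\<lambda>y. real_of_int (a (the_inv_into {..<?d} v y) - b (the_inv_into {..<?d} v y))"
      have "(\<Sum>y\<in>v ` {..<?d}. ?u y *\<^sub>R y) = (\<Sum>j<?d. ?u (v j) *\<^sub>R v j)"
        by (rule sum.reindex_cong[OF v(3)]) auto
      also have "\<dots> = 0"
        using eq0 v(3) by (simp add: the_inv_into_f_f)
      finally have "?u (v j) = 0"
        using v(2) that by (intro independentD[OF v(2), of "v ` {..<?d}"]) auto
      then show ?thesis using that v(3) by (simp add: the_inv_into_f_f)
    qed
    then show "a = b" using a b unfolding P_def by (intro PiE_ext[of a _ _ b]) auto
  qed
  ultimately have "card P \<le> N 1"
    using finite_boxp card_inj_on_le by blast
  moreover have "real (card P) = (\<Prod>j<?d. real (card {0..\<lfloor>h j\<rfloor>}))"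
    by (simp add: P_def card_PiE)
  \<comment> \<open>The integers from 0 to floor h number floor h + 1, which is at least 1 and at
    least \<open>h j\<close>; this yields the maximum up to the factor
    \<open>2 * real ?d\<close>.\<close>
  moreover have "(\<Prod>j<?d. max 1 (1 / ?lam j) / (2 * real ?d)) \<le> (\<Prod>j<?d. real (card {0..\<lfloor>h j\<rfloor>}))"
  proof (intro prod_mono conjI)
    fix j assume j: "j \<in> {..<?d}"
    have hj: "h j > 0" using h j by auto
    then have "0 \<le> \<lfloor>h j\<rfloor>" by simp
    then have "real (card {0..\<lfloor>h j\<rfloor>}) = real_of_int \<lfloor>h j\<rfloor> + 1" by simp
    then have "real (card {0..\<lfloor>h j\<rfloor>}) \<ge> 1 \<and> real (card {0..\<lfloor>h j\<rfloor>}) \<ge> h j"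
      using \<open>0 \<le> \<lfloor>h j\<rfloor>\<close> by linarith
    moreover have "real ?d \<ge> 1" by (simp add: Suc_leI)
    then have "1 / (2 * real ?d) \<le> 1" by (subst divide_le_eq_1_pos) linarith+
    moreover have "max 1 (1 / ?lam j) / (2 * real ?d) = max (1 / (2 * real ?d)) (h j)"
      by (auto simp: h_def max_divide_distrib_right mult_ac)
    ultimately show "max 1 (1 / ?lam j) / (2 * real ?d) \<le> real (card {0..\<lfloor>h j\<rfloor>})"
      by linarith
  qed simp
  ultimately have "(\<Prod>j<?d. max 1 (1 / ?lam j) / (2 * real ?d)) \<le> real (N 1)" by linarith
  moreover have "(\<Prod>j<?d. max 1 (1 / ?lam j) / (2 * real ?d)) = (\<Prod>j<?d. max 1 (1 / ?lam j)) / (2 * real ?d) ^ ?d"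
    by (simp add: prod_dividef)
  moreover have "(\<Prod>j<?d. max 1 (1 / ?lam j)) = (\<Prod>j=1..?d. max 1 (1 / succ_min j L))"
    by (rule prod.reindex_bij_witness[of _ "\<lambda>j. j - 1" Suc]) auto
  ultimately have "(\<Prod>j=1..?d. max 1 (1 / succ_min j L)) / (2 * real ?d) ^ ?d \<le> real (N 1)" by simp
  then show ?thesis by (subst (asm) pos_divide_le_eq) (auto simp: mult.commute)
qed

text \<open>The two products are linked by 1 / min(1, lambda) = max(1, 1 / lambda), valid because
  the minima are positive.\<close>

lemma inverse_card_cube:
  defines "D \<equiv> (\<Prod>j=1..CARD('k). min 1 (succ_min j L))"
  shows "1 / real (N 1) \<le> (2 * real CARD('k)) ^ CARD('k) * D"
    and "D \<le> ((8 * real CARD('k) ^ 2) ^ CARD('k)) ^ CARD('k) * (1 / real (N 1))"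
proof -
  let ?d = "CARD('k)"
  have D0: "D > 0" unfolding D_def using succ_min_pos by (intro prod_pos) auto
  have "(\<Prod>j=1..?d. max 1 (1 / succ_min j L)) = (\<Prod>j=1..?d. 1 / min 1 (succ_min j L))"
  proof (rule prod.cong)
    fix j assume "j \<in> {1..?d}"
    then have "succ_min j L > 0" using succ_min_pos by auto
    then show "max 1 (1 / succ_min j L) = 1 / min 1 (succ_min j L)" by (auto simp: max_def min_def)
  qed simp
  then have D: "(\<Prod>j=1..?d. max 1 (1 / succ_min j L)) = 1 / D" by (simp add: D_def prod_dividef)
  have N0: "real (N 1) > 0" using card_boxp_pos[of "\<lambda>_. 1"] by simp
  show "1 / real (N 1) \<le> (2 * real ?d) ^ ?d * D"
    using card_cube_ge_minima D0 N0 unfolding D by (simp add: field_simps)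
  have "dim (boxp L (\<lambda>_. 1)) \<le> ?d" using dim_subset_UNIV[of "boxp L (\<lambda>_. 1)"] by simp
  from card_cube_le_minima[OF _ this] show "D \<le> ((8 * real ?d ^ 2) ^ ?d) ^ ?d * (1 / real (N 1))"
    using D0 N0 unfolding D by (simp add: field_simps)
qed

end

section \<open>The lattice of a matrix\<close>

lemma card_int_box:
  fixes a b :: int
  shows "card {q :: int ^ 'n. \<forall>i. a \<le> q $ i \<and> q $ i \<le> b} = card {a..b} ^ CARD('n)"
    and "finite {q :: int ^ 'n. \<forall>i. a \<le> q $ i \<and> q $ i \<le> b}"
proof -
  have bij: "bij_betw vec_lambda (PiE (UNIV :: 'n set) (\<lambda>_. {a..b})) {q :: int ^ 'n. \<forall>i. a \<le> q $ i \<and> q $ i \<le> b}"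
    by (rule bij_betw_byWitness[of _ vec_nth]) (auto simp: PiE_def)
  show "card {q :: int ^ 'n. \<forall>i. a \<le> q $ i \<and> q $ i \<le> b} = card {a..b} ^ CARD('n)"
    using bij_betw_same_card[OF bij] by (simp add: card_PiE)
  show "finite {q :: int ^ 'n. \<forall>i. a \<le> q $ i \<and> q $ i \<le> b}"
    using bij_betw_finite[OF bij] by (simp add: finite_PiE)
qed

lemma infnorm_real_vec_le_iff:
  "infnorm (real_vec q) \<le> T \<longleftrightarrow> (\<forall>i. - \<lfloor>T\<rfloor> \<le> q $ i \<and> q $ i \<le> \<lfloor>T\<rfloor>)"
proof -
  have "\<bar>real_of_int z\<bar> \<le> T \<longleftrightarrow> - \<lfloor>T\<rfloor> \<le> z \<and> z \<le> \<lfloor>T\<rfloor>" for z :: int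
    by linarith
  then show ?thesis by (simp add: infnorm_le_iff real_vec_def)
qed

lemma finite_infnorm_real_vec_le: "finite {q :: int ^ 'n. infnorm (real_vec q) \<le> T}"
  unfolding infnorm_real_vec_le_iff by (rule card_int_box)

lemma card_infnorm_real_vec_le:
  assumes "T \<ge> 0"
  shows "real (card {q :: int ^ 'n. infnorm (real_vec q) \<le> T}) \<le> (2 * T + 1) ^ CARD('n)"
    and "real (card {q :: int ^ 'n. infnorm (real_vec q) \<le> T}) \<ge> T ^ CARD('n)"
proof -
  have "0 \<le> \<lfloor>T\<rfloor>" using assms by simp
  then have "real (card {- \<lfloor>T\<rfloor>..\<lfloor>T\<rfloor>}) = 2 * real_of_int \<lfloor>T\<rfloor> + 1" by simp
  then have c: "real (card {- \<lfloor>T\<rfloor>..\<lfloor>T\<rfloor>}) \<le> 2 * T + 1" "T \<le> real (card {- \<lfloor>T\<rfloor>..\<lfloor>T\<rfloor>})"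
    using \<open>0 \<le> \<lfloor>T\<rfloor>\<close> by linarith+
  then show "real (card {q :: int ^ 'n. infnorm (real_vec q) \<le> T}) \<le> (2 * T + 1) ^ CARD('n)"
    and "real (card {q :: int ^ 'n. infnorm (real_vec q) \<le> T}) \<ge> T ^ CARD('n)"
    unfolding infnorm_real_vec_le_iff card_int_box of_nat_power
    using assms by (auto intro!: power_mono)
qed

lemma span_range_real_vec: "span (range real_vec) = (UNIV :: (real ^ 'k) set)"
proof -
  have "Basis \<subseteq> (range real_vec :: (real ^ 'k) set)"
  proof
    fix x :: "real ^ 'k" assume "x \<in> Basis"
    then obtain i where "x = axis i 1" by (auto simp: Basis_vec_def)
    then have "x = real_vec (axis i 1)" by (simp add: real_vec_def axis_def vec_eq_iff)
    then show "x \<in> range real_vec" by blast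
  qed
  then show ?thesis using span_mono span_Basis by blast
qed

text \<open>Discreteness comes from a left inverse of \<open>M\<close>: on a cube it bounds the
  integer coordinates, and finitely many integer vectors obey such a bound.\<close>

lemma full_lattice_range:
  fixes M :: "real ^ 'k ^ 'k"
  assumes inj: "\<And>x. M *v x = 0 \<Longrightarrow> x = 0"
  shows "full_lattice (range (\<lambda>z. M *v real_vec z))"
proof
  have "inj ((*v) M)"
    using inj matrix_vector_mul_linear[of M] by (simp add: linear_injective_0)
  then obtain M' where M': "M' ** M = mat 1"
    using matrix_left_invertible_injective[of M] by blast
  show "0 \<in> range (\<lambda>z. M *v real_vec z)"
    by (rule range_eqI[of _ _ 0]) (simp add: real_vec_0)
  show "x - y \<in> range (\<lambda>z. M *v real_vec z)"
    if "x \<in> range (\<lambda>z. M *v real_vec z)" "y \<in> range (\<lambda>z. M *v real_vec z)" for x y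
  proof -
    obtain a b where "x = M *v real_vec a" "y = M *v real_vec b" using \<open>x \<in> _\<close> \<open>y \<in> _\<close> by auto
    then have "x - y = M *v real_vec (a - b)"
      by (simp add: real_vec_diff matrix_vector_mult_diff_distrib)
    then show ?thesis by blast
  qed
  show "finite (boxp (range (\<lambda>z. M *v real_vec z)) (\<lambda>_. \<rho>))" for \<rho>
  proof -
    define K where "K = (\<Sum>i\<in>UNIV. \<Sum>j\<in>UNIV. \<bar>M' $ i $ j\<bar>) * \<rho>"
    have "boxp (range (\<lambda>z. M *v real_vec z)) (\<lambda>_. \<rho>) \<subseteq> (\<lambda>z. M *v real_vec z) ` {z. infnorm (real_vec z) \<le> K}"
    proof
      fix x assume "x \<in> boxp (range (\<lambda>z. M *v real_vec z)) (\<lambda>_. \<rho>)"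
      then obtain z where z: "x = M *v real_vec z" "\<And>i. \<bar>x $ i\<bar> \<le> \<rho>" by (auto simp: boxp_def)
      have "\<rho> \<ge> 0" using z(2) abs_ge_zero order_trans by blast
      have "real_vec z = M' *v x" unfolding z(1) by (simp add: matrix_vector_mul_assoc M')
      then have "\<bar>real_vec z $ i\<bar> \<le> K" for i
      proof -
        assume "real_vec z = M' *v x"
        then have "\<bar>real_vec z $ i\<bar> = \<bar>\<Sum>j\<in>UNIV. M' $ i $ j * x $ j\<bar>"
          by (simp add: matrix_vector_mult_def)
        also have "\<dots> \<le> (\<Sum>j\<in>UNIV. \<bar>M' $ i $ j * x $ j\<bar>)" by (rule sum_abs)
        also have "\<dots> \<le> (\<Sum>j\<in>UNIV. \<bar>M' $ i $ j\<bar> * \<rho>)"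
          using z(2) by (intro sum_mono) (auto simp: abs_mult intro: mult_left_mono)
        also have "\<dots> = (\<Sum>j\<in>UNIV. \<bar>M' $ i $ j\<bar>) * \<rho>" by (simp add: sum_distrib_right)
        also have "\<dots> \<le> K" unfolding K_def
          using \<open>\<rho> \<ge> 0\<close> by (intro mult_right_mono member_le_sum[of i UNIV "\<lambda>i. \<Sum>j\<in>UNIV. \<bar>M' $ i $ j\<bar>"]) (auto intro: sum_nonneg)
        finally show ?thesis .
      qed
      then show "x \<in> (\<lambda>z. M *v real_vec z) ` {z. infnorm (real_vec z) \<le> K}"
        using z(1) by (auto simp: infnorm_le_iff)
    qed
    then show ?thesis using finite_infnorm_real_vec_le finite_subset by blast
  qed
  have "surj ((*v) M)"
    using \<open>inj ((*v) M)\<close> linear_injective_imp_surjective matrix_vector_mul_linear by blast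
  then have "span ((*v) M ` range real_vec) = UNIV"
    using linear_span_image[OF matrix_vector_mul_linear[of M], of "range real_vec"]
    unfolding span_range_real_vec by metis
  then show "span (range (\<lambda>z. M *v real_vec z)) = UNIV" by (simp add: image_image)
qed

lemma sum_UNIV_Plus:
  fixes f :: "'a::finite + 'b::finite \<Rightarrow> 'c::comm_monoid_add"
  shows "(\<Sum>k\<in>UNIV. f k) = (\<Sum>i\<in>UNIV. f (Inl i)) + (\<Sum>j\<in>UNIV. f (Inr j))"
  using sum.Plus[of UNIV UNIV f] by simp

lemma prod_UNIV_Plus:
  fixes f :: "'a::finite + 'b::finite \<Rightarrow> 'c::comm_monoid_mult"
  shows "(\<Prod>k\<in>UNIV. f k) = (\<Prod>i\<in>UNIV. f (Inl i)) * (\<Prod>j\<in>UNIV. f (Inr j))"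
  using prod.Plus[of UNIV UNIV f] by simp

lemma mult_mat_nth: "(\<Sum>j\<in>UNIV. mat c $ i $ j * x j) = c * (x i :: real)"
proof -
  have "mat c $ i $ j * x j = (if j = i then c * x j else 0)" for j
    by (simp add: mat_def)
  then show ?thesis by simp
qed

lemma block_mat_mult_nth:
  "(block_mat P Q R S *v x) $ Inl i = (\<Sum>j\<in>UNIV. P $ i $ j * x $ Inl j) + (\<Sum>j\<in>UNIV. Q $ i $ j * x $ Inr j)"
  "(block_mat P Q R S *v x) $ Inr i' = (\<Sum>j\<in>UNIV. R $ i' $ j * x $ Inl j) + (\<Sum>j\<in>UNIV. S $ i' $ j * x $ Inr j)"
  unfolding matrix_vector_mult_def block_mat_def vec_lambda_beta sum_UNIV_Plus sum.case by simp_all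

lemma u_mat_nth:
  "(u_mat A *v x) $ Inl i = x $ Inl i + (\<Sum>j\<in>UNIV. A $ i $ j * x $ Inr j)"
  "(u_mat A *v x) $ Inr j = x $ Inr j"
  by (simp_all add: u_mat_def block_mat_mult_nth mult_mat_nth)

lemma a_mat_nth:
  "((a_mat t :: real ^ ('m::finite + 'n::finite) ^ ('m + 'n)) *v x) $ Inl i = exp (t / CARD('m)) * x $ Inl i"
  "((a_mat t :: real ^ ('m::finite + 'n::finite) ^ ('m + 'n)) *v x) $ Inr j = exp (- t / CARD('n)) * x $ Inr j"
  by (simp_all add: a_mat_def block_mat_mult_nth mult_mat_nth)

lemma vec_eq_Plus_iff:
  "x = (y :: 'c ^ ('m::finite + 'n::finite)) \<longleftrightarrow> (\<forall>i. x $ Inl i = y $ Inl i) \<and> (\<forall>j. x $ Inr j = y $ Inr j)"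
  by (simp add: vec_eq_iff split_sum_all)

text \<open>The sign of the integer part follows \<open>count_N\<close>, whereas
  \<open>u_mat\<close> adds it. The range is the same lattice because that part runs over all
  integer vectors.\<close>

definition lattice_pt :: "real ^ 'n ^ 'm \<Rightarrow> (int ^ 'm) \<times> (int ^ 'n) \<Rightarrow> real ^ ('m + 'n)"
  where "lattice_pt A z = (\<chi> k. case k of
    Inl i \<Rightarrow> (A *v real_vec (snd z) - real_vec (fst z)) $ i | Inr j \<Rightarrow> real_vec (snd z) $ j)"

definition side :: "real \<Rightarrow> real \<Rightarrow> 'm + 'n \<Rightarrow> real"
  where "side r T k = (case k of Inl _ \<Rightarrow> r | Inr _ \<Rightarrow> T)"

lemma side_simps [simp]: "side r T (Inl i) = r" "side r T (Inr j) = T"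
  by (simp_all add: side_def)

lemma lattice_pt_nth [simp]:
  "lattice_pt A z $ Inl i = (A *v real_vec (snd z) - real_vec (fst z)) $ i"
  "lattice_pt A z $ Inr j = real_vec (snd z) $ j"
  by (simp_all add: lattice_pt_def)

lemma inj_lattice_pt: "inj (lattice_pt A)"
proof (rule injI)
  fix z w assume eq: "lattice_pt A z = lattice_pt A w"
  then have "real_vec (snd z) = real_vec (snd w)"
    by (metis lattice_pt_nth(2) vec_eq_iff)
  moreover from this have "real_vec (fst z) $ i = real_vec (fst w) $ i" for i
    using arg_cong[OF eq, of "\<lambda>x. x $ Inl i"] by simp
  then have "real_vec (fst z) = real_vec (fst w)" by (simp add: vec_eq_iff)
  ultimately show "z = w" by (intro prod_eqI) (simp_all add: real_vec_def vec_eq_iff)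
qed

lemma lattice_of_eq: "lattice_of A = range (lattice_pt A)"
proof (intro equalityI subsetI)
  fix x assume "x \<in> lattice_of A"
  then obtain z where z: "x = u_mat A *v real_vec z" by (auto simp: lattice_of_def)
  have "x = lattice_pt A (\<chi> i. - z $ Inl i, \<chi> j. z $ Inr j)"
    unfolding z vec_eq_Plus_iff by (simp add: u_mat_nth real_vec_def matrix_vector_mult_def[of A])
  then show "x \<in> range (lattice_pt A)" by blast
next
  fix x assume "x \<in> range (lattice_pt A)"
  then obtain p q where z: "x = lattice_pt A (p, q)" by auto
  have "x = u_mat A *v real_vec (\<chi> k. case k of Inl i \<Rightarrow> - p $ i | Inr j \<Rightarrow> q $ j)"
    unfolding z vec_eq_Plus_iff by (simp add: u_mat_nth real_vec_def matrix_vector_mult_def[of A])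
  then show "x \<in> lattice_of A" by (auto simp: lattice_of_def)
qed

lemma u_mat_eq_0D: "u_mat A *v x = 0 \<Longrightarrow> x = 0"
  by (auto simp: vec_eq_Plus_iff u_mat_nth)

lemma full_lattice_lattice_of: "full_lattice (lattice_of A)"
  unfolding lattice_of_def by (rule full_lattice_range) (rule u_mat_eq_0D)

lemma full_lattice_a_mat:
  "full_lattice ((*v) (a_mat t) ` lattice_of (A :: real ^ 'n ^ 'm))"
proof -
  have "full_lattice (range (\<lambda>z. (a_mat t ** u_mat A) *v real_vec z))"
  proof (rule full_lattice_range)
    fix x assume "(a_mat t ** u_mat A) *v x = 0"
    then have "a_mat t *v (u_mat A *v x) = 0" by (simp add: matrix_vector_mul_assoc)
    then have "u_mat A *v x = 0" by (simp add: vec_eq_Plus_iff a_mat_nth)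
    then show "x = 0" by (rule u_mat_eq_0D)
  qed
  then show ?thesis by (simp add: lattice_of_def image_image matrix_vector_mul_assoc)
qed

lemma count_N_set_eq:
  "{(p :: int ^ 'm, q :: int ^ 'n). infnorm (A *v real_vec q - real_vec p) \<le> r \<and> infnorm (real_vec q) \<le> T} =
    {z. lattice_pt A z \<in> boxp (lattice_of A) (side r T)}"
proof -
  have "(\<forall>k. \<bar>lattice_pt A z $ k\<bar> \<le> side r T k) \<longleftrightarrow>
     infnorm (A *v real_vec (snd z) - real_vec (fst z)) \<le> r \<and> infnorm (real_vec (snd z)) \<le> T" for z
    by (simp add: infnorm_le_iff split_sum_all)
  then show ?thesis by (auto simp: boxp_def lattice_of_eq)
qed

lemma count_N_eq_card_boxp: "count_N A r T = card (boxp (lattice_of A) (side r T))"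
proof -
  have "lattice_pt A ` {z. lattice_pt A z \<in> boxp (lattice_of A) (side r T)} = boxp (lattice_of A) (side r T)"
    by (auto simp: boxp_def lattice_of_eq)
  then show ?thesis
    unfolding count_N_def count_N_set_eq
    by (metis card_image inj_lattice_pt inj_on_subset subset_UNIV)
qed

lemma finite_count_N_set:
  "finite {(p :: int ^ 'm, q :: int ^ 'n). infnorm (A *v real_vec q - real_vec p) \<le> r \<and> infnorm (real_vec q) \<le> T}"
proof -
  interpret full_lattice "lattice_of A" by (rule full_lattice_lattice_of)
  show ?thesis unfolding count_N_set_eq
    using finite_vimageI[OF finite_boxp[of "side r T"] inj_lattice_pt[of A]] by (simp add: vimage_def)
qed

lemma count_N_pos: "0 \<le> r \<Longrightarrow> 0 \<le> T \<Longrightarrow> count_N A r T > 0"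
proof -
  assume "0 \<le> r" "0 \<le> T"
  interpret full_lattice "lattice_of A" by (rule full_lattice_lattice_of)
  show ?thesis unfolding count_N_eq_card_boxp
    using \<open>0 \<le> r\<close> \<open>0 \<le> T\<close> by (intro card_boxp_pos) (auto simp: side_def split: sum.split)
qed

section \<open>Dyadic scales and the passage to \<open>Delta\<close>\<close>

definition rad :: "nat \<Rightarrow> nat \<Rightarrow> nat \<Rightarrow> real"
  where "rad m n k = psi (n / m) (2 ^ k)"

lemma rad_eq: "rad m n k = 2 powr (- (real k * n / m))"
  by (simp add: rad_def psi_def powr_powr powr_realpow[symmetric])

lemma rad_pos: "rad m n k > 0"
  by (simp add: rad_eq)

text \<open>Hence \<open>ratio_M\<close> is 1 / N at these scales, and in comparing a box with one
  of scale j only the r^m T^n of the former remains.\<close>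

lemma rad_power: "m > 0 \<Longrightarrow> rad m n k ^ m * (2 ^ k) ^ n = 1"
proof -
  assume m: "m > 0"
  have "rad m n k ^ m = 2 powr (- (real k * n / m) * real m)"
    by (simp add: rad_eq powr_power)
  also have "- (real k * n / m) * real m = - real (k * n)" using m by simp
  finally have "rad m n k ^ m = inverse (2 ^ (k * n))" by (simp only: powr_minus powr_realpow)
  then show ?thesis by (simp add: power_mult)
qed

text \<open>The time t = n k log 2 is the one with e^(t/m) = 1 / r_k and e^(-t/n) = 2^(-k), so
  \<open>a_mat\<close> maps the counting box onto the unit cube.\<close>

lemma count_N_rad_eq:
  fixes A :: "real ^ 'n ^ 'm"
  shows "count_N A (rad CARD('m) CARD('n) k) (2 ^ k) =
    card (boxp ((*v) (a_mat (real CARD('n) * real k * ln 2)) ` lattice_of A) (\<lambda>_. 1))"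
proof -
  let ?M = "a_mat (real CARD('n) * real k * ln 2) :: real ^ ('m + 'n) ^ ('m + 'n)"
  let ?r = "rad CARD('m) CARD('n) k"
  have "?r = exp (- (real CARD('n) * real k * ln 2 / real CARD('m)))"
    by (simp add: rad_eq powr_def)
  then have e1: "exp (real CARD('n) * real k * ln 2 / real CARD('m)) = 1 / ?r"
    by (simp add: exp_minus inverse_eq_divide)
  have "exp (- (real CARD('n) * real k * ln 2) / real CARD('n)) = exp (real k * - ln 2)" by simp
  also have "\<dots> = 1 / 2 ^ k" by (simp only: exp_of_nat_mult) (simp add: exp_minus inverse_eq_divide power_one_over)
  finally have e2: "exp (- (real CARD('n) * real k * ln 2) / real CARD('n)) = 1 / 2 ^ k" .
  have r0: "?r > 0" by (rule rad_pos)
  have iff: "(\<forall>k. \<bar>(?M *v x) $ k\<bar> \<le> 1) \<longleftrightarrow> (\<forall>k'. \<bar>x $ k'\<bar> \<le> side ?r (2 ^ k) k')" for x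
  proof -
    have "\<bar>(?M *v x) $ l\<bar> \<le> 1 \<longleftrightarrow> \<bar>x $ l\<bar> \<le> side ?r (2 ^ k) l" for l
    proof -
      have *: "\<bar>1 / s * a\<bar> \<le> 1 \<longleftrightarrow> \<bar>a\<bar> \<le> s" if "s > 0" for s a :: real
        using that by (simp add: abs_mult)
      show ?thesis
        by (cases l) (simp_all only: a_mat_nth e1 e2 side_simps *[OF r0] *[of "2 ^ k"] zero_less_power zero_less_numeral)
    qed
    then show ?thesis by simp
  qed
  have "boxp ((*v) ?M ` lattice_of A) (\<lambda>_. 1) = (*v) ?M ` {x \<in> lattice_of A. \<forall>k. \<bar>(?M *v x) $ k\<bar> \<le> 1}"
    by (auto simp: boxp_def)
  then have "(*v) ?M ` boxp (lattice_of A) (side ?r (2 ^ k)) = boxp ((*v) ?M ` lattice_of A) (\<lambda>_. 1)"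
    unfolding iff boxp_def by simp
  moreover have "inj_on ((*v) ?M) (boxp (lattice_of A) (side ?r (2 ^ k)))"
  proof (rule inj_onI)
    fix x y assume "?M *v x = ?M *v y"
    then have "(?M *v x) $ i = (?M *v y) $ i" for i by (rule arg_cong)
    from this[of "Inl _"] this[of "Inr _"] show "x = y"
      unfolding vec_eq_Plus_iff a_mat_nth by simp
  qed
  ultimately show ?thesis unfolding count_N_eq_card_boxp
    using card_image[of "(*v) ?M" "boxp (lattice_of A) (side ?r (2 ^ k))"] by simp
qed

text \<open>The constant depends on the dimensions alone; \<open>A\<close> and \<open>k\<close>
  enter only through the lattice to which the cube estimates are applied.\<close>

lemma inverse_count_N_asymp_Delta:
  fixes A :: "real ^ 'n ^ 'm"
  shows "\<exists>C\<ge>1. \<forall>k. Delta A k \<le> C * (1 / count_N A (rad CARD('m) CARD('n) k) (2 ^ k)) \<and>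
    1 / count_N A (rad CARD('m) CARD('n) k) (2 ^ k) \<le> C * Delta A k"
proof -
  let ?d = "real CARD('m + 'n)"
  define C1 where "C1 = (2 * ?d) ^ CARD('m + 'n)"
  define C2 where "C2 = ((8 * ?d ^ 2) ^ CARD('m + 'n)) ^ CARD('m + 'n)"
  have C: "C1 \<ge> 0" "C2 \<ge> 0" by (simp_all add: C1_def C2_def)
  have "Delta A k \<le> (1 + C1 + C2) * (1 / count_N A (rad CARD('m) CARD('n) k) (2 ^ k)) \<and>
    1 / count_N A (rad CARD('m) CARD('n) k) (2 ^ k) \<le> (1 + C1 + C2) * Delta A k" for k
  proof -
    let ?L = "(*v) (a_mat (real CARD('n) * real k * ln 2)) ` lattice_of A"
    interpret full_lattice ?L by (rule full_lattice_a_mat)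
    have D: "Delta A k = (\<Prod>j=1..CARD('m + 'n). min 1 (succ_min j ?L))"
      unfolding Delta_def by simp
    let ?N = "real (count_N A (rad CARD('m) CARD('n) k) (2 ^ k))"
    have a: "1 / ?N \<le> C1 * Delta A k" "Delta A k \<le> C2 * (1 / ?N)"
      using inverse_card_cube unfolding D count_N_rad_eq C1_def C2_def by blast+
    have "Delta A k \<ge> 0" unfolding D using succ_min_pos by (intro prod_nonneg) (auto simp: less_imp_le)
    then have "C1 * Delta A k \<le> (1 + C1 + C2) * Delta A k" using C by (intro mult_right_mono) auto
    moreover have "C2 * (1 / ?N) \<le> (1 + C1 + C2) * (1 / ?N)" using C by (intro mult_right_mono) auto
    ultimately show ?thesis using a by linarith
  qed
  moreover have "1 + C1 + C2 \<ge> 1" using C by simp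
  ultimately show ?thesis by blast
qed

section \<open>Covering boxes with unequal sides\<close>

context full_lattice
begin

lemma card_boxp_scale:
  assumes s: "\<And>i. 0 < s i" "\<And>i. s i \<le> S i"
  shows "real (card (boxp L S)) \<le> (\<Prod>i\<in>UNIV. 4 * (S i / s i)) * real (card (boxp L s))"
proof -
  have S0: "0 < S i" for i using s less_le_trans by blast
  have "real (card (boxp L S)) \<le> (\<Prod>i\<in>UNIV. 2 * S i / s i + 2) * real (card (boxp L s))"
  proof (rule card_le_cells[where \<phi> = "\<lambda>i x. x $ i"])
    fix x y assume "x \<in> boxp L S" "y \<in> boxp L S" "\<And>i. i \<in> UNIV \<Longrightarrow> \<bar>(x - y) $ i\<bar> < s i"
    then show "x - y \<in> boxp L s" using diff_mem by (auto simp: boxp_def less_imp_le)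
  qed (use s S0 finite_boxp in \<open>auto simp: boxp_def less_imp_le\<close>)
  also have "\<dots> \<le> (\<Prod>i\<in>UNIV. 4 * (S i / s i)) * real (card (boxp L s))"
  proof (intro mult_right_mono prod_mono conjI)
    fix i
    have "1 \<le> S i / s i" using s[of i] by simp
    then show "2 * S i / s i + 2 \<le> 4 * (S i / s i)" by simp
    show "0 \<le> 2 * S i / s i + 2" using S0[of i] s(1)[of i] by (simp add: add_nonneg_nonneg)
  qed simp
  finally show ?thesis .
qed

text \<open>The points lie on a hyperplane, so the cells need not subdivide the coordinate in which
  its normal vector, scaled by the sides \<open>s\<close>, is largest.\<close>

lemma card_boxp_hyperplane:
  assumes s: "\<And>i. 0 < s i" "\<And>i. s i \<le> S i"
    and \<kappa>: "0 < \<kappa>" "\<And>i. \<kappa> \<le> S i / s i"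
    and nspan: "span (boxp L S) \<noteq> UNIV"
  shows "real (card (boxp L S)) \<le>
    (4 * real CARD('k)) ^ CARD('k) * (\<Prod>i\<in>UNIV. S i / s i) / \<kappa> * real (card (boxp L s))"
proof -
  let ?d = "real CARD('k)"
  have "1 \<le> CARD('k)" by (simp add: Suc_leI)
  then have d1: "?d \<ge> 1" by linarith
  have S0: "0 < S i" for i using s less_le_trans by blast
  have ratio: "1 \<le> S i / s i" for i using s[of i] by simp
  obtain a where a: "a \<noteq> 0" "\<And>x. x \<in> boxp L S \<Longrightarrow> a \<bullet> x = 0"
    using span_not_UNIV_orthogonal[OF nspan] span_base by blast
  obtain i0 where i0: "\<And>i. \<bar>a $ i\<bar> * s i \<le> \<bar>a $ i0\<bar> * s i0"
  proof -
    have "Max (range (\<lambda>i. \<bar>a $ i\<bar> * s i)) \<in> range (\<lambda>i. \<bar>a $ i\<bar> * s i)" by (intro Max_in) auto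
    then obtain i0 where "Max (range (\<lambda>i. \<bar>a $ i\<bar> * s i)) = \<bar>a $ i0\<bar> * s i0" by (rule rangeE)
    then have "\<bar>a $ i\<bar> * s i \<le> \<bar>a $ i0\<bar> * s i0" for i
      using Max_ge[of "range (\<lambda>i. \<bar>a $ i\<bar> * s i)" "\<bar>a $ i\<bar> * s i"] by simp
    then show ?thesis using that by blast
  qed
  have ai0: "\<bar>a $ i0\<bar> > 0"
  proof (rule ccontr)
    assume "\<not> \<bar>a $ i0\<bar> > 0"
    then have "\<bar>a $ i\<bar> * s i \<le> 0" for i using i0[of i] by simp
    then have "a $ i = 0" for i 
      using s(1)[of i] mult_pos_pos[of "\<bar>a $ i\<bar>" "s i"] by (meson not_less zero_less_abs_iff)
    then show False using a(1) by (simp add: vec_eq_iff)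
  qed
  let ?I = "UNIV - {i0}"
  \<comment> \<open>Cells of side \<open>s i / ?d\<close> leave room for the fewer than
    \<open>?d\<close> summands that bound the undivided coordinate \<open>i0\<close>.\<close>
  have "real (card (boxp L S)) \<le> (\<Prod>i\<in>?I. 2 * S i / (s i / ?d) + 2) * real (card (boxp L s))"
  proof (rule card_le_cells[where \<phi> = "\<lambda>i x. x $ i"])
    fix x y assume x: "x \<in> boxp L S" and y: "y \<in> boxp L S"
      and small: "\<And>i. i \<in> ?I \<Longrightarrow> \<bar>(x - y) $ i\<bar> < s i / ?d"
    define w where "w = x - y"
    have le: "\<bar>w $ i\<bar> \<le> s i / ?d" if "i \<in> ?I" for i using small[OF that] by (simp add: w_def)
    have "a \<bullet> w = 0" using a(2) x y by (simp add: w_def inner_diff_right)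
    then have "a $ i0 * w $ i0 + (\<Sum>i\<in>?I. a $ i * w $ i) = 0"
      by (simp add: inner_vec_def sum.remove[of UNIV i0])
    then have "\<bar>a $ i0\<bar> * \<bar>w $ i0\<bar> = \<bar>\<Sum>i\<in>?I. a $ i * w $ i\<bar>"
      by (simp add: abs_mult[symmetric])
    also have "\<dots> \<le> (\<Sum>i\<in>?I. \<bar>a $ i * w $ i\<bar>)" by (rule sum_abs)
    also have "\<dots> \<le> (\<Sum>i\<in>?I. \<bar>a $ i0\<bar> * s i0 / ?d)"
    proof (rule sum_mono)
      fix i assume "i \<in> ?I"
      have "\<bar>a $ i * w $ i\<bar> \<le> \<bar>a $ i\<bar> * (s i / ?d)"
        unfolding abs_mult using le[OF \<open>i \<in> ?I\<close>] by (intro mult_left_mono) auto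
      also have "\<dots> \<le> \<bar>a $ i0\<bar> * s i0 / ?d" using i0[of i] by (simp add: divide_right_mono)
      finally show "\<bar>a $ i * w $ i\<bar> \<le> \<bar>a $ i0\<bar> * s i0 / ?d" .
    qed
    also have "\<dots> = real (card ?I) * (\<bar>a $ i0\<bar> * s i0 / ?d)" by simp
    also have "\<dots> \<le> ?d * (\<bar>a $ i0\<bar> * s i0 / ?d)"
      using s(1)[of i0] by (intro mult_right_mono) (auto intro!: divide_nonneg_nonneg mult_nonneg_nonneg simp: less_imp_le)
    also have "\<dots> = \<bar>a $ i0\<bar> * s i0" by simp
    finally have "\<bar>w $ i0\<bar> \<le> s i0" using ai0 by simp
    moreover have "\<bar>w $ i\<bar> \<le> s i" if "i \<noteq> i0" for i
    proof -
      have "s i / ?d \<le> s i / 1" using s(1)[of i] d1 by (intro divide_left_mono) auto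
      then show ?thesis using le[of i] that by simp
    qed
    ultimately have "\<bar>w $ i\<bar> \<le> s i" for i by (cases "i = i0") auto
    then show "x - y \<in> boxp L s" using x y diff_mem by (auto simp: boxp_def w_def)
  qed (use s S0 finite_boxp d1 in \<open>auto simp: boxp_def less_imp_le\<close>)
  also have "\<dots> \<le> (\<Prod>i\<in>?I. 4 * ?d * (S i / s i)) * real (card (boxp L s))"
  proof (intro mult_right_mono prod_mono conjI)
    fix i
    have "1 * 1 \<le> ?d * (S i / s i)" using d1 ratio[of i] by (intro mult_mono) auto
    moreover have "2 * S i / (s i / ?d) = 2 * (?d * (S i / s i))" "4 * ?d * (S i / s i) = 4 * (?d * (S i / s i))"
      by simp_all
    ultimately show "2 * S i / (s i / ?d) + 2 \<le> 4 * ?d * (S i / s i)" by linarith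
    show "0 \<le> 2 * S i / (s i / ?d) + 2" using S0[of i] s(1)[of i] by (simp add: add_nonneg_nonneg)
  qed simp
  also have "(\<Prod>i\<in>?I. 4 * ?d * (S i / s i)) \<le> (4 * ?d) ^ CARD('k) * (\<Prod>i\<in>UNIV. S i / s i) / \<kappa>"
  proof -
    \<comment> \<open>The saving is the ratio missing at \<open>i0\<close>. Since \<open>i0\<close>
      depends on the hyperplane, \<open>\<kappa>\<close> is a lower bound for all the
      ratios.\<close>
    have p: "(\<Prod>i\<in>?I. S i / s i) * \<kappa> \<le> (\<Prod>i\<in>UNIV. S i / s i)"
    proof -
      have "(\<Prod>i\<in>?I. S i / s i) * \<kappa> \<le> (\<Prod>i\<in>?I. S i / s i) * (S i0 / s i0)"
        using \<kappa>(2)[of i0] S0 s(1) by (intro mult_left_mono prod_nonneg) (auto simp: less_imp_le)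
      also have "\<dots> = (\<Prod>i\<in>UNIV. S i / s i)"
        by (simp add: prod.remove[of UNIV i0 "\<lambda>i. S i / s i"] mult.commute)
      finally show ?thesis .
    qed
    have "(\<Prod>i\<in>?I. 4 * ?d * (S i / s i)) = (4 * ?d) ^ card ?I * (\<Prod>i\<in>?I. S i / s i)"
      by (simp only: prod.distrib prod_constant power_mult_distrib)
    also have "\<dots> \<le> (4 * ?d) ^ CARD('k) * ((\<Prod>i\<in>UNIV. S i / s i) / \<kappa>)"
    proof (intro mult_mono power_increasing)
      show "(\<Prod>i\<in>?I. S i / s i) \<le> (\<Prod>i\<in>UNIV. S i / s i) / \<kappa>"
        using p \<kappa>(1) by (simp add: pos_le_divide_eq)
      show "1 \<le> 4 * ?d" using d1 by linarith
    qed (use S0 s(1) in \<open>auto intro!: prod_nonneg card_mono simp: less_imp_le\<close>)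
    finally show ?thesis by simp
  qed
  finally show ?thesis by (simp add: mult_right_mono)
qed

text \<open>Round down the coefficients of \<open>y\<close> in a basis taken from the box; each
  basis vector then contributes at most \<open>S i\<close> to the error in coordinate
  \<open>i\<close>.\<close>

lemma approx_if_spanning:
  assumes "span (boxp L S) = UNIV" "\<And>i. 0 \<le> S i"
  obtains x where "x \<in> L" "\<And>i. \<bar>y $ i - x $ i\<bar> \<le> real CARD('k) * S i"
proof -
  obtain B where B: "B \<subseteq> boxp L S" "independent B" "boxp L S \<subseteq> span B" "card B = dim (boxp L S)"
    using basis_exists by metis
  have fin: "finite B" using B(2) independent_imp_finite by blast
  have cB: "card B \<le> CARD('k)" using B(4) dim_subset_UNIV[of "boxp L S"] by simp
  have "span B = UNIV" using assms(1) B(3) by (metis span_minimal subspace_span top.extremum_uniqueI)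
  then obtain c where c: "y = (\<Sum>b\<in>B. c b *\<^sub>R b)"
    using span_finite[OF fin] by auto
  define x where "x = (\<Sum>b\<in>B. of_int \<lfloor>c b\<rfloor> *\<^sub>R b)"
  have "x \<in> L" unfolding x_def using B(1) by (intro sum_mem of_int_mem) (auto simp: boxp_def)
  moreover have "\<bar>y $ i - x $ i\<bar> \<le> real CARD('k) * S i" for i
  proof -
    have "\<bar>y $ i - x $ i\<bar> = \<bar>\<Sum>b\<in>B. (c b - of_int \<lfloor>c b\<rfloor>) * b $ i\<bar>"
      by (simp add: c x_def left_diff_distrib sum_subtractf)
    also have "\<dots> \<le> (\<Sum>b\<in>B. \<bar>(c b - of_int \<lfloor>c b\<rfloor>) * b $ i\<bar>)" by (rule sum_abs)
    also have "\<dots> \<le> (\<Sum>b\<in>B. S i)"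
    proof (rule sum_mono)
      fix b assume "b \<in> B"
      then have "\<bar>b $ i\<bar> \<le> S i" using B(1) by (auto simp: boxp_def)
      moreover have "\<bar>c b - of_int \<lfloor>c b\<rfloor>\<bar> \<le> 1" by linarith
      ultimately have "\<bar>(c b - of_int \<lfloor>c b\<rfloor>) * b $ i\<bar> \<le> 1 * S i"
        unfolding abs_mult by (intro mult_mono) auto
      then show "\<bar>(c b - of_int \<lfloor>c b\<rfloor>) * b $ i\<bar> \<le> S i" by simp
    qed
    also have "\<dots> = real (card B) * S i" by simp
    also have "\<dots> \<le> real CARD('k) * S i" using cB assms(2) by (intro mult_right_mono) auto
    finally show ?thesis .
  qed
  ultimately show ?thesis using that by blast
qed

end

definition spanning :: "real ^ 'n ^ 'm \<Rightarrow> real \<Rightarrow> real \<Rightarrow> bool"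
  where "spanning A r T \<longleftrightarrow> span (boxp (lattice_of A) (side r T)) = UNIV"

lemma count_N_mono: "r \<le> r' \<Longrightarrow> T \<le> T' \<Longrightarrow> count_N A r T \<le> count_N A r' T'"
proof -
  assume "r \<le> r'" "T \<le> T'"
  interpret full_lattice "lattice_of A" by (rule full_lattice_lattice_of)
  show ?thesis unfolding count_N_eq_card_boxp
    using \<open>r \<le> r'\<close> \<open>T \<le> T'\<close> by (intro card_boxp_mono) (auto simp: side_def split: sum.split)
qed

lemma count_N_scale:
  fixes A :: "real ^ 'n ^ 'm"
  assumes "0 < r" "r \<le> R" "0 < T" "T \<le> T'"
  shows "real (count_N A R T') \<le> (4 * (R / r)) ^ CARD('m) * (4 * (T' / T)) ^ CARD('n) * real (count_N A r T)"
proof -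
  interpret full_lattice "lattice_of A" by (rule full_lattice_lattice_of)
  have "real (count_N A R T') \<le> (\<Prod>i\<in>(UNIV :: ('m + 'n) set). 4 * (side R T' i / side r T i)) * real (count_N A r T)"
    unfolding count_N_eq_card_boxp
    using assms by (intro card_boxp_scale) (auto simp: side_def split: sum.split)
  then show ?thesis by (simp add: prod_UNIV_Plus)
qed

lemma count_N_not_spanning:
  fixes A :: "real ^ 'n ^ 'm"
  assumes "0 < r" "r \<le> R" "0 < T" "T \<le> T'" "\<not> spanning A R T'"
    "0 < \<kappa>" "\<kappa> \<le> R / r" "\<kappa> \<le> T' / T"
  shows "real (count_N A R T') \<le> (4 * real CARD('m + 'n)) ^ CARD('m + 'n) *
    ((R / r) ^ CARD('m) * (T' / T) ^ CARD('n)) / \<kappa> * real (count_N A r T)"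
proof -
  interpret full_lattice "lattice_of A" by (rule full_lattice_lattice_of)
  have "real (count_N A R T') \<le> (4 * real CARD('m + 'n)) ^ CARD('m + 'n) *
    (\<Prod>i\<in>(UNIV :: ('m + 'n) set). side R T' i / side r T i) / \<kappa> * real (count_N A r T)"
    unfolding count_N_eq_card_boxp
    using assms by (intro card_boxp_hyperplane) (auto simp: side_def spanning_def split: sum.split)
  then show ?thesis by (simp add: prod_UNIV_Plus)
qed

text \<open>The target in R^d is \<open>x\<close> followed by a zero block, so the error in the
  second block bounds \<open>q\<close> itself.\<close>

lemma spanning_approx:
  fixes A :: "real ^ 'n ^ 'm"
  assumes "spanning A r T" "0 \<le> r" "0 \<le> T"
  obtains p q where "infnorm (A *v real_vec q - real_vec p - x) \<le> real CARD('m + 'n) * r"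
    "infnorm (real_vec q) \<le> real CARD('m + 'n) * T"
proof -
  interpret full_lattice "lattice_of A" by (rule full_lattice_lattice_of)
  define y :: "real ^ ('m + 'n)" where "y = (\<chi> k. case k of Inl i \<Rightarrow> x $ i | Inr j \<Rightarrow> 0)"
  have "0 \<le> side r T k" for k :: "'m + 'n" using assms by (cases k) auto
  then obtain w where w: "w \<in> lattice_of A" "\<And>i. \<bar>y $ i - w $ i\<bar> \<le> real CARD('m + 'n) * side r T i"
    using approx_if_spanning[of "side r T" y] assms(1) unfolding spanning_def by blast
  then obtain p q where z: "w = lattice_pt A (p, q)" by (auto simp: lattice_of_eq)
  have "\<bar>(A *v real_vec q - real_vec p - x) $ i\<bar> \<le> real CARD('m + 'n) * r" for i
    using w(2)[of "Inl i"] by (simp add: z y_def)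
  moreover have "\<bar>real_vec q $ j\<bar> \<le> real CARD('m + 'n) * T" for j
    using w(2)[of "Inr j"] by (simp add: z y_def)
  ultimately show ?thesis using that[of q p] unfolding infnorm_le_iff by blast
qed

text \<open>Dirichlet's pigeonhole, read as a lower bound for N: the fractional parts of A q lie in
  a unit cube, which is cut into cells of side \<open>r\<close>. Coordinates of \<open>q\<close>
  taken from [0, T] keep differences within T.\<close>

lemma dirichlet_count_N:
  fixes A :: "real ^ 'n ^ 'm"
  assumes "0 < r" "0 \<le> T"
  shows "T ^ CARD('n) \<le> (2 / r + 2) ^ CARD('m) * real (count_N A r T)"
proof -
  interpret full_lattice "lattice_of A" by (rule full_lattice_lattice_of)
  define Q where "Q = {q :: int ^ 'n. \<forall>i. 0 \<le> q $ i \<and> q $ i \<le> \<lfloor>T\<rfloor>}"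
  define g where "g q = lattice_pt A (\<chi> i. \<lfloor>(A *v real_vec q) $ i\<rfloor>, q)" for q
  have "inj_on g Q" by (rule inj_onI) (auto simp: g_def dest!: injD[OF inj_lattice_pt])
  have "0 \<le> \<lfloor>T\<rfloor>" using assms by simp
  then have "T \<le> real (card {0..\<lfloor>T\<rfloor>})" by simp
  then have "T ^ CARD('n) \<le> real (card Q)"
    unfolding Q_def card_int_box of_nat_power using assms by (intro power_mono) auto
  also have "\<dots> = real (card (g ` Q))" using card_image[OF \<open>inj_on g Q\<close>] by simp
  also have "\<dots> \<le> (\<Prod>i\<in>(UNIV :: 'm set). 2 * 1 / r + 2) * real (card (boxp (lattice_of A) (side r T)))"
  proof (rule card_le_cells[where \<phi> = "\<lambda>i x. x $ Inl i"])
    fix x i assume "x \<in> g ` Q"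
    then obtain q where "x = g q" by auto
    then have "x $ Inl i = (A *v real_vec q) $ i - real_of_int \<lfloor>(A *v real_vec q) $ i\<rfloor>"
      by (simp add: g_def real_vec_def)
    then show "\<bar>x $ Inl i\<bar> \<le> 1" by linarith
  next
    fix x y assume x: "x \<in> g ` Q" and y: "y \<in> g ` Q" and small: "\<And>i. i \<in> UNIV \<Longrightarrow> \<bar>(x - y) $ Inl i\<bar> < r"
    obtain q q' where q: "q \<in> Q" "x = g q" "q' \<in> Q" "y = g q'" using x y by auto
    have "x - y \<in> lattice_of A" using q by (intro diff_mem) (auto simp: g_def lattice_of_eq)
    moreover have "\<bar>(x - y) $ Inr j\<bar> \<le> T" for j
    proof -
      have "\<bar>q $ j - q' $ j\<bar> \<le> \<lfloor>T\<rfloor>" using q(1,3) by (auto simp: Q_def abs_le_iff) (smt (verit))+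
      moreover have "(x - y) $ Inr j = real_of_int (q $ j - q' $ j)" using q by (simp add: g_def real_vec_def)
      ultimately show ?thesis by linarith
    qed
    ultimately show "x - y \<in> boxp (lattice_of A) (side r T)"
      using small by (auto simp: boxp_def split_sum_all less_imp_le)
  qed (use assms finite_boxp in auto)
  finally show ?thesis by (simp add: count_N_eq_card_boxp)
qed

section \<open>Counting approximations on average\<close>

definition unit_cube :: "(real ^ 'm) set"
  where "unit_cube = {x. \<forall>i. 0 \<le> x $ i \<and> x $ i < 1}"

lemma unit_cube_borel [measurable]: "unit_cube \<in> sets borel"
  unfolding unit_cube_def by measurable

lemma emeasure_unit_cube: "emeasure lborel (unit_cube :: (real ^ 'm) set) = 1"
proof -
  have "emeasure (torus_measure :: 'm torus measure) UNIV = emeasure lebesgue (unit_cube :: (real ^ 'm) set)"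
    by (subst emeasure_torus_measure) (auto simp: sets_torus_measure unit_cube_def)
  then show ?thesis by (simp add: emeasure_torus_measure_UNIV)
qed

lemma unit_cube_translates: "\<exists>!p. y - real_vec p \<in> unit_cube"
proof (rule ex1I[of _ "\<chi> i. \<lfloor>y $ i\<rfloor>"])
  have "0 \<le> t - real_of_int \<lfloor>t\<rfloor> \<and> t - real_of_int \<lfloor>t\<rfloor> < 1" for t :: real by linarith
  then show "y - real_vec (\<chi> i. \<lfloor>y $ i\<rfloor>) \<in> unit_cube"
    by (auto simp: unit_cube_def real_vec_def)
  fix p assume *: "y - real_vec p \<in> unit_cube"
  have "p $ i = \<lfloor>y $ i\<rfloor>" for i
  proof -
    have "0 \<le> y $ i - of_int (p $ i)" "y $ i - of_int (p $ i) < 1"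
      using * by (auto simp: unit_cube_def real_vec_def)
    then show ?thesis by linarith
  qed
  then show "p = (\<chi> i. \<lfloor>y $ i\<rfloor>)" by (simp add: vec_eq_iff)
qed

lemma nn_integral_lborel_translate:
  fixes f :: "'a::euclidean_space \<Rightarrow> ennreal"
  assumes [measurable]: "f \<in> borel_measurable borel"
  shows "(\<integral>\<^sup>+x. f (x + c) \<partial>lborel) = (\<integral>\<^sup>+x. f x \<partial>lborel)"
proof -
  have "(\<integral>\<^sup>+x. f x \<partial>lborel) = (\<integral>\<^sup>+x. f x \<partial>(distr lborel borel ((+) c)))"
    by (subst lborel_distr_plus) simp
  also have "\<dots> = (\<integral>\<^sup>+x. f (c + x) \<partial>lborel)"
    by (subst nn_integral_distr) auto
  finally show ?thesis by (simp add: add.commute)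
qed

text \<open>Exactly one integer translate of every point lies in \<open>unit_cube\<close>; Tonelli
  and translation invariance then unfold the cube to all of R^m.\<close>

lemma nn_integral_periodization:
  fixes h :: "real ^ 'm \<Rightarrow> ennreal"
  assumes [measurable]: "h \<in> borel_measurable borel"
  shows "(\<integral>\<^sup>+x. (\<integral>\<^sup>+p. h (x + real_vec p) \<partial>count_space UNIV) * indicator unit_cube x \<partial>lborel) = (\<integral>\<^sup>+x. h x \<partial>lborel)"
proof -
  have ind1: "(\<integral>\<^sup>+p. indicator unit_cube (y - real_vec p) \<partial>count_space UNIV) = (1::ennreal)" for y :: "real ^ 'm"
  proof -
    obtain p0 where p0: "\<And>p. y - real_vec p \<in> unit_cube \<longleftrightarrow> p = p0"
      using unit_cube_translates[of y] by metis
    then have "(\<integral>\<^sup>+p. indicator unit_cube (y - real_vec p) \<partial>count_space UNIV) = (\<integral>\<^sup>+p. indicator {p0} p \<partial>count_space UNIV)"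
      by (intro nn_integral_cong) (auto simp: indicator_def)
    then show ?thesis by simp
  qed
  have "(\<integral>\<^sup>+x. (\<integral>\<^sup>+p. h (x + real_vec p) \<partial>count_space UNIV) * indicator unit_cube x \<partial>lborel)
     = (\<integral>\<^sup>+x. (\<integral>\<^sup>+p. h (x + real_vec p) * indicator unit_cube x \<partial>count_space UNIV) \<partial>lborel)"
    by (intro nn_integral_cong) (simp add: nn_integral_multc)
  also have "\<dots> = (\<integral>\<^sup>+p. (\<integral>\<^sup>+x. h (x + real_vec p) * indicator unit_cube x \<partial>lborel) \<partial>count_space UNIV)"
    by (rule nn_integral_count_space_nn_integral) auto
  also have "\<dots> = (\<integral>\<^sup>+p. (\<integral>\<^sup>+x. h x * indicator unit_cube (x - real_vec p) \<partial>lborel) \<partial>count_space UNIV)"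
  proof (rule nn_integral_cong)
    fix p :: "int ^ 'm"
    show "(\<integral>\<^sup>+x. h (x + real_vec p) * indicator unit_cube x \<partial>lborel) = (\<integral>\<^sup>+x. h x * indicator unit_cube (x - real_vec p) \<partial>lborel)"
      using nn_integral_lborel_translate[of "\<lambda>x. h x * indicator unit_cube (x - real_vec p)" "real_vec p"]
      by simp
  qed
  also have "\<dots> = (\<integral>\<^sup>+x. (\<integral>\<^sup>+p. h x * indicator unit_cube (x - real_vec p) \<partial>count_space UNIV) \<partial>lborel)"
    by (rule nn_integral_count_space_nn_integral[symmetric]) auto
  also have "\<dots> = (\<integral>\<^sup>+x. h x \<partial>lborel)"
    by (intro nn_integral_cong) (simp add: nn_integral_cmult ind1)
  finally show ?thesis .
qed

lemma infnorm_measurable [measurable]: "infnorm \<in> borel_measurable borel"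
  by (intro borel_measurable_continuous_onI continuous_on_infnorm continuous_on_id)

lemma emeasure_infnorm_ball:
  fixes y :: "real ^ 'm"
  assumes "0 \<le> s"
  shows "emeasure lborel {x. infnorm (y - x) \<le> s} = ennreal ((2 * s) ^ CARD('m))"
proof -
  have eq: "{x. infnorm (y - x) \<le> s} = cbox (y - vec s) (y + vec s)"
    by (auto simp: infnorm_le_iff mem_box_cart abs_le_iff algebra_simps)
  have "measure lborel (cbox (y - vec s) (y + vec s)) = (\<Prod>i\<in>UNIV. (y + vec s) $ i - (y - vec s) $ i)"
    using assms by (intro content_cbox_cart) (auto simp: interval_ne_empty_cart)
  also have "\<dots> = (2 * s) ^ CARD('m)" by simp
  finally show ?thesis unfolding eq
    using emeasure_lborel_cbox_finite[of "y - vec s" "y + vec s"]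
    by (subst emeasure_eq_ennreal_measure) auto
qed

text \<open>Approximations are counted for a lift \<open>x\<close> of the torus point and together
  with their integer part, so that the difference of two of them is a pair of the kind that
  \<open>count_N\<close> counts.\<close>

definition hit_set :: "real ^ 'n ^ 'm \<Rightarrow> real \<Rightarrow> real \<Rightarrow> real ^ 'm \<Rightarrow> ((int ^ 'm) \<times> (int ^ 'n)) set"
  where "hit_set A s T x = {(p, q). infnorm (A *v real_vec q - real_vec p - x) \<le> s \<and> infnorm (real_vec q) \<le> T}"

definition hits :: "real ^ 'n ^ 'm \<Rightarrow> real \<Rightarrow> real \<Rightarrow> real ^ 'm \<Rightarrow> nat"
  where "hits A s T x = card (hit_set A s T x)"

lemma hit_set_diff:
  assumes "z \<in> hit_set A s T x" "w \<in> hit_set A s' T' x"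
  shows "z - w \<in> {(p, q). infnorm (A *v real_vec q - real_vec p) \<le> s + s' \<and> infnorm (real_vec q) \<le> T + T'}"
proof -
  obtain p q where z: "z = (p, q)" by force
  obtain p' q' where w: "w = (p', q')" by force
  have "infnorm (A *v real_vec (q - q') - real_vec (p - p')) =
      infnorm ((A *v real_vec q - real_vec p - x) + (x - (A *v real_vec q' - real_vec p')))"
    by (simp add: real_vec_diff matrix_vector_mult_diff_distrib algebra_simps)
  also have "\<dots> \<le> infnorm (A *v real_vec q - real_vec p - x) + infnorm (x - (A *v real_vec q' - real_vec p'))"
    by (rule infnorm_triangle)
  also have "infnorm (x - (A *v real_vec q' - real_vec p')) = infnorm (A *v real_vec q' - real_vec p' - x)"
    by (rule infnorm_sub)
  finally have 1: "infnorm (A *v real_vec (q - q') - real_vec (p - p')) \<le> s + s'"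
    using assms by (auto simp: hit_set_def z w)
  have "infnorm (real_vec q - real_vec q') \<le> infnorm (real_vec q) + infnorm (real_vec q')"
    using infnorm_triangle[of "real_vec q" "- real_vec q'"] by (simp add: infnorm_neg)
  then have "infnorm (real_vec (q - q')) \<le> T + T'"
    using assms by (auto simp: hit_set_def z w real_vec_diff)
  with 1 show ?thesis by (simp add: z w)
qed

lemma hit_set_add:
  assumes "z \<in> hit_set A s T x"
    and "w \<in> {(p, q). infnorm (A *v real_vec q - real_vec p) \<le> r \<and> infnorm (real_vec q) \<le> T'}"
  shows "z + w \<in> hit_set A (s + r) (T + T') x"
proof -
  obtain p q where z: "z = (p, q)" by force
  obtain p' q' where w: "w = (p', q')" by force
  have "infnorm (A *v real_vec (q + q') - real_vec (p + p') - x) =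
      infnorm ((A *v real_vec q - real_vec p - x) + (A *v real_vec q' - real_vec p'))"
    by (simp add: real_vec_add matrix_vector_right_distrib algebra_simps)
  also have "\<dots> \<le> infnorm (A *v real_vec q - real_vec p - x) + infnorm (A *v real_vec q' - real_vec p')"
    by (rule infnorm_triangle)
  finally have 1: "infnorm (A *v real_vec (q + q') - real_vec (p + p') - x) \<le> s + r"
    using assms by (auto simp: hit_set_def z w)
  have "infnorm (real_vec (q + q')) \<le> T + T'"
    using assms infnorm_triangle[of "real_vec q" "real_vec q'"] by (auto simp: hit_set_def z w real_vec_add)
  with 1 show ?thesis by (simp add: z w hit_set_def)
qed

lemma finite_hit_set: "finite (hit_set A s T x)"
proof (cases "hit_set A s T x = {}")
  case False
  then obtain w where w: "w \<in> hit_set A s T x" by auto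
  have sub: "(\<lambda>z. z - w) ` hit_set A s T x \<subseteq>
      {(p, q). infnorm (A *v real_vec q - real_vec p) \<le> s + s \<and> infnorm (real_vec q) \<le> T + T}"
    by (rule image_subsetI) (rule hit_set_diff[OF _ w])
  have "inj_on (\<lambda>z. z - w) (hit_set A s T x)" by (auto intro: inj_onI)
  then show ?thesis using sub finite_count_N_set by (rule inj_on_finite)
qed simp

text \<open>The clustering of approximations: one hit plus each pair counted by
  \<open>count_N\<close> is again a hit, in an enlarged box.\<close>

lemma count_N_le_hits:
  assumes "hit_set A s T x \<noteq> {}"
  shows "count_N A r T' \<le> hits A (s + r) (T + T') x"
proof -
  obtain z where z: "z \<in> hit_set A s T x" using assms by auto
  show ?thesis unfolding hits_def count_N_def
  proof (rule card_inj_on_le[OF _ _ finite_hit_set])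
    show "(+) z ` {(p, q). infnorm (A *v real_vec q - real_vec p) \<le> r \<and> infnorm (real_vec q) \<le> T'}
      \<subseteq> hit_set A (s + r) (T + T') x"
      using hit_set_add[OF z] by blast
  qed auto
qed

lemma hits_eq_nn_integral:
  "ennreal (real (hits A s T x)) = (\<integral>\<^sup>+z. indicator (hit_set A s T x) z \<partial>count_space UNIV)"
  using finite_hit_set[of A s T x] by (simp add: hits_def ennreal_of_nat_eq_real_of_nat)

lemma measurable_indicator_hit_set [measurable]:
  "(\<lambda>x. indicator (hit_set A s T x) z :: ennreal) \<in> borel_measurable borel"
proof -
  obtain p q where z: "z = (p, q)" by force
  have "(\<lambda>x. indicator (hit_set A s T x) z :: ennreal) =
    indicator {x. infnorm (A *v real_vec q - real_vec p - x) \<le> s \<and> infnorm (real_vec q) \<le> T}"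
    by (auto simp: fun_eq_iff indicator_def hit_set_def z)
  also have "\<dots> \<in> borel_measurable borel" by measurable
  finally show ?thesis .
qed

lemma borel_measurable_nn_integral_count_space:
  fixes f :: "'i::countable \<Rightarrow> 'a \<Rightarrow> ennreal"
  assumes [measurable]: "\<And>i. f i \<in> borel_measurable M"
  shows "(\<lambda>x. \<integral>\<^sup>+i. f i x \<partial>count_space UNIV) \<in> borel_measurable M"
proof -
  interpret sigma_finite_measure "count_space (UNIV :: 'i set)"
    by (rule sigma_finite_measure_count_space_countable) simp
  show ?thesis by (intro borel_measurable_nn_integral) (simp add: measurable_split_conv, measurable)
qed

lemma hits_measurable [measurable]: "(\<lambda>x. real (hits A s T x)) \<in> borel_measurable borel"
proof -
  have "(\<lambda>x. ennreal (real (hits A s T x))) \<in> borel_measurable borel"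
    unfolding hits_eq_nn_integral by (rule borel_measurable_nn_integral_count_space) measurable
  then have "(\<lambda>x. enn2real (ennreal (real (hits A s T x)))) \<in> borel_measurable borel" by measurable
  then show ?thesis by simp
qed

text \<open>Summation over \<open>p\<close> unfolds the cube, which asks for a periodic weight. The
  weight 1 yields the mean of \<open>hits\<close>; \<open>hits\<close> at another scale as weight
  yields the correlation.\<close>

lemma hits_weighted_integral:
  fixes A :: "real ^ 'n ^ 'm" and g :: "real ^ 'm \<Rightarrow> ennreal"
  assumes [measurable]: "g \<in> borel_measurable borel" and g: "\<And>x p. g (x + real_vec p) = g x"
  shows "(\<integral>\<^sup>+x. ennreal (real (hits A s T x)) * g x * indicator unit_cube x \<partial>lborel) =
    (\<Sum>q | infnorm (real_vec q) \<le> T. \<integral>\<^sup>+x. indicator {x. infnorm (A *v real_vec q - x) \<le> s} x * g x \<partial>lborel)"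
proof -
  let ?Q = "{q :: int ^ 'n. infnorm (real_vec q) \<le> T}"
  let ?h = "\<lambda>q x. indicator {x. infnorm (A *v real_vec q - x) \<le> s} x * g x"
  have fin: "finite ?Q" by (rule finite_infnorm_real_vec_le)
  have split: "ennreal (real (hits A s T x)) * g x = (\<Sum>q\<in>?Q. \<integral>\<^sup>+p. ?h q (x + real_vec p) \<partial>count_space UNIV)" for x
  proof -
    have "hit_set A s T x = (\<Union>q\<in>?Q. (\<lambda>p. (p, q)) ` {p. infnorm (A *v real_vec q - (x + real_vec p)) \<le> s})"
      by (auto simp: hit_set_def image_iff diff_diff_eq add.commute)
    moreover have fin1: "finite {p. infnorm (A *v real_vec q - (x + real_vec p)) \<le> s}" if "q \<in> ?Q" for q
    proof -
      have "(\<lambda>p. (p, q)) ` {p. infnorm (A *v real_vec q - (x + real_vec p)) \<le> s} \<subseteq> hit_set A s T x"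
        using that by (auto simp: hit_set_def diff_diff_eq add.commute)
      then show ?thesis using finite_hit_set finite_subset finite_imageD inj_onI
        by (metis (no_types, lifting) prod.inject)
    qed
    ultimately have "hits A s T x = (\<Sum>q\<in>?Q. card {p. infnorm (A *v real_vec q - (x + real_vec p)) \<le> s})"
      unfolding hits_def using fin
      by (simp only:) (subst card_UN_disjoint, auto simp: card_image inj_on_def intro!: sum.cong)
    then have "ennreal (real (hits A s T x)) =
        (\<Sum>q\<in>?Q. ennreal (real (card {p. infnorm (A *v real_vec q - (x + real_vec p)) \<le> s})))"
      by simp
    then have "ennreal (real (hits A s T x)) * g x =
        (\<Sum>q\<in>?Q. ennreal (real (card {p. infnorm (A *v real_vec q - (x + real_vec p)) \<le> s})) * g x)"
      by (simp only: sum_distrib_right)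
    also have "\<dots> = (\<Sum>q\<in>?Q. \<integral>\<^sup>+p. ?h q (x + real_vec p) \<partial>count_space UNIV)"
    proof (rule sum.cong)
      fix q assume q: "q \<in> ?Q"
      have "(\<integral>\<^sup>+p. ?h q (x + real_vec p) \<partial>count_space UNIV) =
          (\<integral>\<^sup>+p. indicator {p. infnorm (A *v real_vec q - (x + real_vec p)) \<le> s} p * g x \<partial>count_space UNIV)"
        by (intro nn_integral_cong) (simp add: g indicator_def)
      also have "\<dots> = ennreal (real (card {p. infnorm (A *v real_vec q - (x + real_vec p)) \<le> s})) * g x"
        using fin1[OF q] by (simp add: nn_integral_multc ennreal_of_nat_eq_real_of_nat)
      finally show "ennreal (real (card {p. infnorm (A *v real_vec q - (x + real_vec p)) \<le> s})) * g x
          = (\<integral>\<^sup>+p. ?h q (x + real_vec p) \<partial>count_space UNIV)" by simp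
    qed simp
    finally show ?thesis .
  qed
  have "(\<integral>\<^sup>+x. ennreal (real (hits A s T x)) * g x * indicator unit_cube x \<partial>lborel) =
      (\<integral>\<^sup>+x. (\<Sum>q\<in>?Q. (\<integral>\<^sup>+p. ?h q (x + real_vec p) \<partial>count_space UNIV) * indicator unit_cube x) \<partial>lborel)"
    unfolding split by (simp add: sum_distrib_right)
  also have "\<dots> = (\<Sum>q\<in>?Q. \<integral>\<^sup>+x. (\<integral>\<^sup>+p. ?h q (x + real_vec p) \<partial>count_space UNIV) * indicator unit_cube x \<partial>lborel)"
  proof (rule nn_integral_sum)
    fix q
    have [measurable]: "(\<lambda>x. \<integral>\<^sup>+p. ?h q (x + real_vec p) \<partial>count_space UNIV) \<in> borel_measurable borel"
      by (rule borel_measurable_nn_integral_count_space) measurable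
    show "(\<lambda>x. (\<integral>\<^sup>+p. ?h q (x + real_vec p) \<partial>count_space UNIV) * indicator unit_cube x) \<in> borel_measurable lborel"
      by measurable
  qed
  also have "\<dots> = (\<Sum>q\<in>?Q. \<integral>\<^sup>+x. ?h q x \<partial>lborel)"
    by (intro sum.cong nn_integral_periodization) auto
  finally show ?thesis .
qed

lemma hits_add_real_vec: "hits A s T (x + real_vec p0) = hits A s T x"
  unfolding hits_def
proof (rule bij_betw_same_card[OF bij_betw_byWitness])
  show "(\<lambda>(p, q). (p + p0, q)) ` hit_set A s T (x + real_vec p0) \<subseteq> hit_set A s T x"
    by (auto simp: hit_set_def real_vec_add algebra_simps)
  show "(\<lambda>(p, q). (p - p0, q)) ` hit_set A s T x \<subseteq> hit_set A s T (x + real_vec p0)"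
    by (auto simp: hit_set_def real_vec_diff algebra_simps)
qed auto

lemma nn_integral_hits:
  fixes A :: "real ^ 'n ^ 'm"
  assumes "0 \<le> s"
  shows "(\<integral>\<^sup>+x. ennreal (real (hits A s T x)) * indicator unit_cube x \<partial>lborel) =
    ennreal (real (card {q :: int ^ 'n. infnorm (real_vec q) \<le> T}) * (2 * s) ^ CARD('m))"
  using hits_weighted_integral[of "\<lambda>_. 1" A s T] assms
  by (simp add: emeasure_infnorm_ball ennreal_mult ennreal_of_nat_eq_real_of_nat)

text \<open>After unfolding, the first hit is (0, q). A second hit at the same point differs from it
  by a pair counted by \<open>count_N\<close>, and each candidate for the second hit is one on a set
  of measure at most (2 s')^m.\<close>

lemma nn_integral_hits_hits:
  fixes A :: "real ^ 'n ^ 'm"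
  assumes "0 \<le> s" "0 \<le> s'"
  shows "(\<integral>\<^sup>+x. ennreal (real (hits A s T x) * real (hits A s' T' x)) * indicator unit_cube x \<partial>lborel) \<le>
    ennreal (real (card {q :: int ^ 'n. infnorm (real_vec q) \<le> T}) * real (count_N A (s + s') (T + T')) * (2 * s') ^ CARD('m))"
proof -
  let ?Q = "{q :: int ^ 'n. infnorm (real_vec q) \<le> T}"
  define X where "X = {(p :: int ^ 'm, q :: int ^ 'n). infnorm (A *v real_vec q - real_vec p) \<le> s + s' \<and> infnorm (real_vec q) \<le> T + T'}"
  have "(\<integral>\<^sup>+x. ennreal (real (hits A s T x) * real (hits A s' T' x)) * indicator unit_cube x \<partial>lborel) =
    (\<Sum>q\<in>?Q. \<integral>\<^sup>+x. indicator {x. infnorm (A *v real_vec q - x) \<le> s} x * ennreal (real (hits A s' T' x)) \<partial>lborel)"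
    using hits_weighted_integral[of "\<lambda>x. ennreal (real (hits A s' T' x))" A s T]
    by (simp add: hits_add_real_vec ennreal_mult)
  also have "\<dots> \<le> (\<Sum>q\<in>?Q. ennreal (real (count_N A (s + s') (T + T')) * (2 * s') ^ CARD('m)))"
  proof (rule sum_mono)
    fix q assume q: "q \<in> ?Q"
    let ?B = "{x. infnorm (A *v real_vec q - x) \<le> s}"
    have "(\<integral>\<^sup>+x. indicator ?B x * ennreal (real (hits A s' T' x)) \<partial>lborel) =
      (\<integral>\<^sup>+x. (\<integral>\<^sup>+z. indicator ?B x * indicator (hit_set A s' T' x) z \<partial>count_space UNIV) \<partial>lborel)"
      unfolding hits_eq_nn_integral by (simp add: nn_integral_cmult)
    also have "\<dots> = (\<integral>\<^sup>+z. (\<integral>\<^sup>+x. indicator ?B x * indicator (hit_set A s' T' x) z \<partial>lborel) \<partial>count_space UNIV)"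
      by (rule nn_integral_count_space_nn_integral) auto
    also have "\<dots> \<le> (\<integral>\<^sup>+z. ennreal ((2 * s') ^ CARD('m)) * indicator {z. z - (0, q) \<in> X} z \<partial>count_space UNIV)"
    proof (rule nn_integral_mono)
      fix z :: "(int ^ 'm) \<times> (int ^ 'n)"
      have in0: "(0, q) \<in> hit_set A s T x" if "x \<in> ?B" for x
        using that q by (simp add: hit_set_def real_vec_0)
      show "(\<integral>\<^sup>+x. indicator ?B x * indicator (hit_set A s' T' x) z \<partial>lborel) \<le>
        ennreal ((2 * s') ^ CARD('m)) * indicator {z. z - (0, q) \<in> X} z"
      proof (cases "z - (0, q) \<in> X")
        case True
        have "(\<integral>\<^sup>+x. indicator ?B x * indicator (hit_set A s' T' x) z \<partial>lborel) \<le>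
          (\<integral>\<^sup>+x. indicator {x. infnorm ((A *v real_vec (snd z) - real_vec (fst z)) - x) \<le> s'} x \<partial>lborel)"
          by (rule nn_integral_mono) (auto simp: hit_set_def indicator_def)
        also have "\<dots> = ennreal ((2 * s') ^ CARD('m))"
          using assms by (simp add: emeasure_infnorm_ball)
        finally show ?thesis using True by simp
      next
        case False
        have "z - (0, q) \<in> X" if "x \<in> ?B" "z \<in> hit_set A s' T' x" for x
          using hit_set_diff[OF that(2) in0[OF that(1)]] by (simp add: add.commute X_def)
        then have "indicator ?B x * indicator (hit_set A s' T' x) z = (0 :: ennreal)" for x
          using False by (auto simp: indicator_def)
        then show ?thesis by (simp only: nn_integral_const mult_zero_left zero_le)
      qed
    qed
    also have "\<dots> = ennreal ((2 * s') ^ CARD('m)) * emeasure (count_space UNIV) {z. z - (0, q) \<in> X}"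
      by (simp add: nn_integral_cmult)
    also have "emeasure (count_space UNIV) {z. z - (0, q) \<in> X} = ennreal (real (count_N A (s + s') (T + T')))"
    proof -
      have "bij_betw (\<lambda>z. z - (0, q)) {z. z - (0, q) \<in> X} X"
        by (rule bij_betw_byWitness[of _ "\<lambda>z. z + (0, q)"]) auto
      then have "card {z. z - (0, q) \<in> X} = card X" "finite {z. z - (0, q) \<in> X} = finite X"
        by (rule bij_betw_same_card, rule bij_betw_finite)
      moreover have "finite X" unfolding X_def by (rule finite_count_N_set)
      moreover have "card X = count_N A (s + s') (T + T')" by (simp add: X_def count_N_def)
      ultimately show ?thesis by (simp add: ennreal_of_nat_eq_real_of_nat)
    qed
    finally show "(\<integral>\<^sup>+x. indicator ?B x * ennreal (real (hits A s' T' x)) \<partial>lborel) \<le>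
      ennreal (real (count_N A (s + s') (T + T')) * (2 * s') ^ CARD('m))"
      using assms by (simp add: ennreal_mult mult.commute)
  qed
  also have "\<dots> = ennreal (real (card ?Q) * real (count_N A (s + s') (T + T')) * (2 * s') ^ CARD('m))"
    using assms by (simp add: ennreal_mult ennreal_of_nat_eq_real_of_nat mult.assoc)
  finally show ?thesis .
qed

section \<open>Summation of correlations and a zero-one law\<close>

text \<open>Group the indices by the dyadic size of \<open>y\<close> and compare each index of a
  group with the largest one there. The product bound forces it close to 0 or close to the largest,
  so the group of size about 2^(-i) has O(i + 1) members.\<close>

lemma sum_le_of_decaying_products:
  fixes \<rho> :: real
  assumes \<rho>: "0 < \<rho>" "\<rho> < 1"
  shows "\<exists>C\<ge>0. \<forall>S y. finite S \<longrightarrow> (\<forall>l\<in>S. 0 \<le> y l \<and> y l \<le> 1) \<longrightarrow>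
    (\<forall>l\<in>S. \<forall>l'\<in>S. l \<le> l' \<longrightarrow> y l * y l' \<le> \<rho> ^ min l (l' - l)) \<longrightarrow> sum y S \<le> (C :: real)"
proof -
  \<comment> \<open>Two values above (1/2)^(i+1) have product above (1/4)^(i+1), which contradicts
    the bound if both gaps reach \<open>\<kappa> * Suc i\<close>.\<close>
  obtain \<kappa> where \<kappa>: "\<rho> ^ \<kappa> < 1 / 4"
    using real_arch_pow_inv[of "1 / 4" \<rho>] \<rho> by auto
  have "sum y S \<le> 2 * real \<kappa> * 4"
    if fin: "finite S" and y: "\<forall>l\<in>S. 0 \<le> y l \<and> y l \<le> 1"
      and prod: "\<forall>l\<in>S. \<forall>l'\<in>S. l \<le> l' \<longrightarrow> y l * y l' \<le> \<rho> ^ min l (l' - l)" for S and y :: "nat \<Rightarrow> real"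
  proof -
    define S' where "S' = {l \<in> S. y l > 0}"
    have finS': "finite S'" using fin by (simp add: S'_def)
    have "\<exists>i. (1 / 2) ^ Suc i < y l \<and> y l \<le> (1 / 2 :: real) ^ i" if "l \<in> S'" for l
    proof -
      have "0 < y l" using that by (simp add: S'_def)
      from real_arch_pow_inv[OF this, of "1 / 2"] obtain j where j: "(1 / 2) ^ j < y l" by auto
      define j0 where "j0 = (LEAST j. (1 / 2) ^ j < y l)"
      have j0: "(1 / 2) ^ j0 < y l" unfolding j0_def using j by (rule LeastI)
      have "y l \<le> 1" using y that by (simp add: S'_def)
      then have "j0 \<noteq> 0" using j0 by (intro notI) simp
      then obtain i where i: "j0 = Suc i" using not0_implies_Suc by blast
      have "\<not> (1 / 2) ^ i < y l" using not_less_Least[of i "\<lambda>j. (1 / 2) ^ j < y l"] i by (simp add: j0_def)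
      then show ?thesis using j0 i by (auto simp: not_less)
    qed
    then obtain g where g: "\<And>l. l \<in> S' \<Longrightarrow> (1 / 2) ^ Suc (g l) < y l \<and> y l \<le> (1 / 2 :: real) ^ g l"
      by metis
    have level: "real (card {l \<in> S'. g l = i}) \<le> 2 * real \<kappa> * real (Suc i)" for i
    proof (cases "{l \<in> S'. g l = i} = {}")
      case True
      then show ?thesis by (simp only: card.empty) simp
    next
      case False
      define L where "L = Max {l \<in> S'. g l = i}"
      have finL: "finite {l \<in> S'. g l = i}" using finS' by simp
      have L: "L \<in> S'" "g L = i" using Max_in[OF finL False] by (auto simp: L_def)
      have "{l \<in> S'. g l = i} \<subseteq> {..<\<kappa> * Suc i} \<union> (\<lambda>u. L - u) ` {..<\<kappa> * Suc i}"
      proof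
        fix l assume l: "l \<in> {l \<in> S'. g l = i}"
        then have lL: "l \<le> L" using Max_ge[OF finL] by (simp add: L_def)
        have "(1 / 2) ^ Suc i * (1 / 2) ^ Suc i < y l * y L"
          using g[of l] g[of L] l L by (intro mult_strict_mono) auto
        also have "\<dots> \<le> \<rho> ^ min l (L - l)" using prod l L lL by (auto simp: S'_def)
        finally have *: "(1 / 4) ^ Suc i < \<rho> ^ min l (L - l)"
          by (simp only: power_mult_distrib[symmetric]) simp
        have "min l (L - l) < \<kappa> * Suc i"
        proof (rule ccontr)
          assume "\<not> ?thesis"
          then have "\<rho> ^ min l (L - l) \<le> \<rho> ^ (\<kappa> * Suc i)" using \<rho> by (intro power_decreasing) auto
          also have "\<dots> = (\<rho> ^ \<kappa>) ^ Suc i" by (rule power_mult)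
          also have "\<dots> \<le> (1 / 4) ^ Suc i" using \<kappa> \<rho> by (intro power_mono) auto
          finally show False using * by simp
        qed
        then have "l < \<kappa> * Suc i \<or> L - l < \<kappa> * Suc i" by (simp add: min_def split: if_splits)
        then show "l \<in> {..<\<kappa> * Suc i} \<union> (\<lambda>u. L - u) ` {..<\<kappa> * Suc i}"
          using lL by (force simp: image_iff)
      qed
      then have "card {l \<in> S'. g l = i} \<le> card ({..<\<kappa> * Suc i} \<union> (\<lambda>u. L - u) ` {..<\<kappa> * Suc i})"
        by (intro card_mono) auto
      also have "\<dots> \<le> card {..<\<kappa> * Suc i} + card ((\<lambda>u. L - u) ` {..<\<kappa> * Suc i})"
        by (rule card_Un_le)
      also have "\<dots> \<le> \<kappa> * Suc i + \<kappa> * Suc i"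
        using card_image_le[of "{..<\<kappa> * Suc i}" "\<lambda>u. L - u"] by simp
      finally have "card {l \<in> S'. g l = i} \<le> 2 * \<kappa> * Suc i" by simp
      then have "real (card {l \<in> S'. g l = i}) \<le> real (2 * \<kappa> * Suc i)" by (rule of_nat_mono)
      then show ?thesis by (simp only: of_nat_mult of_nat_numeral)
    qed
    \<comment> \<open>Group sizes times values form the differentiated geometric series at
      1/2.\<close>
    have sums: "(\<lambda>i. real (Suc i) * (1 / 2) ^ i) sums 4"
      using geometric_deriv_sums[of "1 / 2 :: real"] by (simp add: power2_eq_square)
    have "sum y S = sum y S'"
    proof (rule sum.mono_neutral_right[OF fin])
      show "\<forall>l\<in>S - S'. y l = 0" using y by (auto simp: S'_def not_less intro: antisym)
    qed (auto simp: S'_def)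
    also have "\<dots> \<le> (\<Sum>l\<in>S'. (1 / 2) ^ g l)" using g by (intro sum_mono) auto
    also have "\<dots> = (\<Sum>i\<in>g ` S'. \<Sum>l\<in>{l \<in> S'. g l = i}. (1 / 2) ^ g l)"
      by (rule sum.image_gen[OF finS'])
    also have "\<dots> = (\<Sum>i\<in>g ` S'. real (card {l \<in> S'. g l = i}) * (1 / 2) ^ i)" by simp
    also have "\<dots> \<le> (\<Sum>i\<in>g ` S'. 2 * real \<kappa> * (real (Suc i) * (1 / 2) ^ i))"
      using level by (intro sum_mono) (simp add: mult.assoc[symmetric] mult_right_mono del: of_nat_Suc)
    also have "\<dots> = 2 * real \<kappa> * (\<Sum>i\<in>g ` S'. real (Suc i) * (1 / 2) ^ i)"
      by (simp add: sum_distrib_left)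
    also have "\<dots> \<le> 2 * real \<kappa> * (\<Sum>i. real (Suc i) * (1 / 2) ^ i)"
      using sums finS' by (intro mult_left_mono sum_le_suminf) (auto simp: sums_iff)
    also have "\<dots> = 2 * real \<kappa> * 4" using sums by (simp add: sums_iff)
    finally show ?thesis .
  qed
  then show ?thesis by (intro exI[of _ "2 * real \<kappa> * 4"]) auto
qed

text \<open>For fixed \<open>k\<close> the sum over those \<open>l\<close> with \<open>x l \<le> x k\<close> is \<open>O(x k)\<close>: the products of two
  quotients \<open>B k l / x k\<close> decay. The remaining pairs are treated symmetrically.\<close>

lemma sum_correlations_le:
  fixes \<rho> :: real
  assumes \<rho>: "0 < \<rho>" "\<rho> < 1"
  shows "\<exists>C\<ge>0. \<forall>x B K. (\<forall>k. 0 < x k) \<longrightarrow> (\<forall>k l. 0 \<le> B k l) \<longrightarrow>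
    (\<forall>k j l. k \<le> j \<longrightarrow> j \<le> l \<longrightarrow> B k l * x j \<le> x k * x l * \<rho> ^ min (j - k) (l - j)) \<longrightarrow>
    (\<Sum>l<K. \<Sum>k\<le>l. B k l) \<le> C * (\<Sum>k<K. x k :: real)"
proof -
  obtain C where C: "C \<ge> 0" "\<And>S y. finite S \<Longrightarrow> (\<forall>l\<in>S. 0 \<le> y l \<and> y l \<le> 1) \<Longrightarrow>
    (\<forall>l\<in>S. \<forall>l'\<in>S. l \<le> l' \<longrightarrow> y l * y l' \<le> \<rho> ^ min l (l' - l)) \<Longrightarrow> sum y S \<le> (C :: real)"
    using sum_le_of_decaying_products[OF \<rho>] by metis
  have "(\<Sum>l<K. \<Sum>k\<le>l. B k l) \<le> 2 * C * (\<Sum>k<K. x k)"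
    if x: "\<forall>k. 0 < x k" and B0: "\<forall>k l. 0 \<le> B k l"
      and B: "\<forall>k j l. k \<le> j \<longrightarrow> j \<le> l \<longrightarrow> B k l * x j \<le> x k * x l * \<rho> ^ min (j - k) (l - j)"
    for x :: "nat \<Rightarrow> real" and B :: "nat \<Rightarrow> nat \<Rightarrow> real" and K
  proof -
    \<comment> \<open>The extreme choices \<open>j = k\<close> and \<open>j = l\<close> bound
      \<open>B k l\<close> by \<open>x l\<close> and by \<open>x k\<close>.\<close>
    have Bl: "B k l \<le> x l" if "k \<le> l" for k l
      using B[rule_format, of k k l] that x[rule_format, of k] by (simp add: mult.commute)
    have Bk: "B k l \<le> x k" if "k \<le> l" for k l
      using B[rule_format, of k l l] that x[rule_format, of l] by simp
    have 1: "(\<Sum>l\<in>{l. k \<le> l \<and> l < K \<and> x l \<le> x k}. B k l) \<le> C * x k" for k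
    proof -
      \<comment> \<open>The index is the lag u = l - k, so that the smaller of two indices measures
        the distance from \<open>k\<close>.\<close>
      let ?S = "{u. k + u < K \<and> x (k + u) \<le> x k}"
      have "finite ?S" by (rule finite_subset[of _ "{..<K}"]) auto
      moreover have "\<forall>u\<in>?S. 0 \<le> B k (k + u) / x k \<and> B k (k + u) / x k \<le> 1"
        using B0 x Bk[of k] by (auto simp: less_imp_le)
      moreover have "\<forall>u\<in>?S. \<forall>v\<in>?S. u \<le> v \<longrightarrow> (B k (k + u) / x k) * (B k (k + v) / x k) \<le> \<rho> ^ min u (v - u)"
      proof (intro ballI impI)
        fix u v assume uv: "u \<in> ?S" "v \<in> ?S" "u \<le> v"
        have "B k (k + u) * B k (k + v) \<le> x (k + u) * B k (k + v)"
          using Bl[of k "k + u"] B0 by (intro mult_right_mono) auto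
        also have "\<dots> \<le> x k * x (k + v) * \<rho> ^ min u (v - u)"
          using B[rule_format, of k "k + u" "k + v"] uv by (simp add: mult.commute)
        also have "\<dots> \<le> x k * x k * \<rho> ^ min u (v - u)"
          using uv x \<rho> by (intro mult_right_mono mult_left_mono) (auto simp: less_imp_le)
        finally show "(B k (k + u) / x k) * (B k (k + v) / x k) \<le> \<rho> ^ min u (v - u)"
          using x[rule_format, of k] by (simp add: field_simps)
      qed
      ultimately have "(\<Sum>u\<in>?S. B k (k + u) / x k) \<le> C" by (rule C(2))
      then have "(\<Sum>u\<in>?S. B k (k + u)) \<le> C * x k"
        using x[rule_format, of k] by (simp add: sum_divide_distrib[symmetric] pos_divide_le_eq)
      moreover have "(\<Sum>u\<in>?S. B k (k + u)) = (\<Sum>l\<in>{l. k \<le> l \<and> l < K \<and> x l \<le> x k}. B k l)"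
        by (rule sum.reindex_bij_witness[of _ "\<lambda>l. l - k" "\<lambda>u. k + u"]) auto
      ultimately show ?thesis by simp
    qed
    have 2: "(\<Sum>k\<in>{k. k \<le> l \<and> x k \<le> x l}. B k l) \<le> C * x l" for l
    proof -
      \<comment> \<open>Lags now run backwards from \<open>l\<close>, which exchanges the two gaps
        inside the minimum.\<close>
      let ?S = "{u. u \<le> l \<and> x (l - u) \<le> x l}"
      have "finite ?S" by (rule finite_subset[of _ "{..l}"]) auto
      moreover have "\<forall>u\<in>?S. 0 \<le> B (l - u) l / x l \<and> B (l - u) l / x l \<le> 1"
        using B0 x Bl[of _ l] by (auto simp: less_imp_le)
      moreover have "\<forall>u\<in>?S. \<forall>v\<in>?S. u \<le> v \<longrightarrow> (B (l - u) l / x l) * (B (l - v) l / x l) \<le> \<rho> ^ min u (v - u)"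
      proof (intro ballI impI)
        fix u v assume uv: "u \<in> ?S" "v \<in> ?S" "u \<le> v"
        have "B (l - u) l * B (l - v) l \<le> x (l - u) * B (l - v) l"
          using Bk[of "l - u" l] B0 by (intro mult_right_mono) auto
        also have "\<dots> \<le> x (l - v) * x l * \<rho> ^ min u (v - u)"
        proof -
          have "l - u - (l - v) = v - u" "l - (l - u) = u" using uv by auto
          then show ?thesis
            using B[rule_format, of "l - v" "l - u" l] uv by (simp add: mult.commute min.commute)
        qed
        also have "\<dots> \<le> x l * x l * \<rho> ^ min u (v - u)"
          using uv x \<rho> by (intro mult_right_mono) (auto simp: less_imp_le)
        finally show "(B (l - u) l / x l) * (B (l - v) l / x l) \<le> \<rho> ^ min u (v - u)"
          using x[rule_format, of l] by (simp add: field_simps)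
      qed
      ultimately have "(\<Sum>u\<in>?S. B (l - u) l / x l) \<le> C" by (rule C(2))
      then have "(\<Sum>u\<in>?S. B (l - u) l) \<le> C * x l"
        using x[rule_format, of l] by (simp add: sum_divide_distrib[symmetric] pos_divide_le_eq)
      moreover have "(\<Sum>u\<in>?S. B (l - u) l) = (\<Sum>k\<in>{k. k \<le> l \<and> x k \<le> x l}. B k l)"
        by (rule sum.reindex_bij_witness[of _ "\<lambda>k. l - k" "\<lambda>u. l - u"]) auto
      ultimately show ?thesis by simp
    qed
    \<comment> \<open>Each pair is charged to the index with the larger \<open>x\<close>. Ties are
      counted twice, which only increases the bound since \<open>B\<close> is nonnegative.\<close>
    have "(\<Sum>l<K. \<Sum>k\<le>l. B k l) \<le> (\<Sum>l<K. (\<Sum>k\<in>{k. k \<le> l \<and> x l \<le> x k}. B k l) + (\<Sum>k\<in>{k. k \<le> l \<and> x k \<le> x l}. B k l))"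
    proof (rule sum_mono)
      fix l
      let ?P = "{k. k \<le> l \<and> x l \<le> x k}" and ?P' = "{k. k \<le> l \<and> x k \<le> x l}"
      have fin: "finite ?P" "finite ?P'" by auto
      have "{..l} = ?P \<union> ?P'" by auto
      then have "(\<Sum>k\<le>l. B k l) + (\<Sum>k\<in>?P \<inter> ?P'. B k l) = (\<Sum>k\<in>?P. B k l) + (\<Sum>k\<in>?P'. B k l)"
        using sum.union_inter[OF fin, of "\<lambda>k. B k l"] by (simp only:)
      moreover have "0 \<le> (\<Sum>k\<in>?P \<inter> ?P'. B k l)" using B0 by (intro sum_nonneg) auto
      ultimately show "(\<Sum>k\<le>l. B k l) \<le> (\<Sum>k\<in>?P. B k l) + (\<Sum>k\<in>?P'. B k l)" by linarith
    qed
    also have "\<dots> = (\<Sum>l<K. \<Sum>k\<in>{k. k \<le> l \<and> x l \<le> x k}. B k l) + (\<Sum>l<K. \<Sum>k\<in>{k. k \<le> l \<and> x k \<le> x l}. B k l)"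
      by (rule sum.distrib)
    also have "(\<Sum>l<K. \<Sum>k\<in>{k. k \<le> l \<and> x l \<le> x k}. B k l) = (\<Sum>k<K. \<Sum>l\<in>{l. k \<le> l \<and> l < K \<and> x l \<le> x k}. B k l)"
    proof -
      have "(\<Sum>l<K. \<Sum>k\<in>{k. k \<le> l \<and> x l \<le> x k}. B k l) = (\<Sum>l<K. \<Sum>k | k \<in> {..<K} \<and> k \<le> l \<and> x l \<le> x k. B k l)"
        by (intro sum.cong) auto
      also have "\<dots> = (\<Sum>k<K. \<Sum>l | l \<in> {..<K} \<and> k \<le> l \<and> x l \<le> x k. B k l)"
        by (rule sum.swap_restrict) auto
      also have "\<dots> = (\<Sum>k<K. \<Sum>l\<in>{l. k \<le> l \<and> l < K \<and> x l \<le> x k}. B k l)"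
        by (intro sum.cong) auto
      finally show ?thesis .
    qed
    also have "\<dots> \<le> (\<Sum>k<K. C * x k)" by (intro sum_mono 1)
    also have "(\<Sum>l<K. \<Sum>k\<in>{k. k \<le> l \<and> x k \<le> x l}. B k l) \<le> (\<Sum>l<K. C * x l)" by (intro sum_mono 2)
    finally show ?thesis by (simp add: sum_distrib_left[symmetric])
  qed
  then show ?thesis using C(1) by (intro exI[of _ "2 * C"]) auto
qed

text \<open>If \<open>U\<close> and its complement were both non-null, Fubini would give a
  translation carrying a non-null part of the complement into a compact subset \<open>S\<close> of
  \<open>U\<close>. A nearby translation by an element of \<open>G\<close> carries it close to
  \<open>S\<close> but, by invariance, off \<open>S\<close>; a neighbourhood of \<open>S\<close>
  with small excess has no room for that.\<close>

lemma zero_one_law_dense_translations: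
  fixes U G :: "'a::euclidean_space set"
  assumes U[measurable]: "U \<in> sets borel" and pos: "\<not> negligible U"
    and dense: "\<And>y e. 0 < e \<Longrightarrow> \<exists>g\<in>G. dist y g < e"
    and inv: "\<And>g x. g \<in> G \<Longrightarrow> x \<in> U \<Longrightarrow> x + g \<in> U"
  shows "negligible (- U)"
proof (rule ccontr)
  assume neg: "\<not> negligible (- U)"
  have UN: "\<exists>n. \<not> negligible (W \<inter> cball 0 (real n))" if "\<not> negligible W" for W :: "'a set"
  proof (rule ccontr)
    assume "\<not> ?thesis"
    then have "negligible (\<Union>n. W \<inter> cball 0 (real n))" by (intro negligible_Union_nat) auto
    moreover have "W = (\<Union>n. W \<inter> cball 0 (real n))"
      by (auto simp: real_arch_simple)
    ultimately show False using that by simp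
  qed
  obtain n where n: "\<not> negligible (U \<inter> cball 0 (real n))" using UN[OF pos] by blast
  obtain n' where n': "\<not> negligible (- U \<inter> cball 0 (real n'))" using UN[OF neg] by blast
  define T where "T = - U \<inter> cball 0 (real n')"
  have [measurable]: "T \<in> sets borel" unfolding T_def by measurable
  have T: "emeasure lborel T > 0"
    using n' negligible_iff_emeasure0[of T] by (simp add: T_def[symmetric] zero_less_iff_neq_zero)
  have U1: "U \<inter> cball 0 (real n) \<in> lmeasurable"
    by (intro bounded_set_imp_lmeasurable) auto
  then have m: "measure lebesgue (U \<inter> cball 0 (real n)) > 0"
    using n negligible_iff_measure0[OF U1] by (simp add: zero_less_measure_iff)
  obtain S where S: "closed S" "S \<subseteq> U \<inter> cball 0 (real n)"
      "U \<inter> cball 0 (real n) - S \<in> lmeasurable"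
      "emeasure lebesgue (U \<inter> cball 0 (real n) - S) < ennreal (measure lebesgue (U \<inter> cball 0 (real n)))"
    using sets_lebesgue_inner_closed[of "U \<inter> cball 0 (real n)" "measure lebesgue (U \<inter> cball 0 (real n))"] U1 m
    by blast
  have compS: "compact S" using S bounded_subset[OF bounded_cball] by (auto simp: compact_eq_bounded_closed)
  have [measurable]: "S \<in> sets borel" using S(1) by simp
  have Spos: "emeasure lborel S > 0"
  proof (rule ccontr)
    assume "\<not> ?thesis"
    then have "S \<in> null_sets lebesgue" by (auto simp: null_sets_def)
    then have "emeasure lebesgue (U \<inter> cball 0 (real n) - S) = emeasure lebesgue (U \<inter> cball 0 (real n))"
      using U1 by (intro emeasure_Diff_null_set) auto
    then show False using S(4) U1 by (simp add: emeasure_eq_measure2)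
  qed
  \<comment> \<open>Integrated over all translations, the measure of this set is the product of the
    measures of \<open>T\<close> and \<open>S\<close>.\<close>
  have "\<exists>y0. emeasure lborel {x \<in> T. x + y0 \<in> S} > 0"
  proof (rule ccontr)
    assume "\<not> ?thesis"
    then have zero: "emeasure lborel {x \<in> T. x + y \<in> S} = 0" for y by (simp add: zero_less_iff_neq_zero)
    let ?f = "\<lambda>x y. indicator T x * indicator S (x + y) :: ennreal"
    have "emeasure lborel T * emeasure lborel S = (\<integral>\<^sup>+x. indicator T x * emeasure lborel S \<partial>lborel)"
      by (simp add: nn_integral_multc)
    also have "\<dots> = (\<integral>\<^sup>+x. \<integral>\<^sup>+y. ?f x y \<partial>lborel \<partial>lborel)"
    proof (rule nn_integral_cong)
      fix x
      have "(\<integral>\<^sup>+y. indicator S (y + x) \<partial>lborel) = (\<integral>\<^sup>+y. indicator S y \<partial>lborel)"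
        by (rule nn_integral_lborel_translate) measurable
      then show "indicator T x * emeasure lborel S = (\<integral>\<^sup>+y. ?f x y \<partial>lborel)"
        by (simp add: nn_integral_cmult add.commute)
    qed
    also have "\<dots> = (\<integral>\<^sup>+y. \<integral>\<^sup>+x. ?f x y \<partial>lborel \<partial>lborel)"
      by (rule lborel_pair.Fubini'[symmetric]) measurable
    also have "\<dots> = (\<integral>\<^sup>+y. emeasure lborel {x \<in> T. x + y \<in> S} \<partial>lborel)"
    proof (rule nn_integral_cong)
      fix y
      have "?f x y = indicator {x \<in> T. x + y \<in> S} x" for x by (auto simp: indicator_def)
      then show "(\<integral>\<^sup>+x. ?f x y \<partial>lborel) = emeasure lborel {x \<in> T. x + y \<in> S}" by simp
    qed
    also have "\<dots> = 0" by (simp add: zero)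
    finally show False using T Spos by auto
  qed
  then obtain y0 where y0: "emeasure lborel {x \<in> T. x + y0 \<in> S} > 0" by blast
  define h where "h = emeasure lborel {x \<in> T. x + y0 \<in> S}"
  have "h \<le> emeasure lborel (cball (0 :: 'a) (real n'))"
    unfolding h_def T_def by (intro emeasure_mono) auto
  also have "\<dots> < \<infinity>" by (intro emeasure_bounded_finite) auto
  finally obtain h' where h': "h = ennreal h'" "h' > 0" using y0 unfolding h_def[symmetric] by (cases h) auto
  \<comment> \<open>The excess of \<open>O'\<close> over \<open>S\<close> is made smaller than the
    measure \<open>h'\<close> of the set to be moved into it.\<close>
  obtain O' where O': "open O'" "S \<subseteq> O'" "O' - S \<in> lmeasurable" "emeasure lebesgue (O' - S) < ennreal h'"
    using sets_lebesgue_outer_open[of S h'] h' by auto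
  obtain \<delta> where \<delta>: "\<delta> > 0" "\<And>x z. x \<in> S \<Longrightarrow> dist x z < \<delta> \<Longrightarrow> z \<in> O'"
  proof (cases "S = {}")
    case True
    then show ?thesis using that[of 1] by auto
  next
    case False
    obtain e where "e > 0" "(\<Union>x\<in>S. cball x e) \<subseteq> O'"
      using compact_subset_open_imp_cball_epsilon_subset[OF compS O'(1,2)] by blast
    then show ?thesis by (intro that[of e]) (auto simp: subset_eq intro: less_imp_le)
  qed
  \<comment> \<open>The subtraction \<open>x - g\<close> has to imitate \<open>x + y0\<close> and
    stay within \<open>\<delta>\<close> of a point of \<open>S\<close>; hence \<open>g\<close> is
    taken near \<open>- y0\<close>.\<close>
  obtain g where g: "g \<in> G" "dist (- y0) g < \<delta>" using dense[OF \<delta>(1)] by blast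
  have sub: "{x \<in> T. x + y0 \<in> S} \<subseteq> {x. x - g \<in> O' - S}"
  proof
    fix x assume x: "x \<in> {x \<in> T. x + y0 \<in> S}"
    have "dist (x + y0) (x - g) = dist (- y0) g" by (simp add: dist_norm norm_minus_commute algebra_simps)
    then have "x - g \<in> O'" using x g \<delta>(2)[of "x + y0" "x - g"] by simp
    moreover have "x - g \<notin> S"
    proof
      assume "x - g \<in> S"
      then have "(x - g) + g \<in> U" using S(2) g by (intro inv) auto
      then show False using x by (simp add: T_def)
    qed
    ultimately show "x \<in> {x. x - g \<in> O' - S}" by simp
  qed
  have [measurable]: "O' \<in> sets borel" using O'(1) by simp
  have "h \<le> emeasure lborel {x. x - g \<in> O' - S}"
    unfolding h_def by (intro emeasure_mono sub) measurable
  also have "\<dots> = (\<integral>\<^sup>+x. indicator (O' - S) (x + (- g)) \<partial>lborel)"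
  proof -
    have "indicator (O' - S) (x + (- g)) = (indicator {x. x - g \<in> O' - S} x :: ennreal)" for x
      by (simp add: indicator_def)
    then show ?thesis by simp
  qed
  also have "\<dots> = (\<integral>\<^sup>+x. indicator (O' - S) x \<partial>lborel)"
    by (rule nn_integral_lborel_translate) measurable
  also have "\<dots> = emeasure lborel (O' - S)" by simp
  also have "\<dots> < ennreal h'" using O'(4) by simp
  finally show False using h' by simp
qed

section \<open>The convergence case\<close>

lemma to_torus_diff: "to_torus y - to_torus x = to_torus (y - x)"
  by (simp add: to_torus.abs_eq minus_torus.abs_eq)

lemma to_torus_minus_real_vec: "to_torus (x - real_vec p) = to_torus x"
proof -
  have "torus_rel (x - real_vec p) x"
    unfolding torus_rel_def by (rule range_eqI[of _ _ "- p"]) (simp add: real_vec_minus)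
  then show ?thesis by (simp add: to_torus.abs_eq torus.abs_eq_iff)
qed

lemma znorm_less_iff:
  "znorm (to_torus y - to_torus x) < t \<longleftrightarrow> (\<exists>p. infnorm (y - real_vec p - x) < t)"
proof -
  have "znorm (to_torus y - to_torus x) = (INF p. infnorm (y - x - real_vec p))"
    unfolding to_torus_diff by (simp add: to_torus.abs_eq znorm.abs_eq)
  moreover have "bdd_below (range (\<lambda>p. infnorm (y - x - real_vec p)))"
    by (rule bdd_belowI[of _ 0]) (auto simp: infnorm_pos_le)
  ultimately show ?thesis by (simp add: cINF_less_iff diff_diff_eq add.commute)
qed

lemma znorm_nonneg: "0 \<le> znorm (to_torus y - to_torus x)"
proof (rule ccontr)
  assume "\<not> ?thesis"
  then obtain p where "infnorm (y - real_vec p - x) < 0" using znorm_less_iff[of y x 0] by auto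
  then show False using infnorm_pos_le[of "y - real_vec p - x"] by linarith
qed

lemma null_sets_torus_measureI:
  assumes "negligible (to_torus -` S)"
  shows "S \<in> null_sets torus_measure"
proof -
  have S: "S \<in> sets torus_measure"
    using assms by (simp add: sets_torus_measure negligible_imp_sets)
  have "negligible (to_torus -` S \<inter> {x. \<forall>i. 0 \<le> x $ i \<and> x $ i < 1})"
    using assms by (rule negligible_subset) auto
  then have "emeasure lebesgue (to_torus -` S \<inter> {x. \<forall>i. 0 \<le> x $ i \<and> x $ i < 1}) = 0"
    by (simp add: negligible_iff_null_sets null_setsD1)
  then show ?thesis using S emeasure_torus_measure[OF S] by (simp add: null_setsI)
qed

text \<open>A preimage in R^m of \<open>approx_set\<close>. Unbounded norm of \<open>q\<close>
  replaces infinitude, which leaves only countable quantifiers and makes the set visibly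
  Borel.\<close>

definition near_io :: "real ^ 'n ^ 'm \<Rightarrow> real \<Rightarrow> (real ^ 'm) set"
  where "near_io A \<epsilon> = {x. \<forall>k :: nat. \<exists>q p. real k < infnorm (real_vec q) \<and>
    infnorm (A *v real_vec q - real_vec p - x) < \<epsilon> * psi (CARD('n) / CARD('m)) (infnorm (real_vec q))}"

lemma near_io_borel [measurable]: "near_io A \<epsilon> \<in> sets borel"
  unfolding near_io_def by measurable

text \<open>Balls contain finitely many integer vectors, so infinitely many solutions amount to
  solutions of unbounded norm; \<open>q = 0\<close> is excluded there because its norm exceeds no
  natural number.\<close>

lemma near_io_eq_vimage:
  fixes A :: "real ^ 'n ^ 'm"
  shows "near_io A \<epsilon> = to_torus -` approx_set A (\<lambda>q. \<epsilon> * psi (CARD('n) / CARD('m)) q)"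
proof -
  let ?P = "\<lambda>x q. \<exists>p. infnorm (A *v real_vec q - real_vec p - x) < \<epsilon> * psi (CARD('n) / CARD('m)) (infnorm (real_vec q))"
  have "infinite {q :: int ^ 'n. q \<noteq> 0 \<and> ?P x q} \<longleftrightarrow> (\<forall>k :: nat. \<exists>q. real k < infnorm (real_vec q) \<and> ?P x q)" for x
  proof
    assume inf: "infinite {q :: int ^ 'n. q \<noteq> 0 \<and> ?P x q}"
    show "\<forall>k :: nat. \<exists>q. real k < infnorm (real_vec q) \<and> ?P x q"
    proof
      fix k :: nat
      have "infinite ({q :: int ^ 'n. q \<noteq> 0 \<and> ?P x q} - {q. infnorm (real_vec q) \<le> real k})"
        using inf finite_infnorm_real_vec_le by (rule Diff_infinite_finite[rotated])
      then have "{q :: int ^ 'n. q \<noteq> 0 \<and> ?P x q} - {q. infnorm (real_vec q) \<le> real k} \<noteq> {}"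
        by (rule infinite_imp_nonempty)
      then obtain q where "q \<in> {q :: int ^ 'n. q \<noteq> 0 \<and> ?P x q} - {q. infnorm (real_vec q) \<le> real k}"
        unfolding ex_in_conv[symmetric] by (rule exE)
      then show "\<exists>q. real k < infnorm (real_vec q) \<and> ?P x q" by (auto simp: not_le)
    qed
  next
    assume *: "\<forall>k :: nat. \<exists>q. real k < infnorm (real_vec q) \<and> ?P x q"
    show "infinite {q :: int ^ 'n. q \<noteq> 0 \<and> ?P x q}"
    proof
      assume fin: "finite {q :: int ^ 'n. q \<noteq> 0 \<and> ?P x q}"
      define M where "M = Max (insert 0 ((\<lambda>q. infnorm (real_vec q)) ` {q :: int ^ 'n. q \<noteq> 0 \<and> ?P x q}))"
      obtain k :: nat where k: "M \<le> real k" using real_arch_simple by blast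
      obtain q where q: "real k < infnorm (real_vec q)" "?P x q" using * by blast
      have "q \<noteq> 0" using q(1) by (auto simp: real_vec_0 infnorm_0)
      then have "infnorm (real_vec q) \<le> M" unfolding M_def using fin q(2) by (intro Max_ge) auto
      then show False using q(1) k by simp
    qed
  qed
  then show ?thesis
    unfolding near_io_def approx_set_def vimage_def znorm_less_iff mem_Collect_eq by simp
qed

lemma near_io_periodic: "x \<in> near_io A \<epsilon> \<Longrightarrow> x - real_vec p \<in> near_io A \<epsilon>"
  by (simp add: near_io_eq_vimage to_torus_minus_real_vec)

lemma negligible_if_negligible_Int_unit_cube:
  assumes "negligible (W \<inter> unit_cube)" "\<And>x p. x \<in> W \<Longrightarrow> x - real_vec p \<in> W"
  shows "negligible W"
proof -
  have "negligible (\<Union>p. (+) (real_vec p) ` (W \<inter> unit_cube))"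
  proof (rule negligible_countable_Union)
    show "countable (range (\<lambda>p. (+) (real_vec p) ` (W \<inter> unit_cube)))" by simp
  qed (use assms(1) negligible_translation in auto)
  moreover have "W \<subseteq> (\<Union>p. (+) (real_vec p) ` (W \<inter> unit_cube))"
  proof
    fix x assume x: "x \<in> W"
    obtain p where p: "x - real_vec p \<in> unit_cube" using unit_cube_translates[of x] by blast
    then have "x - real_vec p \<in> W \<inter> unit_cube" using assms(2)[OF x] by simp
    then show "x \<in> (\<Union>p. (+) (real_vec p) ` (W \<inter> unit_cube))"
      by (intro UN_I[of p] image_eqI[of _ _ "x - real_vec p"]) auto
  qed
  ultimately show ?thesis by (rule negligible_subset)
qed

lemma dyadic_interval:
  fixes t :: real
  assumes "1 \<le> t"
  obtains k :: nat where "2 ^ k \<le> t" "t < 2 ^ Suc k"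
proof -
  obtain j :: nat where j: "t < 2 ^ j" using real_arch_pow[of 2 t] by auto
  define j0 where "j0 = (LEAST j :: nat. t < 2 ^ j)"
  have j0: "t < 2 ^ j0" unfolding j0_def using j by (rule LeastI)
  then have "j0 \<noteq> 0" using assms by (intro notI) simp
  then obtain k where k: "j0 = Suc k" using not0_implies_Suc by blast
  have "\<not> t < 2 ^ k" using not_less_Least[of k "\<lambda>j. t < 2 ^ j"] k by (simp add: j0_def)
  then show ?thesis using that[of k] j0 k by simp
qed

lemma psi_antimono: "0 \<le> s \<Longrightarrow> 0 < a \<Longrightarrow> a \<le> b \<Longrightarrow> psi s b \<le> psi s a"
  unfolding psi_def by (intro powr_mono2') auto

text \<open>The number of centres grows like 2^(kn) and the volume of a cube of side e r_k like
  2^(-kn), so the powers of 2^k cancel.\<close>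

lemma card_ball_mult_rad:
  fixes c e :: real
  assumes "0 \<le> c" "0 \<le> e"
  shows "real (card {q :: int ^ 'n. infnorm (real_vec q) \<le> c * 2 ^ k}) * (e * rad CARD('m::finite) CARD('n) k) ^ CARD('m)
    \<le> (2 * c + 1) ^ CARD('n) * e ^ CARD('m)"
proof -
  let ?r = "rad CARD('m) CARD('n) k"
  have "real (card {q :: int ^ 'n. infnorm (real_vec q) \<le> c * 2 ^ k}) \<le> (2 * (c * 2 ^ k) + 1) ^ CARD('n)"
    using assms by (intro card_infnorm_real_vec_le) auto
  also have "\<dots> \<le> ((2 * c + 1) * 2 ^ k) ^ CARD('n)"
    using assms by (intro power_mono) (auto simp: distrib_right)
  finally have "real (card {q :: int ^ 'n. infnorm (real_vec q) \<le> c * 2 ^ k}) * (e * ?r) ^ CARD('m)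
      \<le> ((2 * c + 1) * 2 ^ k) ^ CARD('n) * (e * ?r) ^ CARD('m)"
    using assms rad_pos[of "CARD('m)" "CARD('n)" k] by (intro mult_right_mono) auto
  also have "\<dots> = (2 * c + 1) ^ CARD('n) * e ^ CARD('m) * (?r ^ CARD('m) * (2 ^ k) ^ CARD('n))"
    by (simp only: power_mult_distrib mult_ac)
  also have "?r ^ CARD('m) * (2 ^ k) ^ CARD('n) = 1" by (rule rad_power) (rule zero_less_card_finite)
  finally show ?thesis by simp
qed

lemma negligible_near_io:
  fixes A :: "real ^ 'n ^ 'm"
  assumes sum: "summable (\<lambda>k. 1 / real (count_N A (rad CARD('m) CARD('n) k) (2 ^ k)))"
    and \<epsilon>: "0 < \<epsilon>"
  shows "negligible (near_io A \<epsilon>)"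
proof (rule negligible_if_negligible_Int_unit_cube)
  let ?r = "rad CARD('m) CARD('n)"
  let ?N = "\<lambda>k. real (count_N A (?r k) (2 ^ k))"
  \<comment> \<open>The enlarged box comes from adding a pair of the box (r_k, 2^k) to an
    approximation with \<open>q\<close> of norm below 2^(k+1) and error at most epsilon r_k.\<close>
  let ?h = "\<lambda>k x. real (hits A ((1 + \<epsilon>) * ?r k) (3 * 2 ^ k) x)"
  define E where "E k = {x \<in> unit_cube. ?N k \<le> ?h k x}" for k
  \<comment> \<open>7 = 2 * 3 + 1 comes from counting \<open>q\<close> of norm at most 3 times
    2^k.\<close>
  define C where "C = 7 ^ CARD('n) * (2 * (1 + \<epsilon>)) ^ CARD('m)"
  have C0: "0 \<le> C" using \<epsilon> by (simp add: C_def)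
  have Npos: "0 < ?N k" for k using count_N_pos[of "?r k" "2 ^ k" A] rad_pos[of "CARD('m)" "CARD('n)" k] by simp
  have E_meas [measurable]: "E k \<in> sets lborel" for k unfolding E_def by measurable
  have em: "emeasure lborel (E k) \<le> ennreal (C * (1 / ?N k))" for k
  proof -
    have r0: "0 \<le> (1 + \<epsilon>) * ?r k" using \<epsilon> rad_pos[of "CARD('m)" "CARD('n)" k] by simp
    have "E k = {x \<in> unit_cube. 1 \<le> ennreal (1 / ?N k) * ennreal (?h k x)}"
      unfolding E_def using Npos[of k]
      by (auto simp: ennreal_mult[symmetric] ennreal_1[symmetric] divide_simps simp del: ennreal_1)
    then have "emeasure lborel (E k) \<le> ennreal (1 / ?N k) * (\<integral>\<^sup>+x. ennreal (?h k x) * indicator unit_cube x \<partial>lborel)"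
      by (simp only:) (rule nn_integral_Markov_inequality, measurable)
    also have "\<dots> = ennreal (1 / ?N k * (real (card {q :: int ^ 'n. infnorm (real_vec q) \<le> 3 * 2 ^ k}) * (2 * ((1 + \<epsilon>) * ?r k)) ^ CARD('m)))"
      unfolding nn_integral_hits[OF r0] using r0 by (intro ennreal_mult[symmetric]) auto
    also have "\<dots> \<le> ennreal (1 / ?N k * C)"
    proof (intro ennreal_leI mult_left_mono)
      show "real (card {q :: int ^ 'n. infnorm (real_vec q) \<le> 3 * 2 ^ k}) * (2 * ((1 + \<epsilon>) * ?r k)) ^ CARD('m) \<le> C"
        using card_ball_mult_rad[of 3 "2 * (1 + \<epsilon>)" k, where 'n = 'n and 'm = 'm] \<epsilon>
        unfolding C_def mult.assoc by simp
    qed simp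
    finally show ?thesis by (simp add: mult.commute)
  qed
  have fin: "emeasure lborel (E k) < \<infinity>" for k using em[of k] by (rule le_less_trans) simp
  have "summable (\<lambda>k. measure lborel (E k))"
  proof (rule summable_comparison_test)
    show "summable (\<lambda>k. C * (1 / ?N k))" using sum by (rule summable_mult)
    have "measure lborel (E k) \<le> C * (1 / ?N k)" for k
      unfolding measure_def using em[of k] C0 Npos[of k] by (intro enn2real_leI) auto
    then show "\<exists>K. \<forall>k\<ge>K. norm (measure lborel (E k)) \<le> C * (1 / ?N k)" by simp
  qed
  then have null: "limsup E \<in> null_sets lborel"
    using fin E_meas by (intro borel_cantelli_limsup1) auto
  have "near_io A \<epsilon> \<inter> unit_cube \<subseteq> limsup E"
  proof
    fix x assume x: "x \<in> near_io A \<epsilon> \<inter> unit_cube"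
    have "\<exists>k\<ge>K. x \<in> E k" for K
    proof -
      \<comment> \<open>Asking for norm above 2^K forces the dyadic scale \<open>k\<close> of
        \<open>q\<close> to be at least \<open>K\<close>.\<close>
      have "\<exists>q p. real (2 ^ K) < infnorm (real_vec q) \<and>
          infnorm (A *v real_vec q - real_vec p - x) < \<epsilon> * psi (CARD('n) / CARD('m)) (infnorm (real_vec q))"
        using x unfolding near_io_def by blast
      then obtain q p where q: "2 ^ K < infnorm (real_vec q)"
        "infnorm (A *v real_vec q - real_vec p - x) < \<epsilon> * psi (CARD('n) / CARD('m)) (infnorm (real_vec q))"
        by auto
      have "1 \<le> (2 :: real) ^ K" by simp
      then have "1 \<le> infnorm (real_vec q)" using q(1) by linarith
      then obtain k where k: "2 ^ k \<le> infnorm (real_vec q)" "infnorm (real_vec q) < 2 ^ Suc k"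
        by (rule dyadic_interval)
      have "(2 :: real) ^ K < 2 ^ Suc k" using q(1) k(2) by linarith
      then have "K < Suc k" by (rule power_less_imp_less_exp[rotated]) simp
      then have Kk: "K \<le> k" by simp
      have "psi (CARD('n) / CARD('m)) (infnorm (real_vec q)) \<le> ?r k"
        unfolding rad_def using k(1) by (intro psi_antimono) auto
      then have "\<epsilon> * psi (CARD('n) / CARD('m)) (infnorm (real_vec q)) \<le> \<epsilon> * ?r k"
        using \<epsilon> by simp
      then have "(p, q) \<in> hit_set A (\<epsilon> * ?r k) (2 * 2 ^ k) x"
        using q(2) k(2) by (auto simp: hit_set_def)
      then have "count_N A (?r k) (2 ^ k) \<le> hits A (\<epsilon> * ?r k + ?r k) (2 * 2 ^ k + 2 ^ k) x"
        by (intro count_N_le_hits) auto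
      moreover have "\<epsilon> * ?r k + ?r k = (1 + \<epsilon>) * ?r k" "2 * 2 ^ k + 2 ^ k = 3 * (2 ^ k :: real)"
        by (simp_all add: algebra_simps)
      ultimately have "x \<in> E k" using x by (simp add: E_def)
      then show ?thesis using Kk by blast
    qed
    then show "x \<in> limsup E" by (simp add: limsup_INF_SUP) blast
  qed
  moreover have "negligible (limsup E)"
    using null by (simp add: negligible_iff_null_sets null_sets_completionI)
  ultimately show "negligible (near_io A \<epsilon> \<inter> unit_cube)" by (meson negligible_subset)
qed (rule near_io_periodic)

section \<open>The divergence case\<close>

text \<open>The base of the saving on hyperplanes. For scales k, j, l the side ratios are 2^((j-k)
  n/m) and 2^(l-j); the slower of the two growth rates is used for both.\<close>

definition decay :: "nat \<Rightarrow> nat \<Rightarrow> real"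
  where "decay m n = 2 powr (- min 1 (n / m))"

lemma decay_bounds:
  assumes "0 < m" "0 < n"
  shows "0 < decay m n" "decay m n < 1"
  using assms powr_less_mono[of "- min 1 (real n / real m)" 0 2] by (auto simp: decay_def)

lemma inverse_decay_le:
  assumes "0 < m" "k \<le> j" "j \<le> l"
  shows "(1 / decay m n) ^ min (j - k) (l - j) \<le> rad m n k / rad m n j"
    and "(1 / decay m n) ^ min (j - k) (l - j) \<le> 2 ^ l / 2 ^ j"
proof -
  let ?c = "min 1 (real n / real m)"
  let ?u = "min (j - k) (l - j)"
  have eq: "(1 / decay m n) ^ ?u = 2 powr (?c * real ?u)"
    by (simp add: decay_def powr_minus powr_power inverse_eq_divide mult.commute)
  have r: "rad m n k / rad m n j = 2 powr (real n / real m * real (j - k))"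
  proof -
    have "rad m n k / rad m n j = 2 powr (- (real k * n / m) - - (real j * n / m))"
      unfolding rad_eq by (rule powr_diff[symmetric])
    also have "- (real k * n / m) - - (real j * n / m) = real n / real m * real (j - k)"
      using assms by (simp add: of_nat_diff field_simps)
    finally show ?thesis .
  qed
  have "?c * real ?u \<le> real n / real m * real (j - k)" by (intro mult_mono) auto
  then show "(1 / decay m n) ^ ?u \<le> rad m n k / rad m n j" unfolding eq r by simp
  have "?c * real ?u \<le> 1 * real (l - j)" by (intro mult_mono) auto
  then have "(1 / decay m n) ^ ?u \<le> 2 powr (real (l - j))" unfolding eq by simp
  also have "\<dots> = 2 ^ (l - j)" by (rule powr_realpow) simp
  also have "\<dots> = 2 ^ l / 2 ^ j" using assms by (simp add: power_diff)
  finally show "(1 / decay m n) ^ ?u \<le> 2 ^ l / 2 ^ j" .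
qed

lemma rad_antimono: "k \<le> l \<Longrightarrow> rad m n l \<le> rad m n k"
  unfolding rad_def by (intro psi_antimono) (auto intro: power_increasing)

lemma rad_tendsto_0:
  assumes "0 < m" "0 < n"
  shows "rad m n \<longlonglongrightarrow> 0"
proof -
  have "rad m n = (\<lambda>k. (1 / 2 powr (real n / real m)) ^ k)"
    by (rule ext) (simp add: rad_eq powr_minus power_one_over powr_power inverse_eq_divide mult_ac)
  moreover have "(\<lambda>k. (1 / 2 powr (real n / real m)) ^ k) \<longlonglongrightarrow> 0"
  proof (rule LIMSEQ_realpow_zero)
    have "2 powr 0 < 2 powr (real n / real m)" using assms by (intro powr_less_mono) auto
    then show "1 / 2 powr (real n / real m) < 1" by simp
  qed simp
  ultimately show ?thesis by simp
qed

text \<open>Spanning puts a hit near every \<open>x\<close>, so the count is at most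
  \<open>hits\<close> in an enlarged box for all \<open>x\<close>, hence at most the mean of
  \<open>hits\<close> over the unit cube.\<close>

lemma count_N_le_if_spanning:
  fixes A :: "real ^ 'n ^ 'm"
  assumes sp: "spanning A r T" and r: "0 < r" and T: "1 \<le> T"
  shows "real (count_N A r T) \<le> (2 * real CARD('m + 'n) + 3) ^ CARD('n) * (2 * (real CARD('m + 'n) + 1)) ^ CARD('m) *
    (r ^ CARD('m) * T ^ CARD('n))"
proof -
  let ?d = "real CARD('m + 'n)"
  \<comment> \<open>The terms with \<open>?d\<close> come from approximating \<open>x\<close> by a
    hit, the extra \<open>r\<close> and \<open>T\<close> from adding the counted pairs to
    it.\<close>
  let ?s = "?d * r + r" and ?T = "?d * T + T"
  have s0: "0 \<le> ?s" and T0: "0 \<le> ?T" using r T by (auto intro!: add_nonneg_nonneg mult_nonneg_nonneg)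
  have le: "count_N A r T \<le> hits A ?s ?T x" for x
  proof -
    obtain p q where "infnorm (A *v real_vec q - real_vec p - x) \<le> ?d * r" "infnorm (real_vec q) \<le> ?d * T"
      using spanning_approx[OF sp] r T by (metis less_eq_real_def order_trans zero_le_one)
    then have "(p, q) \<in> hit_set A (?d * r) (?d * T) x" by (simp add: hit_set_def)
    then show ?thesis by (intro count_N_le_hits) auto
  qed
  have "ennreal (real (count_N A r T)) = (\<integral>\<^sup>+x. ennreal (real (count_N A r T)) * indicator (unit_cube :: (real ^ 'm) set) x \<partial>lborel)"
    by (simp add: nn_integral_cmult_indicator emeasure_unit_cube)
  also have "\<dots> \<le> (\<integral>\<^sup>+x. ennreal (real (hits A ?s ?T x)) * indicator unit_cube x \<partial>lborel)"
    using le by (intro nn_integral_mono mult_right_mono ennreal_leI) auto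
  also have "\<dots> = ennreal (real (card {q :: int ^ 'n. infnorm (real_vec q) \<le> ?T}) * (2 * ?s) ^ CARD('m))"
    by (rule nn_integral_hits[OF s0])
  finally have "real (count_N A r T) \<le> real (card {q :: int ^ 'n. infnorm (real_vec q) \<le> ?T}) * (2 * ?s) ^ CARD('m)"
    using s0 by (subst (asm) ennreal_le_iff) auto
  also have "\<dots> \<le> (2 * ?T + 1) ^ CARD('n) * (2 * ?s) ^ CARD('m)"
    using card_infnorm_real_vec_le(1)[OF T0] s0 by (intro mult_right_mono) auto
  also have "2 * ?s = 2 * (?d + 1) * r" by (simp add: algebra_simps)
  also have "(2 * ?T + 1) ^ CARD('n) * (2 * (?d + 1) * r) ^ CARD('m) \<le>
      ((2 * ?d + 3) * T) ^ CARD('n) * (2 * (?d + 1) * r) ^ CARD('m)"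
  proof (rule mult_right_mono[OF power_mono])
    show "2 * ?T + 1 \<le> (2 * ?d + 3) * T" using T by (simp add: algebra_simps)
  qed (use T0 r in auto)
  finally show ?thesis by (simp only: power_mult_distrib mult_ac)
qed

text \<open>The box (r_k, 2^l) is covered by translates of the box (r_j, 2^j), for which r^m T^n is
  1; lying in a hyperplane saves \<open>decay\<close> to the power of the smaller gap.\<close>

lemma count_N_rad_not_spanning:
  fixes A :: "real ^ 'n ^ 'm"
  defines "r \<equiv> rad CARD('m) CARD('n)"
  assumes "k \<le> j" "j \<le> l" "\<not> spanning A (r k) (2 ^ l)"
  shows "real (count_N A (r k) (2 ^ l)) \<le> (4 * real CARD('m + 'n)) ^ CARD('m + 'n) *
    (r k ^ CARD('m) * (2 ^ l) ^ CARD('n)) * decay CARD('m) CARD('n) ^ min (j - k) (l - j) *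
    real (count_N A (r j) (2 ^ j))"
proof -
  let ?D = "decay CARD('m) CARD('n)"
  let ?u = "min (j - k) (l - j)"
  have D: "0 < ?D" by (intro decay_bounds) auto
  have "real (count_N A (r k) (2 ^ l)) \<le> (4 * real CARD('m + 'n)) ^ CARD('m + 'n) *
    ((r k / r j) ^ CARD('m) * (2 ^ l / 2 ^ j) ^ CARD('n)) / ((1 / ?D) ^ ?u) * real (count_N A (r j) (2 ^ j))"
  proof (rule count_N_not_spanning)
    show "(1 / ?D) ^ ?u \<le> r k / r j" "(1 / ?D) ^ ?u \<le> 2 ^ l / 2 ^ j"
      unfolding r_def using assms by (auto intro: inverse_decay_le)
  qed (use assms D in \<open>auto simp: r_def rad_pos rad_antimono power_increasing\<close>)
  also have "(r k / r j) ^ CARD('m) * (2 ^ l / 2 ^ j) ^ CARD('n) =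
      r k ^ CARD('m) * (2 ^ l) ^ CARD('n) / (r j ^ CARD('m) * (2 ^ j) ^ CARD('n))"
    by (simp only: power_divide times_divide_times_eq)
  also have "r j ^ CARD('m) * (2 ^ j) ^ CARD('n) = 1"
    unfolding r_def by (rule rad_power) (rule zero_less_card_finite)
  finally show ?thesis using D by (simp add: power_one_over mult_ac)
qed

text \<open>A point at positive distance from A Z^n + Z^m prevents the boxes (r_k, 2^l) from
  spanning, for one fixed k and all l. The hyperplane bound is then compatible with Dirichlet's
  lower bound only if 1 / N_j decays geometrically.\<close>

lemma dense_if_not_summable:
  fixes A :: "real ^ 'n ^ 'm"
  assumes nsum: "\<not> summable (\<lambda>k. 1 / real (count_N A (rad CARD('m) CARD('n) k) (2 ^ k)))" and e: "0 < e"
  shows "\<exists>p q. infnorm (A *v real_vec q - real_vec p - y) < e"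
proof (rule ccontr)
  assume far: "\<not> ?thesis"
  let ?r = "rad CARD('m) CARD('n)"
  let ?N = "\<lambda>j. real (count_N A (?r j) (2 ^ j))"
  let ?d = "real CARD('m + 'n)"
  let ?D = "decay CARD('m) CARD('n)"
  have D: "0 < ?D" "?D < 1" by (auto intro!: decay_bounds)
  have d0: "0 < ?d" by (rule of_nat_0_less_iff[THEN iffD2]) (rule zero_less_card_finite)
  have "\<forall>\<^sub>F k in sequentially. ?r k < e / ?d"
    using e d0 by (intro order_tendstoD(2)[OF rad_tendsto_0]) auto
  then obtain k where k: "?r k < e / ?d" by (auto simp: eventually_sequentially)
  have ns: "\<not> spanning A (?r k) (2 ^ l)" for l
  proof
    assume "spanning A (?r k) (2 ^ l)"
    then obtain p q where "infnorm (A *v real_vec q - real_vec p - y) \<le> ?d * ?r k"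
        "infnorm (real_vec q) \<le> ?d * 2 ^ l"
      by (rule spanning_approx) (use rad_pos[of "CARD('m)" "CARD('n)" k] in auto)
    moreover have "?d * ?r k < e" using k d0 by (simp add: field_simps)
    ultimately show False using far by (meson le_less_trans)
  qed
  define C where "C = (2 / ?r k + 2) ^ CARD('m) * ((4 * ?d) ^ CARD('m + 'n) * ?r k ^ CARD('m))"
  have rk: "0 < ?r k" by (rule rad_pos)
  \<comment> \<open>The choice \<open>l = 2 * j\<close> makes both gaps at least
    \<open>j - k\<close>, and the factor \<open>?X\<close> cancels between the lower and the upper
    bound.\<close>
  have bound: "1 / ?N j \<le> C * ?D ^ (j - k)" if "k \<le> j" for j
  proof -
    have Nj: "0 < ?N j" using count_N_pos[of "?r j" "2 ^ j" A] rad_pos[of "CARD('m)" "CARD('n)" j] by simp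
    let ?X = "((2::real) ^ (2 * j)) ^ CARD('n)"
    have "?X \<le> (2 / ?r k + 2) ^ CARD('m) * real (count_N A (?r k) (2 ^ (2 * j)))"
      by (rule dirichlet_count_N) (use rk in auto)
    also have "\<dots> \<le> (2 / ?r k + 2) ^ CARD('m) * ((4 * ?d) ^ CARD('m + 'n) *
      (?r k ^ CARD('m) * ?X) * ?D ^ min (j - k) (2 * j - j) * ?N j)"
      using rk that ns by (intro mult_left_mono count_N_rad_not_spanning) auto
    also have "\<dots> = ?X * (C * ?D ^ (j - k) * ?N j)"
      unfolding C_def by (simp add: min_def mult_ac)
    finally have "1 \<le> C * ?D ^ (j - k) * ?N j" by simp
    then show ?thesis using Nj by (simp add: field_simps)
  qed
  have "summable (\<lambda>j. C * ?D ^ j)"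
    using D by (intro summable_mult summable_geometric) auto
  then have "summable (\<lambda>j. 1 / ?N (j + k))"
  proof (rule summable_comparison_test[rotated])
    show "\<exists>M. \<forall>j\<ge>M. norm (1 / ?N (j + k)) \<le> C * ?D ^ j" using bound[of "_ + k"] by simp
  qed
  then show False using nsum summable_iff_shift[of "\<lambda>j. 1 / ?N j" k] by simp
qed

text \<open>Once the norm of \<open>q\<close> exceeds that of \<open>q0\<close>, passing to
  \<open>q + q0\<close> at most doubles the norm, which costs \<open>psi\<close> the factor
  2^(n/m).\<close>

lemma near_io_translate:
  fixes A :: "real ^ 'n ^ 'm"
  assumes x: "x \<in> near_io A \<epsilon>" and \<epsilon>: "0 \<le> \<epsilon>"
  shows "x + (A *v real_vec q0 - real_vec p0) \<in> near_io A (2 powr (CARD('n) / CARD('m)) * \<epsilon>)"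
  unfolding near_io_def
proof (intro CollectI allI)
  fix k :: nat
  let ?s = "real CARD('n) / real CARD('m)"
  obtain K :: nat where K: "real k + infnorm (real_vec q0) \<le> real K" using real_arch_simple by blast
  obtain q p where qp: "real K < infnorm (real_vec q)"
    "infnorm (A *v real_vec q - real_vec p - x) < \<epsilon> * psi ?s (infnorm (real_vec q))"
    using x unfolding near_io_def by blast
  let ?a = "infnorm (real_vec q)" and ?b = "infnorm (real_vec (q + q0))"
  have n0: "0 \<le> infnorm (real_vec q0)" by (rule infnorm_pos_le)
  have "?a \<le> ?b + infnorm (real_vec q0)"
    using infnorm_triangle[of "real_vec (q + q0)" "- real_vec q0"] by (simp add: real_vec_add infnorm_neg)
  then have kb: "real k < ?b" using qp(1) K by linarith
  have "?b \<le> ?a + infnorm (real_vec q0)" unfolding real_vec_add by (rule infnorm_triangle)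
  then have ba: "?b \<le> 2 * ?a" using qp(1) K by linarith
  have b0: "0 < ?b" using kb by linarith
  then have a0: "0 < ?a" using ba by linarith
  have "psi ?s ?a = 2 powr ?s * psi ?s (2 * ?a)"
    using a0 by (simp add: psi_def powr_mult powr_minus)
  also have "\<dots> \<le> 2 powr ?s * psi ?s ?b"
    using ba b0 by (intro mult_left_mono psi_antimono) auto
  finally have "\<epsilon> * psi ?s ?a \<le> \<epsilon> * (2 powr ?s * psi ?s ?b)" using \<epsilon> by (rule mult_left_mono)
  then have lt: "infnorm (A *v real_vec q - real_vec p - x) < 2 powr ?s * \<epsilon> * psi ?s ?b"
    using qp(2) by (simp add: mult_ac)
  have eq: "A *v real_vec (q + q0) - real_vec (p + p0) - (x + (A *v real_vec q0 - real_vec p0)) =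
      A *v real_vec q - real_vec p - x"
    by (simp add: real_vec_add matrix_vector_right_distrib algebra_simps)
  show "\<exists>q p. real k < infnorm (real_vec q) \<and>
    infnorm (A *v real_vec q - real_vec p - (x + (A *v real_vec q0 - real_vec p0))) < 2 powr ?s * \<epsilon> * psi ?s (infnorm (real_vec q))"
    using lt kb unfolding eq[symmetric] by blast
qed

text \<open>The zero-one law needs an invariant set, and the union \<open>U\<close> of the
  translates of \<open>near_io A \<epsilon>\<close> by A Z^n + Z^m is one. By
  \<open>near_io_translate\<close> it stays inside the enlarged set.\<close>

lemma negligible_Compl_near_io_if:
  fixes A :: "real ^ 'n ^ 'm"
  assumes nsum: "\<not> summable (\<lambda>k. 1 / real (count_N A (rad CARD('m) CARD('n) k) (2 ^ k)))"
    and \<epsilon>: "0 \<le> \<epsilon>" and pos: "\<not> negligible (near_io A \<epsilon>)"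
  shows "negligible (- near_io A (2 powr (CARD('n) / CARD('m)) * \<epsilon>))"
proof -
  define g where "g z = A *v real_vec (snd z) - real_vec (fst z)" for z :: "(int ^ 'm) \<times> (int ^ 'n)"
  have g_add: "g (z + w) = g z + g w" for z w
    by (simp add: g_def real_vec_add matrix_vector_right_distrib)
  define U where "U = (\<Union>z. (\<lambda>x. x - g z) -` near_io A \<epsilon>)"
  have "U \<in> sets borel" unfolding U_def
  proof (rule sets.countable_UN'')
    fix z
    have "(\<lambda>x. x - g z) -` near_io A \<epsilon> \<inter> space borel \<in> sets borel"
      by (rule measurable_sets[of _ _ borel]) measurable
    then show "(\<lambda>x. x - g z) -` near_io A \<epsilon> \<in> sets borel" by simp
  qed simp
  moreover have "near_io A \<epsilon> \<subseteq> U"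
  proof
    fix x assume "x \<in> near_io A \<epsilon>"
    then show "x \<in> U" unfolding U_def by (intro UN_I[of 0]) (auto simp: g_def real_vec_0)
  qed
  then have "\<not> negligible U" using pos negligible_subset by blast
  moreover have "\<exists>h\<in>range g. dist y h < e" if "0 < e" for y e
  proof -
    have s: "0 < sqrt (DIM(real ^ 'm))" by simp
    then have "0 < e / sqrt (DIM(real ^ 'm))" using that by simp
    from dense_if_not_summable[OF nsum this, of y]
    obtain p q where "infnorm (A *v real_vec q - real_vec p - y) < e / sqrt (DIM(real ^ 'm))" by blast
    then have "norm (g (p, q) - y) < e"
      using norm_le_infnorm[of "g (p, q) - y"] s by (simp add: g_def pos_less_divide_eq mult.commute)
    then show ?thesis by (intro bexI[of _ "g (p, q)"]) (auto simp: dist_norm norm_minus_commute)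
  qed
  moreover have "x + h \<in> U" if h: "h \<in> range g" and xU: "x \<in> U" for h x
  proof -
    obtain z where z: "h = g z" using h by blast
    obtain w where w: "x - g w \<in> near_io A \<epsilon>" using xU unfolding U_def by blast
    have "x + h - g (w + z) = x - g w" by (simp add: g_add z)
    then have "x + h \<in> (\<lambda>x. x - g (w + z)) -` near_io A \<epsilon>" using w by (simp only: vimage_eq)
    then show ?thesis unfolding U_def by blast
  qed
  ultimately have "negligible (- U)" by (rule zero_one_law_dense_translations)
  moreover have "U \<subseteq> near_io A (2 powr (CARD('n) / CARD('m)) * \<epsilon>)"
  proof
    fix x assume "x \<in> U"
    then obtain z where "x - g z \<in> near_io A \<epsilon>" unfolding U_def by auto
    from near_io_translate[OF this \<epsilon>, of "snd z" "fst z"]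
    show "x \<in> near_io A (2 powr (CARD('n) / CARD('m)) * \<epsilon>)" by (simp add: g_def)
  qed
  ultimately show ?thesis by (meson Compl_subset_Compl_iff negligible_subset)
qed

section \<open>Second moments and positive measure\<close>

lemma Paley_Zygmund_unit_cube:
  fixes Z :: "real ^ 'm \<Rightarrow> real"
  assumes [measurable]: "Z \<in> borel_measurable borel" and Z0: "\<And>x. 0 \<le> Z x"
    and a: "0 < a" and M: "0 < M"
    and mean: "ennreal a \<le> (\<integral>\<^sup>+x. ennreal (Z x) * indicator unit_cube x \<partial>lborel)"
    and sq: "(\<integral>\<^sup>+x. ennreal ((Z x)\<^sup>2) * indicator unit_cube x \<partial>lborel) \<le> ennreal M"
  shows "ennreal (a\<^sup>2 / (4 * M)) \<le> emeasure lborel {x \<in> unit_cube. a / 2 < Z x}"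
proof -
  \<comment> \<open>AM-GM takes the place of Cauchy-Schwarz: on \<open>?E\<close>, \<open>Z\<close>
    is at most t Z^2 / 2 + 1 / (2 t), elsewhere at most a / 2. This \<open>t\<close> turns t M / 2
    into a / 4, half of what is left of the mean.\<close>
  define t where "t = a / (2 * M)"
  have t: "0 < t" using a M by (simp add: t_def)
  let ?E = "{x \<in> unit_cube. a / 2 < Z x}"
  have [measurable]: "?E \<in> sets borel" by measurable
  have "emeasure lborel ?E \<le> emeasure lborel (unit_cube :: (real ^ 'm) set)" by (intro emeasure_mono) auto
  then have "emeasure lborel ?E \<le> 1" by (simp add: emeasure_unit_cube)
  then have "emeasure lborel ?E < \<infinity>" by (rule le_less_trans) simp
  then obtain e where e: "0 \<le> e" "emeasure lborel ?E = ennreal e" by (cases "emeasure lborel ?E") auto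
  have pw: "ennreal (Z x) * indicator unit_cube x \<le>
      ennreal (a / 2) * indicator unit_cube x + (ennreal (t / 2) * (ennreal ((Z x)\<^sup>2) * indicator unit_cube x)
      + ennreal (1 / (2 * t)) * indicator ?E x)" for x
  proof (cases "x \<in> unit_cube")
    case True
    have "0 \<le> (t * Z x - 1)\<^sup>2 / (2 * t)" using t by simp
    also have "(t * Z x - 1)\<^sup>2 / (2 * t) = t / 2 * (Z x)\<^sup>2 - Z x + 1 / (2 * t)"
      using t by (simp add: power2_eq_square field_simps)
    finally have amgm: "Z x \<le> t / 2 * (Z x)\<^sup>2 + 1 / (2 * t)" by simp
    have "Z x \<le> a / 2 + (t / 2 * (Z x)\<^sup>2 + 1 / (2 * t) * indicator ?E x)"
    proof (cases "a / 2 < Z x")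
      case True
      then show ?thesis using amgm a \<open>x \<in> unit_cube\<close> by simp
    next
      case False
      have "0 \<le> t / 2 * (Z x)\<^sup>2" using t by simp
      then show ?thesis using False by simp
    qed
    then have "ennreal (Z x) \<le> ennreal (a / 2 + (t / 2 * (Z x)\<^sup>2 + 1 / (2 * t) * indicator ?E x))"
      by (rule ennreal_leI)
    also have "\<dots> = ennreal (a / 2) + (ennreal (t / 2) * ennreal ((Z x)\<^sup>2) + ennreal (1 / (2 * t)) * indicator ?E x)"
    proof -
      have "ennreal (1 / (2 * t) * indicator ?E x) = ennreal (1 / (2 * t)) * indicator ?E x"
        by (simp add: indicator_def)
      moreover have "ennreal (t / 2 * (Z x)\<^sup>2) = ennreal (t / 2) * ennreal ((Z x)\<^sup>2)"
        using t by (intro ennreal_mult) auto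
      moreover have plus: "ennreal (a / 2 + (p + q)) = ennreal (a / 2) + (ennreal p + ennreal q)" if "0 \<le> p" "0 \<le> q" for p q
        using that a by simp
      have "ennreal (a / 2 + (t / 2 * (Z x)\<^sup>2 + 1 / (2 * t) * indicator ?E x)) =
        ennreal (a / 2) + (ennreal (t / 2 * (Z x)\<^sup>2) + ennreal (1 / (2 * t) * indicator ?E x))"
        using t by (intro plus) auto
      ultimately show ?thesis by (simp only:)
    qed
    finally show ?thesis using True by simp
  qed simp
  have "ennreal a \<le> (\<integral>\<^sup>+x. ennreal (Z x) * indicator unit_cube x \<partial>lborel)" by (rule mean)
  also have "\<dots> \<le> (\<integral>\<^sup>+x. ennreal (a / 2) * indicator (unit_cube :: (real ^ 'm) set) x + (ennreal (t / 2) * (ennreal ((Z x)\<^sup>2) * indicator unit_cube x)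
      + ennreal (1 / (2 * t)) * indicator ?E x) \<partial>lborel)"
    by (intro nn_integral_mono pw)
  also have "\<dots> = ennreal (a / 2) + (ennreal (t / 2) * (\<integral>\<^sup>+x. ennreal ((Z x)\<^sup>2) * indicator unit_cube x \<partial>lborel)
      + ennreal (1 / (2 * t)) * emeasure lborel ?E)"
    by (simp add: nn_integral_add nn_integral_cmult nn_integral_cmult_indicator emeasure_unit_cube)
  also have "\<dots> \<le> ennreal (a / 2) + (ennreal (t / 2) * ennreal M + ennreal (1 / (2 * t)) * ennreal e)"
    unfolding e(2) by (intro add_mono mult_left_mono sq) auto
  also have "\<dots> = ennreal (a / 2 + (t / 2 * M + 1 / (2 * t) * e))"
    using a t M e by (simp add: ennreal_plus ennreal_mult[symmetric] del: ennreal_plus[symmetric])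
  finally have "a \<le> a / 2 + (t / 2 * M + 1 / (2 * t) * e)"
    using a t M e by (subst (asm) ennreal_le_iff) (auto intro!: add_nonneg_nonneg)
  moreover have "t / 2 * M = a / 4" using M by (simp add: t_def)
  ultimately have "a / 4 \<le> 1 / (2 * t) * e" by linarith
  then have "a / 2 * t \<le> e" using t by (simp add: field_simps)
  then have "a\<^sup>2 / (4 * M) \<le> e" by (simp add: t_def power2_eq_square)
  then show ?thesis unfolding e(2) by (rule ennreal_leI)
qed

lemma power2_sum_le:
  fixes a :: "nat \<Rightarrow> real"
  assumes "\<And>k. 0 \<le> a k"
  shows "(\<Sum>k<K. a k)\<^sup>2 \<le> 2 * (\<Sum>l<K. \<Sum>k\<le>l. a k * a l)"
proof (induction K)
  case (Suc K)
  have "(\<Sum>k<Suc K. a k)\<^sup>2 = (\<Sum>k<K. a k)\<^sup>2 + 2 * ((\<Sum>k<K. a k) * a K) + a K * a K"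
    by (simp add: power2_eq_square algebra_simps)
  also have "\<dots> \<le> 2 * (\<Sum>l<K. \<Sum>k\<le>l. a k * a l) + 2 * ((\<Sum>k<K. a k) * a K) + 2 * (a K * a K)"
    using Suc.IH by (intro add_mono) auto
  also have "\<dots> = 2 * (\<Sum>l<Suc K. \<Sum>k\<le>l. a k * a l)"
    by (simp add: lessThan_Suc_atMost[symmetric] sum_distrib_right[symmetric] algebra_simps)
  finally show ?case .
qed simp

text \<open>The finer scale \<open>l\<close> is put second in \<open>nn_integral_hits_hits\<close>.
  Up to constants the number of \<open>q\<close> times the ball volume is then 2^(kn) r_l^m, the
  reciprocal of r_k^m 2^(ln).\<close>

lemma hits_correlation:
  fixes A :: "real ^ 'n ^ 'm"
  defines "r \<equiv> rad CARD('m) CARD('n)"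
  assumes \<epsilon>: "0 < \<epsilon>" "\<epsilon> \<le> 1" and kl: "k \<le> l"
  shows "(\<integral>\<^sup>+x. ennreal (real (hits A (\<epsilon> * r k) (2 ^ k) x) * real (hits A (\<epsilon> * r l) (2 ^ l) x)) * indicator unit_cube x \<partial>lborel)
    \<le> ennreal (3 ^ CARD('n) * 8 ^ CARD('m) * 8 ^ CARD('n) * 2 ^ CARD('m) *
      (real (count_N A (r k) (2 ^ l)) / (r k ^ CARD('m) * (2 ^ l) ^ CARD('n))))"
proof -
  have r: "0 < r j" for j unfolding r_def by (rule rad_pos)
  have r1: "r j ^ CARD('m) * (2 ^ j) ^ CARD('n) = 1" for j
    unfolding r_def by (rule rad_power) (rule zero_less_card_finite)
  have rkl: "r l \<le> r k" unfolding r_def by (rule rad_antimono[OF kl])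
  have two: "(2::real) ^ k \<le> 2 ^ l" using kl by (intro power_increasing) auto
  let ?Q = "{q :: int ^ 'n. infnorm (real_vec q) \<le> 2 ^ k}"
  have Q: "real (card ?Q) \<le> 3 ^ CARD('n) * (2 ^ k) ^ CARD('n)"
  proof -
    have "real (card ?Q) \<le> (2 * 2 ^ k + 1) ^ CARD('n)" by (rule card_infnorm_real_vec_le) simp
    also have "\<dots> \<le> (3 * 2 ^ k) ^ CARD('n)" by (intro power_mono) auto
    finally show ?thesis by (simp only: power_mult_distrib)
  qed
  \<comment> \<open>8 = 4 * 2: the box is enlarged to twice (r_k, 2^l) and then covered by boxes of
    that size.\<close>
  have N: "real (count_N A (\<epsilon> * r k + \<epsilon> * r l) (2 ^ k + 2 ^ l)) \<le> 8 ^ CARD('m) * 8 ^ CARD('n) * real (count_N A (r k) (2 ^ l))"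
  proof -
    have "\<epsilon> * r k \<le> 1 * r k" "\<epsilon> * r l \<le> 1 * r l" using \<epsilon> r less_imp_le by (intro mult_right_mono; blast)+
    then have "count_N A (\<epsilon> * r k + \<epsilon> * r l) (2 ^ k + 2 ^ l) \<le> count_N A (2 * r k) (2 * 2 ^ l)"
      using rkl two by (intro count_N_mono) auto
    also have "real (count_N A (2 * r k) (2 * 2 ^ l)) \<le> (4 * (2 * r k / r k)) ^ CARD('m) * (4 * (2 * 2 ^ l / 2 ^ l)) ^ CARD('n) * real (count_N A (r k) (2 ^ l))"
      using r[of k] by (intro count_N_scale) auto
    finally show ?thesis using r[of k] by simp
  qed
  have e: "(2 * (\<epsilon> * r l)) ^ CARD('m) \<le> 2 ^ CARD('m) * r l ^ CARD('m)"
    unfolding power_mult_distrib[symmetric] using \<epsilon> r[of l] by (intro power_mono) (auto simp: mult_le_cancel_right1)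
  have inv: "(2 ^ k) ^ CARD('n) * r l ^ CARD('m) = 1 / (r k ^ CARD('m) * (2 ^ l) ^ CARD('n))"
  proof -
    have "((2 ^ k) ^ CARD('n) * r l ^ CARD('m)) * (r k ^ CARD('m) * (2 ^ l) ^ CARD('n)) =
      (r k ^ CARD('m) * (2 ^ k) ^ CARD('n)) * (r l ^ CARD('m) * (2 ^ l) ^ CARD('n))" by (simp only: mult_ac)
    then have "((2 ^ k) ^ CARD('n) * r l ^ CARD('m)) * (r k ^ CARD('m) * (2 ^ l) ^ CARD('n)) = 1"
      unfolding r1 by simp
    then show ?thesis using r[of k] by (simp add: eq_divide_eq)
  qed
  have "real (card ?Q) * real (count_N A (\<epsilon> * r k + \<epsilon> * r l) (2 ^ k + 2 ^ l)) * (2 * (\<epsilon> * r l)) ^ CARD('m)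
    \<le> (3 ^ CARD('n) * (2 ^ k) ^ CARD('n)) * (8 ^ CARD('m) * 8 ^ CARD('n) * real (count_N A (r k) (2 ^ l))) * (2 ^ CARD('m) * r l ^ CARD('m))"
    using \<epsilon> r[of l] by (intro mult_mono Q N e) auto
  also have "\<dots> = 3 ^ CARD('n) * 8 ^ CARD('m) * 8 ^ CARD('n) * 2 ^ CARD('m) *
      (real (count_N A (r k) (2 ^ l)) * ((2 ^ k) ^ CARD('n) * r l ^ CARD('m)))"
    by (simp only: mult_ac)
  also have "\<dots> = 3 ^ CARD('n) * 8 ^ CARD('m) * 8 ^ CARD('n) * 2 ^ CARD('m) *
      (real (count_N A (r k) (2 ^ l)) / (r k ^ CARD('m) * (2 ^ l) ^ CARD('n)))"
    unfolding inv by simp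
  finally show ?thesis
    using nn_integral_hits_hits[of "\<epsilon> * r k" "\<epsilon> * r l" A "2 ^ k" "2 ^ l"] \<epsilon> r[of k] r[of l]
    by (meson ennreal_leI less_imp_le mult_nonneg_nonneg order_trans)
qed

text \<open>Spanning pairs (k, l) have bounded ratio and yield the square of the sum; nonspanning
  pairs fall under \<open>sum_correlations_le\<close> and yield the linear term.\<close>

lemma sum_count_N_correlations:
  fixes A :: "real ^ 'n ^ 'm"
  defines "r \<equiv> rad CARD('m) CARD('n)"
  defines "x \<equiv> \<lambda>k. 1 / real (count_N A (r k) (2 ^ k))"
  shows "\<exists>C\<ge>1. \<forall>K. (\<Sum>l<K. \<Sum>k\<le>l. x k * x l * (real (count_N A (r k) (2 ^ l)) / (r k ^ CARD('m) * (2 ^ l) ^ CARD('n))))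
    \<le> C * ((\<Sum>k<K. x k) + (\<Sum>k<K. x k)\<^sup>2)"
proof -
  let ?D = "decay CARD('m) CARD('n)"
  let ?R = "\<lambda>k l. real (count_N A (r k) (2 ^ l)) / (r k ^ CARD('m) * (2 ^ l) ^ CARD('n))"
  define Cs where "Cs = (2 * real CARD('m + 'n) + 3) ^ CARD('n) * (2 * (real CARD('m + 'n) + 1)) ^ CARD('m)"
  define c where "c = (4 * real CARD('m + 'n)) ^ CARD('m + 'n)"
  have d0: "0 < real CARD('m + 'n)" by (rule of_nat_0_less_iff[THEN iffD2]) (rule zero_less_card_finite)
  have Cs: "0 \<le> Cs" and c: "0 < c" using d0 by (simp_all add: Cs_def c_def)
  have r: "0 < r j" for j unfolding r_def by (rule rad_pos)
  have V: "0 < r k ^ CARD('m) * (2 ^ l) ^ CARD('n)" for k l using r[of k] by simp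
  have Npos: "0 < real (count_N A (r k) (2 ^ k))" for k using count_N_pos[of "r k" "2 ^ k" A] r[of k] by simp
  have x: "0 < x k" for k using Npos[of k] by (simp add: x_def)
  obtain C where C: "C \<ge> 0" "\<And>x B K. (\<forall>k. 0 < x k) \<Longrightarrow> (\<forall>k l. 0 \<le> B k l) \<Longrightarrow>
    (\<forall>k j l. k \<le> j \<longrightarrow> j \<le> l \<longrightarrow> B k l * x j \<le> x k * x l * ?D ^ min (j - k) (l - j)) \<Longrightarrow>
    (\<Sum>l<K. \<Sum>k\<le>l. B k l) \<le> C * (\<Sum>k<K. x k :: real)"
    using sum_correlations_le[of ?D] decay_bounds[of "CARD('m)" "CARD('n)"] by auto
  \<comment> \<open>Spanning pairs are set to zero, and division by \<open>c\<close> removes the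
    constant of the hyperplane bound, as the hypothesis of \<open>sum_correlations_le\<close>
    demands constant 1.\<close>
  define B where "B k l = (if spanning A (r k) (2 ^ l) then 0 else x k * x l * ?R k l / c)" for k l
  have R0: "0 \<le> ?R k l" for k l using V[of k l] by simp
  have "(\<Sum>l<K. \<Sum>k\<le>l. B k l) \<le> C * (\<Sum>k<K. x k)" for K
  proof (rule C(2))
    have "0 \<le> x k * x l * ?R k l / c" for k l
      by (intro divide_nonneg_pos mult_nonneg_nonneg R0 less_imp_le[OF x] c)
    then show "\<forall>k l. 0 \<le> B k l" by (simp add: B_def)
    show "\<forall>k j l. k \<le> j \<longrightarrow> j \<le> l \<longrightarrow> B k l * x j \<le> x k * x l * ?D ^ min (j - k) (l - j)"
    proof (intro allI impI)
      fix k j l :: nat assume kjl: "k \<le> j" "j \<le> l"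
      have D0: "0 \<le> ?D ^ min (j - k) (l - j)" using decay_bounds[of "CARD('m)" "CARD('n)"] by (simp add: less_imp_le)
      show "B k l * x j \<le> x k * x l * ?D ^ min (j - k) (l - j)"
      proof (cases "spanning A (r k) (2 ^ l)")
        case True
        then show ?thesis using x[of k] x[of l] D0 by (simp add: B_def)
      next
        case False
        have "real (count_N A (r k) (2 ^ l)) \<le> c * (r k ^ CARD('m) * (2 ^ l) ^ CARD('n)) *
          ?D ^ min (j - k) (l - j) * real (count_N A (r j) (2 ^ j))"
          unfolding c_def r_def using kjl False by (intro count_N_rad_not_spanning) (auto simp: r_def)
        then have "?R k l \<le> c * ?D ^ min (j - k) (l - j) * real (count_N A (r j) (2 ^ j))"
          using V[of k l] by (subst pos_divide_le_eq) (auto simp: mult_ac)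
        then have "?R k l / c * x j \<le> ?D ^ min (j - k) (l - j)"
        proof -
          have "a / c * (1 / N) \<le> D'" if "a \<le> c * D' * N" "0 < N" for a D' N :: real
            using that c by (simp add: field_simps)
          then show "?R k l \<le> c * ?D ^ min (j - k) (l - j) * real (count_N A (r j) (2 ^ j)) \<Longrightarrow> ?thesis"
            unfolding x_def using Npos[of j] by blast
        qed
        then have "x k * x l * (?R k l / c * x j) \<le> x k * x l * ?D ^ min (j - k) (l - j)"
          using x by (intro mult_left_mono) (auto simp: less_imp_le)
        then show ?thesis using False by (simp add: B_def mult.assoc)
      qed
    qed
  qed (use x in auto)
  note sumB = this
  have "(\<Sum>l<K. \<Sum>k\<le>l. x k * x l * ?R k l) \<le> (1 + Cs + c * C) * ((\<Sum>k<K. x k) + (\<Sum>k<K. x k)\<^sup>2)" for K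
  proof -
    let ?S = "\<Sum>k<K. x k"
    have S0: "0 \<le> ?S" using x by (intro sum_nonneg) (auto simp: less_imp_le)
    have "(\<Sum>l<K. \<Sum>k\<le>l. x k * x l * ?R k l) \<le> (\<Sum>l<K. \<Sum>k\<le>l. Cs * (x k * x l) + c * B k l)"
    proof (intro sum_mono)
      fix k l
      show "x k * x l * ?R k l \<le> Cs * (x k * x l) + c * B k l"
      proof (cases "spanning A (r k) (2 ^ l)")
        case True
        have "real (count_N A (r k) (2 ^ l)) \<le> Cs * (r k ^ CARD('m) * (2 ^ l) ^ CARD('n))"
          unfolding Cs_def using True r[of k] by (intro count_N_le_if_spanning) auto
        then have "?R k l \<le> Cs" using V[of k l] by (subst pos_divide_le_eq) auto
        then have "x k * x l * ?R k l \<le> x k * x l * Cs"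
          using x by (intro mult_left_mono) (auto simp: less_imp_le)
        then show ?thesis using True by (simp add: B_def mult_ac)
      next
        case False
        then have "c * B k l = x k * x l * ?R k l" using c by (simp add: B_def)
        then show ?thesis using Cs x[of k] x[of l] by simp
      qed
    qed
    also have "\<dots> = Cs * (\<Sum>l<K. \<Sum>k\<le>l. x k * x l) + c * (\<Sum>l<K. \<Sum>k\<le>l. B k l)"
      by (simp add: sum.distrib sum_distrib_left)
    also have "(\<Sum>l<K. \<Sum>k\<le>l. x k * x l) \<le> (\<Sum>l<K. \<Sum>k<K. x k * x l)"
      using x by (intro sum_mono sum_mono2) (auto simp: less_imp_le)
    also have "\<dots> = ?S\<^sup>2" by (simp add: power2_eq_square sum_product mult.commute)
    also have "(\<Sum>l<K. \<Sum>k\<le>l. B k l) \<le> C * ?S" by (rule sumB)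
    finally have "(\<Sum>l<K. \<Sum>k\<le>l. x k * x l * ?R k l) \<le> Cs * ?S\<^sup>2 + c * (C * ?S)"
      using Cs c by (simp add: mult_left_mono add_mono)
    also have "\<dots> \<le> (1 + Cs + c * C) * ?S\<^sup>2 + (1 + Cs + c * C) * ?S"
      using Cs c C(1) S0 by (subst mult.assoc[symmetric]) (intro add_mono mult_right_mono, auto)
    finally show ?thesis by (simp add: distrib_left)
  qed
  moreover have "1 + Cs + c * C \<ge> 1" using Cs c C(1) by simp
  ultimately show ?thesis by blast
qed

text \<open>Outside A Z^n + Z^m no finite set of pairs can serve infinitely many scales, because the
  required distance tends to 0; so \<open>q\<close> is unbounded. Doubling epsilon turns the weak
  inequality of a hit into a strict one.\<close>

lemma near_io_if_hits:
  fixes A :: "real ^ 'n ^ 'm"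
  defines "r \<equiv> rad CARD('m) CARD('n)"
  assumes \<epsilon>: "0 < \<epsilon>"
    and io: "\<And>k0. \<exists>k\<ge>k0. hit_set A (\<epsilon> * r k) (2 ^ k) x \<noteq> {}"
    and x: "\<And>p q. x \<noteq> A *v real_vec q - real_vec p"
  shows "x \<in> near_io A (2 * \<epsilon>)"
proof (rule ccontr)
  let ?psi = "psi (CARD('n) / CARD('m))"
  assume "x \<notin> near_io A (2 * \<epsilon>)"
  then obtain k1 :: nat where k1: "\<And>q p. real k1 < infnorm (real_vec q) \<Longrightarrow>
      \<not> infnorm (A *v real_vec q - real_vec p - x) < 2 * \<epsilon> * ?psi (infnorm (real_vec q))"
    unfolding near_io_def by blast
  have r: "0 < r j" for j unfolding r_def by (rule rad_pos)
  have r1: "r k \<le> 1" for k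
    using rad_antimono[of 0 k "CARD('m)" "CARD('n)"] by (simp add: r_def rad_eq)
  define H where "H = hit_set A \<epsilon> (real k1) x"
  have small: "z \<in> H" if z: "z \<in> hit_set A (\<epsilon> * r k) (2 ^ k) x" for z k
  proof -
    obtain p q where pq: "z = (p, q)" by force
    have hit: "infnorm (A *v real_vec q - real_vec p - x) \<le> \<epsilon> * r k" "infnorm (real_vec q) \<le> 2 ^ k"
      using z by (auto simp: hit_set_def pq)
    have "infnorm (real_vec q) \<le> real k1"
    proof (rule ccontr)
      assume "\<not> ?thesis"
      then have q: "real k1 < infnorm (real_vec q)" by simp
      then have "0 < infnorm (real_vec q)" by linarith
      then have "r k \<le> ?psi (infnorm (real_vec q))"
        unfolding r_def rad_def using hit(2) by (intro psi_antimono) auto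
      then have "\<epsilon> * r k \<le> \<epsilon> * ?psi (infnorm (real_vec q))" using \<epsilon> by simp
      moreover have "0 < \<epsilon> * r k" using \<epsilon> r by simp
      ultimately show False using k1[OF q, of p] hit(1) by linarith
    qed
    moreover have "\<epsilon> * r k \<le> \<epsilon>" using \<epsilon> r1[of k] by simp
    ultimately show ?thesis using hit(1) by (simp add: H_def hit_set_def pq)
  qed
  have finH: "finite H" unfolding H_def by (rule finite_hit_set)
  define dst where "dst z = infnorm (A *v real_vec (snd z) - real_vec (fst z) - x)" for z :: "(int ^ 'm) \<times> (int ^ 'n)"
  \<comment> \<open>The 1 covers the case that \<open>H\<close> is empty.\<close>
  define \<delta> where "\<delta> = Min (insert 1 (dst ` H))"
  have "0 < y" if "y \<in> insert 1 (dst ` H)" for y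
  proof -
    have "0 < dst z" for z using x[of "snd z" "fst z"] by (simp add: dst_def infnorm_pos_lt)
    then show ?thesis using that by auto
  qed
  then have \<delta>: "0 < \<delta>" unfolding \<delta>_def using finH by (subst Min_gr_iff) auto
  then have "0 < \<delta> / \<epsilon>" using \<epsilon> by simp
  then have "\<forall>\<^sub>F k in sequentially. r k < \<delta> / \<epsilon>"
    unfolding r_def by (intro order_tendstoD(2)[OF rad_tendsto_0]) auto
  then obtain k0 where k0: "\<And>k. k \<ge> k0 \<Longrightarrow> r k < \<delta> / \<epsilon>" by (auto simp: eventually_sequentially)
  obtain k z where k: "k \<ge> k0" "z \<in> hit_set A (\<epsilon> * r k) (2 ^ k) x" using io[of k0] by blast
  have "\<delta> \<le> dst z" unfolding \<delta>_def using finH small[OF k(2)] by (intro Min_le) auto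
  also have "\<dots> \<le> \<epsilon> * r k" using k(2) by (auto simp: dst_def hit_set_def)
  also have "\<dots> < \<delta>" using k0[OF k(1)] \<epsilon> by (simp add: pos_less_divide_eq mult.commute)
  finally show False by simp
qed

lemma not_negligible_near_io:
  fixes A :: "real ^ 'n ^ 'm"
  assumes nsum: "\<not> summable (\<lambda>k. 1 / real (count_N A (rad CARD('m) CARD('n) k) (2 ^ k)))"
    and \<epsilon>: "0 < \<epsilon>" "\<epsilon> \<le> 1"
  shows "\<not> negligible (near_io A (2 * \<epsilon>))"
proof
  assume neg: "negligible (near_io A (2 * \<epsilon>))"
  define r where "r = rad CARD('m) CARD('n)"
  define xs where "xs k = 1 / real (count_N A (r k) (2 ^ k))" for k
  define S where "S K = (\<Sum>k<K. xs k)" for K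
  define h where "h k x = real (hits A (\<epsilon> * r k) (2 ^ k) x)" for k x
  define Z where "Z K x = (\<Sum>k<K. xs k * h k x)" for K x
  have r: "0 < r j" for j unfolding r_def by (rule rad_pos)
  have rn: "r j ^ CARD('m) * (2 ^ j) ^ CARD('n) = 1" for j
    unfolding r_def by (rule rad_power) (rule zero_less_card_finite)
  have xs: "0 \<le> xs k" for k by (simp add: xs_def)
  have h0: "0 \<le> h k x" for k x by (simp add: h_def)
  have [measurable]: "h k \<in> borel_measurable borel" for k unfolding h_def[abs_def] by measurable
  have Z0: "0 \<le> Z K x" for K x unfolding Z_def using xs h0 by (intro sum_nonneg mult_nonneg_nonneg)
  have [measurable]: "Z K \<in> borel_measurable borel" for K unfolding Z_def[abs_def] by measurable
  have S_mono: "S K \<le> S K'" if "K \<le> K'" for K K'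
    unfolding S_def using that xs by (intro sum_mono2) auto
  have S_unbounded: "\<exists>K. b < S K" for b
  proof (rule ccontr)
    assume "\<not> ?thesis"
    then have "S K \<le> b" for K by (meson not_less)
    then have "summable xs" using xs unfolding S_def by (intro summableI_nonneg_bounded)
    then show False using nsum by (simp add: xs_def[abs_def] r_def)
  qed
  let ?R = "\<lambda>k l. real (count_N A (r k) (2 ^ l)) / (r k ^ CARD('m) * (2 ^ l) ^ CARD('n))"
  have R0: "0 \<le> ?R k l" for k l using r[of k] by simp
  define C2 :: real where "C2 = 3 ^ CARD('n) * 8 ^ CARD('m) * 8 ^ CARD('n) * 2 ^ CARD('m)"
  have C2: "0 < C2" by (simp add: C2_def)
  have corr: "(\<integral>\<^sup>+x. ennreal (h k x * h l x) * indicator unit_cube x \<partial>lborel) \<le> ennreal (C2 * ?R k l)" if "k \<le> l" for k l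
    unfolding h_def C2_def r_def using \<epsilon> that by (rule hits_correlation)
  obtain C where C: "C \<ge> 1" "\<And>K. (\<Sum>l<K. \<Sum>k\<le>l. xs k * xs l * ?R k l) \<le> C * (S K + (S K)\<^sup>2)"
    using sum_count_N_correlations[of A] unfolding r_def xs_def S_def by blast
  have sq: "(\<integral>\<^sup>+x. ennreal ((Z K x)\<^sup>2) * indicator unit_cube x \<partial>lborel) \<le> ennreal (2 * C2 * (C * (S K + (S K)\<^sup>2)))" for K
  proof -
    have pw: "ennreal ((Z K x)\<^sup>2) * indicator unit_cube x \<le>
      (\<Sum>l<K. \<Sum>k\<le>l. ennreal (2 * (xs k * xs l)) * (ennreal (h k x * h l x) * indicator unit_cube x))" for x
    proof -
      have "(Z K x)\<^sup>2 \<le> 2 * (\<Sum>l<K. \<Sum>k\<le>l. (xs k * h k x) * (xs l * h l x))"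
        unfolding Z_def using xs h0 by (intro power2_sum_le mult_nonneg_nonneg)
      also have "\<dots> = (\<Sum>l<K. \<Sum>k\<le>l. 2 * (xs k * xs l) * (h k x * h l x))"
        by (simp add: sum_distrib_left mult_ac)
      finally have "ennreal ((Z K x)\<^sup>2) \<le> ennreal (\<Sum>l<K. \<Sum>k\<le>l. 2 * (xs k * xs l) * (h k x * h l x))"
        by (rule ennreal_leI)
      also have "\<dots> = (\<Sum>l<K. \<Sum>k\<le>l. ennreal (2 * (xs k * xs l) * (h k x * h l x)))"
      proof -
        have nn: "0 \<le> 2 * (xs k * xs l) * (h k x * h l x)" for k l
          using xs h0 by (intro mult_nonneg_nonneg) auto
        show ?thesis by (simp only: sum_ennreal sum_nonneg nn)
      qed
      also have "\<dots> = (\<Sum>l<K. \<Sum>k\<le>l. ennreal (2 * (xs k * xs l)) * ennreal (h k x * h l x))"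
        using xs h0 by (intro sum.cong refl ennreal_mult) auto
      finally have "ennreal ((Z K x)\<^sup>2) * indicator unit_cube x \<le>
        (\<Sum>l<K. \<Sum>k\<le>l. ennreal (2 * (xs k * xs l)) * ennreal (h k x * h l x)) * indicator unit_cube x"
        by (rule mult_right_mono) simp
      then show ?thesis by (simp only: sum_distrib_right mult.assoc)
    qed
    have "(\<integral>\<^sup>+x. ennreal ((Z K x)\<^sup>2) * indicator unit_cube x \<partial>lborel) \<le>
      (\<integral>\<^sup>+x. (\<Sum>l<K. \<Sum>k\<le>l. ennreal (2 * (xs k * xs l)) * (ennreal (h k x * h l x) * indicator unit_cube x)) \<partial>lborel)"
      by (intro nn_integral_mono pw)
    also have "\<dots> = (\<Sum>l<K. \<Sum>k\<le>l. ennreal (2 * (xs k * xs l)) * (\<integral>\<^sup>+x. ennreal (h k x * h l x) * indicator unit_cube x \<partial>lborel))"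
      by (simp add: nn_integral_sum nn_integral_cmult)
    also have "\<dots> \<le> (\<Sum>l<K. \<Sum>k\<le>l. ennreal (2 * (xs k * xs l)) * ennreal (C2 * ?R k l))"
      by (intro sum_mono mult_left_mono corr) auto
    also have "\<dots> = (\<Sum>l<K. \<Sum>k\<le>l. ennreal (2 * C2 * (xs k * xs l * ?R k l)))"
    proof (intro sum.cong refl)
      fix k l
      have "ennreal (2 * (xs k * xs l)) * ennreal (C2 * ?R k l) = ennreal (2 * (xs k * xs l) * (C2 * ?R k l))"
        using xs C2 R0 by (intro ennreal_mult[symmetric] mult_nonneg_nonneg) (auto simp: less_imp_le)
      also have "2 * (xs k * xs l) * (C2 * ?R k l) = 2 * C2 * (xs k * xs l * ?R k l)" by (simp only: mult_ac)
      finally show "ennreal (2 * (xs k * xs l)) * ennreal (C2 * ?R k l) = ennreal (2 * C2 * (xs k * xs l * ?R k l))" .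
    qed
    also have "\<dots> = ennreal (\<Sum>l<K. \<Sum>k\<le>l. 2 * C2 * (xs k * xs l * ?R k l))"
    proof -
      have nn: "0 \<le> 2 * C2 * (xs k * xs l * ?R k l)" for k l
        using xs C2 R0 by (intro mult_nonneg_nonneg) (auto simp: less_imp_le)
      then show ?thesis by (simp only: sum_ennreal sum_nonneg)
    qed
    also have "(\<Sum>l<K. \<Sum>k\<le>l. 2 * C2 * (xs k * xs l * ?R k l)) = 2 * C2 * (\<Sum>l<K. \<Sum>k\<le>l. xs k * xs l * ?R k l)"
      by (simp only: sum_distrib_left)
    also have "ennreal \<dots> \<le> ennreal (2 * C2 * (C * (S K + (S K)\<^sup>2)))"
      using C2 by (intro ennreal_leI mult_left_mono C(2)) auto
    finally show ?thesis .
  qed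
  have mean: "ennreal ((2 * \<epsilon>) ^ CARD('m) * S K) \<le> (\<integral>\<^sup>+x. ennreal (Z K x) * indicator unit_cube x \<partial>lborel)" for K
  proof -
    have one: "ennreal ((2 * \<epsilon>) ^ CARD('m)) \<le> (\<integral>\<^sup>+x. ennreal (h k x) * indicator unit_cube x \<partial>lborel)" for k
    proof -
      let ?Q = "{q :: int ^ 'n. infnorm (real_vec q) \<le> 2 ^ k}"
      have "(2 * \<epsilon>) ^ CARD('m) = (2 * \<epsilon>) ^ CARD('m) * (r k ^ CARD('m) * (2 ^ k) ^ CARD('n))" unfolding rn by simp
      also have "\<dots> = (2 ^ k) ^ CARD('n) * (2 * (\<epsilon> * r k)) ^ CARD('m)"
        by (simp only: power_mult_distrib mult_ac)
      also have "\<dots> \<le> real (card ?Q) * (2 * (\<epsilon> * r k)) ^ CARD('m)"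
        using \<epsilon> r[of k] by (intro mult_right_mono card_infnorm_real_vec_le) auto
      finally have "ennreal ((2 * \<epsilon>) ^ CARD('m)) \<le> ennreal (real (card ?Q) * (2 * (\<epsilon> * r k)) ^ CARD('m))"
        by (rule ennreal_leI)
      also have "\<dots> = (\<integral>\<^sup>+x. ennreal (h k x) * indicator unit_cube x \<partial>lborel)"
        unfolding h_def using \<epsilon> r[of k] by (intro nn_integral_hits[symmetric]) auto
      finally show ?thesis .
    qed
    have "ennreal ((2 * \<epsilon>) ^ CARD('m) * S K) = ennreal (\<Sum>k<K. xs k * (2 * \<epsilon>) ^ CARD('m))"
      unfolding S_def sum_distrib_left by (intro arg_cong[where f = ennreal] sum.cong refl mult.commute)
    also have "\<dots> = (\<Sum>k<K. ennreal (xs k * (2 * \<epsilon>) ^ CARD('m)))"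
      using xs \<epsilon> by (intro sum_ennreal[symmetric] mult_nonneg_nonneg) auto
    also have "\<dots> = (\<Sum>k<K. ennreal (xs k) * ennreal ((2 * \<epsilon>) ^ CARD('m)))"
      using xs \<epsilon> by (intro sum.cong refl ennreal_mult) auto
    also have "\<dots> \<le> (\<Sum>k<K. ennreal (xs k) * (\<integral>\<^sup>+x. ennreal (h k x) * indicator unit_cube x \<partial>lborel))"
      by (intro sum_mono mult_left_mono one) auto
    also have "\<dots> = (\<integral>\<^sup>+x. (\<Sum>k<K. ennreal (xs k) * (ennreal (h k x) * indicator unit_cube x)) \<partial>lborel)"
      by (simp add: nn_integral_sum nn_integral_cmult)
    also have "\<dots> = (\<integral>\<^sup>+x. ennreal (Z K x) * indicator unit_cube x \<partial>lborel)"
    proof (intro nn_integral_cong)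
      fix x
      have "ennreal (Z K x) = (\<Sum>k<K. ennreal (xs k * h k x))"
        unfolding Z_def using xs h0 by (intro sum_ennreal[symmetric] mult_nonneg_nonneg)
      also have "\<dots> = (\<Sum>k<K. ennreal (xs k) * ennreal (h k x))"
        using xs h0 by (intro sum.cong refl ennreal_mult) auto
      finally show "(\<Sum>k<K. ennreal (xs k) * (ennreal (h k x) * indicator unit_cube x)) = ennreal (Z K x) * indicator unit_cube x"
        by (simp only: sum_distrib_right mult.assoc)
    qed
    finally show ?thesis .
  qed
  define a where "a K = (2 * \<epsilon>) ^ CARD('m) * S K" for K
  define E where "E K = {x \<in> unit_cube. a K / 2 < Z K x}" for K
  have [measurable]: "E K \<in> sets borel" for K unfolding E_def by measurable
  \<comment> \<open>This is a^2 / (4 M) after the powers of \<open>S K\<close> have cancelled, so it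
    does not depend on \<open>K\<close>.\<close>
  define c0 where "c0 = ((2 * \<epsilon>) ^ CARD('m))\<^sup>2 / (16 * C2 * C)"
  have c0: "0 < c0" using \<epsilon> C2 C(1) by (simp add: c0_def)
  \<comment> \<open>From \<open>K1\<close> on the linear term in the second moment is dominated by
    the quadratic one.\<close>
  obtain K1 where K1: "1 < S K1" using S_unbounded by blast
  have E_large: "ennreal c0 \<le> emeasure lborel (E K)" if "K1 \<le> K" for K
  proof -
    have S1: "1 < S K" using K1 S_mono[OF that] by linarith
    define M where "M = 2 * C2 * (C * (2 * (S K)\<^sup>2))"
    have "S K * 1 \<le> S K * S K" using S1 by (intro mult_left_mono) auto
    then have "S K + (S K)\<^sup>2 \<le> 2 * (S K)\<^sup>2" by (simp add: power2_eq_square)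
    then have "2 * C2 * (C * (S K + (S K)\<^sup>2)) \<le> M"
      unfolding M_def using C2 C(1) by (intro mult_left_mono) auto
    then have sqM: "(\<integral>\<^sup>+x. ennreal ((Z K x)\<^sup>2) * indicator unit_cube x \<partial>lborel) \<le> ennreal M"
      by (intro order_trans[OF sq] ennreal_leI)
    have M0: "0 < M" using C2 C(1) S1 by (simp add: M_def)
    have a0: "0 < a K" using \<epsilon> S1 by (simp add: a_def)
    have "ennreal ((a K)\<^sup>2 / (4 * M)) \<le> emeasure lborel (E K)"
      unfolding E_def using Z0 a0 M0 mean[folded a_def] sqM by (intro Paley_Zygmund_unit_cube) auto
    moreover have "(a K)\<^sup>2 / (4 * M) = c0"
      using S1 C2 C(1) by (simp add: a_def M_def c0_def power_mult_distrib field_simps)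
    ultimately show ?thesis by simp
  qed
  \<comment> \<open>The sets \<open>E K\<close> need not be nested; continuity from above along
    their tails gives measure at least \<open>c0\<close> to the points that lie in infinitely many
    of them.\<close>
  define B where "B n = (\<Union>K\<in>{n..}. E K)" for n
  have [measurable]: "B n \<in> sets borel" for n unfolding B_def by measurable
  have B_large: "ennreal c0 \<le> emeasure lborel (B n)" for n
  proof -
    have "ennreal c0 \<le> emeasure lborel (E (max n K1))" by (rule E_large) simp
    also have "\<dots> \<le> emeasure lborel (B n)"
    proof (rule emeasure_mono)
      show "E (max n K1) \<subseteq> B n" unfolding B_def by (rule UN_upper) simp
    qed simp
    finally show ?thesis .
  qed
  have B_fin: "emeasure lborel (B n) \<noteq> \<infinity>" for n
  proof -
    have "emeasure lborel (B n) \<le> emeasure lborel (unit_cube :: (real ^ 'm) set)"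
      by (intro emeasure_mono) (auto simp: B_def E_def)
    then have "emeasure lborel (B n) < \<infinity>" unfolding emeasure_unit_cube by (rule le_less_trans) simp
    then show ?thesis by simp
  qed
  have "decseq B" unfolding B_def decseq_def by (intro allI impI UN_mono) auto
  then have lim: "(\<lambda>n. emeasure lborel (B n)) \<longlonglongrightarrow> emeasure lborel (\<Inter>n. B n)"
    using B_fin by (intro Lim_emeasure_decseq) auto
  have le: "ennreal c0 \<le> emeasure lborel (\<Inter>n. B n)"
    by (rule LIMSEQ_le_const[OF lim]) (use B_large in blast)
  \<comment> \<open>Points of \<open>G\<close> may be hit by one pair at all large scales; they form
    a countable, hence null, set.\<close>
  define G where "G = range (\<lambda>z :: (int ^ 'm) \<times> (int ^ 'n). A *v real_vec (snd z) - real_vec (fst z))"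
  have "(\<Inter>n. B n) \<subseteq> near_io A (2 * \<epsilon>) \<union> G"
  proof
    fix x assume xB: "x \<in> (\<Inter>n. B n)"
    show "x \<in> near_io A (2 * \<epsilon>) \<union> G"
    proof (cases "x \<in> G")
      case False
      have "\<exists>k\<ge>k0. hit_set A (\<epsilon> * r k) (2 ^ k) x \<noteq> {}" for k0
      proof (rule ccontr)
        assume none: "\<not> ?thesis"
        have hz: "h k x = 0" if "k \<ge> k0" for k using none that by (auto simp: h_def hits_def)
        \<comment> \<open>If the hits stop at \<open>k0\<close>, then \<open>Z K x\<close> no longer
          changes, while the thresholds \<open>a K / 2\<close> grow without bound.\<close>
        have const: "Z K x = Z k0 x" if "k0 \<le> K" for K
          unfolding Z_def using that hz by (intro sum.mono_neutral_right) auto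
        obtain K2 where K2: "2 * Z k0 x / (2 * \<epsilon>) ^ CARD('m) < S K2" using S_unbounded by blast
        have "x \<in> B (max k0 K2)" using xB by blast
        then obtain K where K: "max k0 K2 \<le> K" "x \<in> E K" unfolding B_def by blast
        have "2 * Z k0 x / (2 * \<epsilon>) ^ CARD('m) < S K" using K2 S_mono[of K2 K] K(1) by linarith
        then have "2 * Z k0 x < a K" using \<epsilon> by (simp add: a_def pos_divide_less_eq mult.commute)
        moreover have "a K / 2 < Z k0 x" using K const[of K] by (simp add: E_def)
        ultimately show False by linarith
      qed
      moreover have "x \<noteq> A *v real_vec q - real_vec p" for p q
      proof
        assume "x = A *v real_vec q - real_vec p"
        then have "x \<in> G" unfolding G_def by (intro range_eqI[of _ _ "(p, q)"]) simp
        then show False using False by contradiction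
      qed
      ultimately have "x \<in> near_io A (2 * \<epsilon>)"
        unfolding r_def using \<epsilon> by (intro near_io_if_hits) auto
      then show ?thesis by simp
    qed simp
  qed
  moreover have "negligible G"
    unfolding G_def negligible_iff_null_sets by (intro null_sets_completionI countable_imp_null_set_lborel) simp
  ultimately have "negligible (\<Inter>n. B n)" using neg by (meson negligible_Un negligible_subset)
  moreover have "(\<Inter>n. B n) \<in> sets borel" by measurable
  ultimately have "emeasure lborel (\<Inter>n. B n) = 0"
    using negligible_iff_emeasure0[of "\<Inter>n. B n"] by simp
  then show False using le c0 by simp
qed

lemma negligible_Compl_near_io:
  fixes A :: "real ^ 'n ^ 'm"
  assumes nsum: "\<not> summable (\<lambda>k. 1 / real (count_N A (rad CARD('m) CARD('n) k) (2 ^ k)))"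
    and \<epsilon>: "0 < \<epsilon>"
  shows "negligible (- near_io A \<epsilon>)"
proof -
  let ?b = "2 powr (real CARD('n) / real CARD('m))"
  \<comment> \<open>\<open>\<eta>\<close> leaves room for both losses: 2 from weak to strict
    inequality and \<open>?b\<close> from the translations.\<close>
  define \<eta> where "\<eta> = min 1 (\<epsilon> / (2 * ?b))"
  have \<eta>: "0 < \<eta>" "\<eta> \<le> 1" using \<epsilon> by (auto simp: \<eta>_def)
  have "\<eta> \<le> \<epsilon> / (2 * ?b)" by (simp add: \<eta>_def)
  then have le: "?b * (2 * \<eta>) \<le> \<epsilon>" by (simp add: field_simps)
  have "near_io A (?b * (2 * \<eta>)) \<subseteq> near_io A \<epsilon>"
  proof
    fix x assume x: "x \<in> near_io A (?b * (2 * \<eta>))"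
    have "?b * (2 * \<eta>) * psi (CARD('n) / CARD('m)) t \<le> \<epsilon> * psi (CARD('n) / CARD('m)) t" for t
      using le by (intro mult_right_mono) (auto simp: psi_def)
    then show "x \<in> near_io A \<epsilon>" using x unfolding near_io_def by (blast intro: less_le_trans)
  qed
  moreover have "negligible (- near_io A (?b * (2 * \<eta>)))"
    using nsum \<eta> by (intro negligible_Compl_near_io_if not_negligible_near_io) auto
  ultimately show ?thesis by (meson Compl_subset_Compl_iff negligible_subset)
qed

section \<open>From limsup sets to \<open>Bad\<close> and \<open>c_inf\<close>\<close>

lemma approx_set_null:
  fixes A :: "real ^ 'n ^ 'm"
  assumes "summable (\<lambda>k. 1 / real (count_N A (rad CARD('m) CARD('n) k) (2 ^ k)))" "0 < \<epsilon>"
  shows "approx_set A (\<lambda>q. \<epsilon> * psi (CARD('n) / CARD('m)) q) \<in> null_sets torus_measure"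
  using negligible_near_io[OF assms] by (intro null_sets_torus_measureI) (simp add: near_io_eq_vimage)

lemma Bad_eps_null:
  fixes A :: "real ^ 'n ^ 'm"
  assumes "\<not> summable (\<lambda>k. 1 / real (count_N A (rad CARD('m) CARD('n) k) (2 ^ k)))" "0 < \<epsilon>"
  shows "Bad_eps A \<epsilon> \<in> null_sets torus_measure"
  using negligible_Compl_near_io[OF assms]
  by (intro null_sets_torus_measureI) (simp add: near_io_eq_vimage Bad_eps_def vimage_Diff Compl_eq_Diff_UNIV)

definition quot :: "real ^ 'n ^ 'm \<Rightarrow> 'm torus \<Rightarrow> int ^ 'n \<Rightarrow> real"
  where "quot A b q = znorm (to_torus (A *v real_vec q) - b) / psi (CARD('n) / CARD('m)) (infnorm (real_vec q))"

lemma quot_nonneg: "0 \<le> quot A b q"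
proof -
  obtain x where "b = to_torus x" by (metis to_torus.abs_eq Quotient_torus Quotient_abs_rep)
  then show ?thesis by (simp add: quot_def znorm_nonneg psi_def)
qed

text \<open>Balls contain finitely many integer vectors, so norms tending to infinity define the
  cofinite filter on Z^n.\<close>

lemma eventually_infnorm_real_vec_iff:
  "eventually P (filtercomap (\<lambda>q :: int ^ 'n. infnorm (real_vec q)) at_top) \<longleftrightarrow> finite {q. \<not> P q}"
proof
  assume "eventually P (filtercomap (\<lambda>q :: int ^ 'n. infnorm (real_vec q)) at_top)"
  then obtain R where R: "\<And>q. R \<le> infnorm (real_vec q) \<Longrightarrow> P q"
    unfolding eventually_filtercomap_at_top_linorder by blast
  have "{q. \<not> P q} \<subseteq> {q. infnorm (real_vec q) \<le> R}"
  proof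
    fix q assume "q \<in> {q. \<not> P q}"
    then show "q \<in> {q. infnorm (real_vec q) \<le> R}" using R[of q] by (cases "R \<le> infnorm (real_vec q)") auto
  qed
  then show "finite {q. \<not> P q}" using finite_infnorm_real_vec_le finite_subset by blast
next
  assume fin: "finite {q. \<not> P q}"
  define M where "M = Max (insert 0 ((\<lambda>q. infnorm (real_vec q)) ` {q. \<not> P q}))"
  have "P q" if "M < infnorm (real_vec q)" for q
  proof (rule ccontr)
    assume "\<not> P q"
    then have "infnorm (real_vec q) \<le> M" unfolding M_def using fin by (intro Max_ge) auto
    then show False using that by simp
  qed
  then show "eventually P (filtercomap (\<lambda>q :: int ^ 'n. infnorm (real_vec q)) at_top)"
    unfolding eventually_filtercomap_at_top_dense by blast
qed

lemma notin_approx_set_iff: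
  fixes A :: "real ^ 'n ^ 'm"
  shows "b \<notin> approx_set A (\<lambda>q. \<epsilon> * psi (CARD('n) / CARD('m)) q) \<longleftrightarrow>
    eventually (\<lambda>q. \<epsilon> \<le> quot A b q) (filtercomap (\<lambda>q :: int ^ 'n. infnorm (real_vec q)) at_top)"
proof -
  let ?X = "{q :: int ^ 'n. q \<noteq> 0 \<and> znorm (to_torus (A *v real_vec q) - b) < \<epsilon> * psi (CARD('n) / CARD('m)) (infnorm (real_vec q))}"
  have "znorm (to_torus (A *v real_vec q) - b) < \<epsilon> * psi (CARD('n) / CARD('m)) (infnorm (real_vec q)) \<longleftrightarrow>
    \<not> \<epsilon> \<le> quot A b q" if "q \<noteq> 0" for q
  proof -
    have "real_vec q \<noteq> 0" using that by (auto simp: real_vec_def vec_eq_iff)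
    then have "0 < psi (CARD('n) / CARD('m)) (infnorm (real_vec q))" by (simp add: psi_def infnorm_eq_0)
    then show ?thesis by (simp add: quot_def not_le pos_divide_less_eq)
  qed
  \<comment> \<open>At \<open>q = 0\<close> both \<open>psi\<close> and, through division by zero,
    \<open>quot\<close> are 0; a single vector does not affect finiteness.\<close>
  then have X: "?X = {q. \<not> \<epsilon> \<le> quot A b q} - {0}" by blast
  show ?thesis unfolding eventually_infnorm_real_vec_iff approx_set_def mem_Collect_eq not_not X by simp
qed

lemma c_inf_eq: "c_inf A b = Liminf (filtercomap (\<lambda>q. infnorm (real_vec q)) at_top) (\<lambda>q. ereal (quot A b q))"
  by (simp add: c_inf_def quot_def)

text \<open>A positive liminf exceeds some 1 / (j + 1), and then almost all quotients do. The
  countable union reduces \<open>Bad\<close> to the sets with fixed epsilon.\<close>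

lemma Bad_subset:
  fixes A :: "real ^ 'n ^ 'm"
  shows "Bad A \<subseteq> (\<Union>j. Bad_eps A (1 / real (Suc j)))"
proof
  fix b assume "b \<in> Bad A"
  then have "0 < c_inf A b" by (simp add: Bad_def)
  then obtain e where e: "ereal 0 < ereal e" "ereal e < c_inf A b"
    using ereal_dense2[of 0 "c_inf A b"] by (metis zero_ereal_def)
  then have "0 < e" by simp
  then obtain j where j: "1 / real (Suc j) < e"
    using reals_Archimedean[of e] by (auto simp: inverse_eq_divide)
  have "eventually (\<lambda>q. ereal e < ereal (quot A b q)) (filtercomap (\<lambda>q. infnorm (real_vec q)) at_top)"
    using e(2) unfolding c_inf_eq by (rule less_LiminfD)
  then have "eventually (\<lambda>q. 1 / real (Suc j) \<le> quot A b q) (filtercomap (\<lambda>q. infnorm (real_vec q)) at_top)"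
    by (rule eventually_mono) (use j in simp)
  then have "b \<notin> approx_set A (\<lambda>q. 1 / real (Suc j) * psi (CARD('n) / CARD('m)) q)"
    using notin_approx_set_iff[of b A "1 / real (Suc j)"] by blast
  then show "b \<in> (\<Union>j. Bad_eps A (1 / real (Suc j)))" unfolding Bad_eps_def by blast
qed

text \<open>Lying outside every set of the union makes the liminf at least every positive
  integer.\<close>

lemma Compl_Bad_infinity_subset:
  fixes A :: "real ^ 'n ^ 'm"
  shows "UNIV - Bad_infinity A \<subseteq> (\<Union>j. approx_set A (\<lambda>q. real (Suc j) * psi (CARD('n) / CARD('m)) q))"
proof
  fix b assume "b \<in> UNIV - Bad_infinity A"
  then have "c_inf A b \<noteq> \<infinity>" by (simp add: Bad_infinity_def)
  then have "\<exists>j. \<not> ereal (real (Suc j)) \<le> c_inf A b"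
  proof (rule contrapos_np)
    assume "\<nexists>j. \<not> ereal (real (Suc j)) \<le> c_inf A b"
    then have *: "ereal (real (Suc j)) \<le> c_inf A b" for j by blast
    show "c_inf A b = \<infinity>"
    proof (rule ereal_top)
      fix B
      obtain j :: nat where "B \<le> real j" using real_arch_simple by blast
      then have "ereal B \<le> ereal (real (Suc j))" by simp
      then show "ereal B \<le> c_inf A b" using * order_trans by blast
    qed
  qed
  then obtain j where j: "\<not> ereal (real (Suc j)) \<le> c_inf A b" by blast
  have "b \<in> approx_set A (\<lambda>q. real (Suc j) * psi (CARD('n) / CARD('m)) q)"
  proof (rule ccontr)
    assume "\<not> ?thesis"
    then have "eventually (\<lambda>q. ereal (real (Suc j)) \<le> ereal (quot A b q)) (filtercomap (\<lambda>q. infnorm (real_vec q)) at_top)"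
      using notin_approx_set_iff[of b A "real (Suc j)"] by simp
    then have "ereal (real (Suc j)) \<le> c_inf A b" unfolding c_inf_eq by (rule Liminf_bounded)
    then show False using j by blast
  qed
  then show "b \<in> (\<Union>j. approx_set A (\<lambda>q. real (Suc j) * psi (CARD('n) / CARD('m)) q))" by blast
qed

lemma c_inf_nonneg: "0 \<le> c_inf A b"
  unfolding c_inf_eq by (intro Liminf_bounded always_eventually allI) (simp add: quot_nonneg)

text \<open>Completeness, inherited from Lebesgue measure. It supplies the measurability of
  \<open>Bad\<close> and \<open>Bad_infinity\<close>, which are reached only by inclusion in null
  sets or through their complements.\<close>

lemma null_sets_torus_subset:
  assumes "T \<in> null_sets torus_measure" "S \<subseteq> T"
  shows "S \<in> null_sets (torus_measure :: 'm::finite torus measure)"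
proof (rule null_sets_torus_measureI[OF negligible_if_negligible_Int_unit_cube])
  have T: "T \<in> sets torus_measure" using assms(1) by auto
  have "emeasure lebesgue (to_torus -` T \<inter> unit_cube) = 0"
    using assms(1) emeasure_torus_measure[OF T] by (simp add: unit_cube_def null_setsD1)
  moreover have "to_torus -` T \<inter> unit_cube \<in> sets lebesgue"
    using T by (intro sets.Int) (auto simp: sets_torus_measure)
  ultimately have "negligible (to_torus -` T \<inter> unit_cube)" by (simp add: negligible_iff_emeasure0)
  then show "negligible (to_torus -` S \<inter> unit_cube)"
    by (rule negligible_subset) (use assms(2) in auto)
qed (simp add: to_torus_minus_real_vec)

theorem proposition2p2:
  fixes A :: "real ^ 'n ^ 'm"
  shows
    "(\<forall>k. ratio_M A (psi (CARD('n) / CARD('m)) (2 ^ k)) (2 ^ k) = 1 / real (count_N A (psi (CARD('n) / CARD('m)) (2 ^ k)) (2 ^ k))) \<and>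
     (\<exists>C>0. \<forall>k.
        inverse C * Delta A k \<le> ratio_M A (psi (CARD('n) / CARD('m)) (2 ^ k)) (2 ^ k) \<and>
        ratio_M A (psi (CARD('n) / CARD('m)) (2 ^ k)) (2 ^ k) \<le> C * Delta A k) \<and>
     (AE b in torus_measure. c_inf A b = (if \<not> summable (Delta A) then 0 else \<infinity>)) \<and>
     (\<not> summable (Delta A) \<longrightarrow>
       (\<forall>\<epsilon>>0. Bad_eps A \<epsilon> \<in> null_sets torus_measure) \<and>
       Bad A \<in> null_sets torus_measure \<and>
       Bad_infinity A \<in> null_sets torus_measure) \<and>
     (summable (Delta A) \<longrightarrow>
       (\<forall>\<epsilon>>0. UNIV - Bad_eps A \<epsilon> \<in> null_sets torus_measure) \<and>
       UNIV - Bad A \<in> null_sets torus_measure \<and>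
       UNIV - Bad_infinity A \<in> null_sets torus_measure)"
proof -
  let ?r = "rad CARD('m) CARD('n)"
  let ?x = "\<lambda>k. 1 / real (count_N A (?r k) (2 ^ k))"
  have ratio: "ratio_M A (?r k) (2 ^ k) = ?x k" for k
    using rad_power[of "CARD('m)" "CARD('n)" k] by (simp add: ratio_M_def)
  obtain C where C: "C \<ge> 1" "\<And>k. Delta A k \<le> C * ?x k" "\<And>k. ?x k \<le> C * Delta A k"
    using inverse_count_N_asymp_Delta[of A] by blast
  have lower: "inverse C * Delta A k \<le> ?x k" for k
    using C(1) C(2)[of k] by (simp add: inverse_eq_divide pos_divide_le_eq mult.commute)
  have x0: "0 \<le> ?x k" for k by simp
  \<comment> \<open>Nonnegativity of \<open>Delta\<close> is read off the comparison with the
    reciprocal counts.\<close>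
  have Delta0: "0 \<le> Delta A k" for k
  proof -
    have "0 \<le> C * Delta A k" using x0[of k] C(3)[of k] by linarith
    then show ?thesis using C(1) by (simp add: zero_le_mult_iff)
  qed
  have summable_iff: "summable (Delta A) \<longleftrightarrow> summable ?x"
  proof
    assume "summable (Delta A)"
    then have "summable (\<lambda>k. C * Delta A k)" by (rule summable_mult)
    then show "summable ?x" by (rule summable_comparison_test') (use C(3) in simp)
  next
    assume "summable ?x"
    then have "summable (\<lambda>k. C * ?x k)" by (rule summable_mult)
    then show "summable (Delta A)" by (rule summable_comparison_test') (use C(2) Delta0 in simp)
  qed
  have div: "(\<forall>\<epsilon>>0. Bad_eps A \<epsilon> \<in> null_sets torus_measure) \<and> Bad A \<in> null_sets torus_measure \<and>
      Bad_infinity A \<in> null_sets torus_measure" if "\<not> summable (Delta A)"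
  proof -
    have eps: "Bad_eps A \<epsilon> \<in> null_sets torus_measure" if "\<epsilon> > 0" for \<epsilon>
      using \<open>\<not> summable (Delta A)\<close> that unfolding summable_iff by (rule Bad_eps_null)
    have "(\<Union>j. Bad_eps A (1 / real (Suc j))) \<in> null_sets torus_measure"
      by (intro null_sets_UN eps) simp
    then have "Bad A \<in> null_sets torus_measure" using Bad_subset by (rule null_sets_torus_subset)
    moreover have "Bad_infinity A \<subseteq> Bad A" by (auto simp: Bad_infinity_def Bad_def)
    ultimately show ?thesis using eps null_sets_torus_subset by blast
  qed
  have conv: "(\<forall>\<epsilon>>0. UNIV - Bad_eps A \<epsilon> \<in> null_sets torus_measure) \<and> UNIV - Bad A \<in> null_sets torus_measure \<and>
      UNIV - Bad_infinity A \<in> null_sets torus_measure" if "summable (Delta A)"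
  proof -
    have eps: "approx_set A (\<lambda>q. \<epsilon> * psi (CARD('n) / CARD('m)) q) \<in> null_sets torus_measure" if "\<epsilon> > 0" for \<epsilon>
      using \<open>summable (Delta A)\<close> that unfolding summable_iff by (rule approx_set_null)
    have "(\<Union>j. approx_set A (\<lambda>q. real (Suc j) * psi (CARD('n) / CARD('m)) q)) \<in> null_sets torus_measure"
      by (intro null_sets_UN eps) simp
    then have "UNIV - Bad_infinity A \<in> null_sets torus_measure"
      using Compl_Bad_infinity_subset by (rule null_sets_torus_subset)
    moreover have "UNIV - Bad A \<subseteq> UNIV - Bad_infinity A" by (auto simp: Bad_infinity_def Bad_def)
    moreover have "UNIV - Bad_eps A \<epsilon> = approx_set A (\<lambda>q. \<epsilon> * psi (CARD('n) / CARD('m)) q)" for \<epsilon>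
      by (auto simp: Bad_eps_def)
    ultimately show ?thesis using eps null_sets_torus_subset by simp blast
  qed
  have "AE b in torus_measure. c_inf A b = (if \<not> summable (Delta A) then 0 else \<infinity>)"
  proof (cases "summable (Delta A)")
    case True
    then show ?thesis using conv by (intro AE_I'[of "UNIV - Bad_infinity A"]) (auto simp: Bad_infinity_def)
  next
    case False
    have "c_inf A b = 0" if "b \<notin> Bad A" for b
      using that c_inf_nonneg[of A b] by (simp add: Bad_def)
    then show ?thesis using div False by (intro AE_I'[of "Bad A"]) auto
  qed
  moreover have "\<exists>C>0. \<forall>k. inverse C * Delta A k \<le> ratio_M A (?r k) (2 ^ k) \<and> ratio_M A (?r k) (2 ^ k) \<le> C * Delta A k"
    using C(1) C(3) lower unfolding ratio by (intro exI[of _ C]) auto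
  ultimately show ?thesis using ratio div conv unfolding rad_def by blast
qed

end
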